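(* Let $G$ be a $3$-regular graph. Then $G$ is a complete intersection if and only if every connected component of $G$ is an odd band or an even Möbius band.
   Context: Graphs are finite, simple (no loops, no multiple edges) and undirected; a graph is $3$-regular if every vertex has degree $3$. Let $k$ be an arbitrary field. For a graph $G$ with $V(G)=\{v_1,\ldots,v_m\}$ and $E(G)=\{e_1,\ldots,e_n\}$, the toric ideal $P_G$ of $G$ is the kernel of the $k$-algebra homomorphism $k[x_1,\ldots,x_n]\to k[t_1,\ldots,t_m]$ with $x_i\mapsto t_jt_l$ whenever $e_i=\{v_j,v_l\}$. $G$ is a complete intersection if $\mu(P_G)=\mathrm{ht}(P_G)$, where $\mu(P_G)$ is the minimal number of generators of $P_G$. A chain is a graph $H$ with $V(H)=\{a_1,\ldots,a_r,b_1,\ldots,b_r\}$ ($2r$ distinct vertices) and edges $\{a_i,a_{i+1}\}$, $\{b_i,b_{i+1}\}$ for $1\le i<r$ and $\{a_j,b_j\}$ for $1\le j\le r$. A graph obtained from such a chain $H$ on the same vertex set is a band if its edge set is $E(H)\cup\{\{a_1,a_r\},\{b_1,b_r\}\}$, and a Möbius band if its edge set is $E(H)\cup\{\{a_1,b_r\},\{a_r,b_1\}\}$. It is called odd or even according to whether $r$ is odd or even. *)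

theory Defs
  imports
    "HOL-Algebra.Ideal"
    "HOL-Algebra.RingHom"
    "HOL-Library.Poly_Mapping"
    "HOL-Library.Extended_Nat"
begin

section \<open>Graphs\<close>

text \<open>A graph is given by its vertex set \<open>V\<close> and its set \<open>E\<close> of edges, each edge being the
  set of its two end points. Loops and multiple edges are thereby excluded.\<close>

definition simple_graph :: "'v set \<Rightarrow> 'v set set \<Rightarrow> bool" where
  "simple_graph V E \<longleftrightarrow> finite V \<and> (\<forall>e\<in>E. e \<subseteq> V \<and> card e = 2)"

definition degree :: "'v set set \<Rightarrow> 'v \<Rightarrow> nat" where
  "degree E v = card {e \<in> E. v \<in> e}"

definition regular :: "nat \<Rightarrow> 'v set \<Rightarrow> 'v set set \<Rightarrow> bool" where
  "regular d V E \<longleftrightarrow> (\<forall>v\<in>V. degree E v = d)"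

definition adjacency :: "'v set set \<Rightarrow> ('v \<times> 'v) set" where
  "adjacency E = {(u, v). {u, v} \<in> E}"

definition induced_edges :: "'v set set \<Rightarrow> 'v set \<Rightarrow> 'v set set" where
  "induced_edges E C = {e \<in> E. e \<subseteq> C}"

definition components :: "'v set \<Rightarrow> 'v set set \<Rightarrow> ('v set \<times> 'v set set) set" where
  "components V E =
     (\<lambda>v. let C = {u. (v, u) \<in> (adjacency E)\<^sup>*} in (C, induced_edges E C)) ` V"

subsection \<open>Bands and Moebius bands\<close>

definition chain_vertices :: "nat \<Rightarrow> (nat \<Rightarrow> 'v) \<Rightarrow> (nat \<Rightarrow> 'v) \<Rightarrow> 'v set" where
  "chain_vertices r a b = a ` {1..r} \<union> b ` {1..r}"

definition chain_edges :: "nat \<Rightarrow> (nat \<Rightarrow> 'v) \<Rightarrow> (nat \<Rightarrow> 'v) \<Rightarrow> 'v set set" where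
  "chain_edges r a b =
     {{a i, a (i + 1)} | i. 1 \<le> i \<and> i < r} \<union>
     {{b i, b (i + 1)} | i. 1 \<le> i \<and> i < r} \<union>
     {{a j, b j} | j. 1 \<le> j \<and> j \<le> r}"

definition chain_labelling :: "nat \<Rightarrow> (nat \<Rightarrow> 'v) \<Rightarrow> (nat \<Rightarrow> 'v) \<Rightarrow> bool" where
  "chain_labelling r a b \<longleftrightarrow>
     r \<ge> 1 \<and> inj_on a {1..r} \<and> inj_on b {1..r} \<and> a ` {1..r} \<inter> b ` {1..r} = {}"

text \<open>The condition \<^const>\<open>simple_graph\<close> rules out the band with \<open>r = 1\<close>, whose two extra
  edges would be loops. For \<open>r = 2\<close> the Moebius band is the complete graph on four vertices,
  whereas the two extra edges of the band coincide with edges of the chain.\<close>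

definition is_band :: "nat \<Rightarrow> 'v set \<Rightarrow> 'v set set \<Rightarrow> bool" where
  "is_band r V E \<longleftrightarrow> simple_graph V E \<and>
     (\<exists>a b. chain_labelling r a b \<and> V = chain_vertices r a b \<and>
            E = chain_edges r a b \<union> {{a 1, a r}, {b 1, b r}})"

definition is_moebius_band :: "nat \<Rightarrow> 'v set \<Rightarrow> 'v set set \<Rightarrow> bool" where
  "is_moebius_band r V E \<longleftrightarrow> simple_graph V E \<and>
     (\<exists>a b. chain_labelling r a b \<and> V = chain_vertices r a b \<and>
            E = chain_edges r a b \<union> {{a 1, b r}, {a r, b 1}})"

definition odd_band :: "'v set \<Rightarrow> 'v set set \<Rightarrow> bool" where
  "odd_band V E \<longleftrightarrow> (\<exists>r. odd r \<and> is_band r V E)"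

definition even_moebius_band :: "'v set \<Rightarrow> 'v set set \<Rightarrow> bool" where
  "even_moebius_band V E \<longleftrightarrow> (\<exists>r. even r \<and> is_moebius_band r V E)"

section \<open>Height and number of generators of an ideal\<close>

definition prime_chain :: "('a, 'm) ring_scheme \<Rightarrow> 'a set \<Rightarrow> nat \<Rightarrow> (nat \<Rightarrow> 'a set) \<Rightarrow> bool" where
  "prime_chain R P n c \<longleftrightarrow>
     (\<forall>i\<le>n. primeideal (c i) R) \<and> (\<forall>i<n. c i \<subset> c (Suc i)) \<and> c n = P"

definition prime_height :: "('a, 'm) ring_scheme \<Rightarrow> 'a set \<Rightarrow> enat" where
  "prime_height R P = (SUP n \<in> {n. \<exists>c. prime_chain R P n c}. enat n)"

definition height :: "('a, 'm) ring_scheme \<Rightarrow> 'a set \<Rightarrow> enat" where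
  "height R I = (INF P \<in> {P. primeideal P R \<and> I \<subseteq> P}. prime_height R P)"

text \<open>The value is \<open>\<infinity>\<close> if the ideal is not finitely generated.\<close>

definition min_generators :: "('a, 'm) ring_scheme \<Rightarrow> 'a set \<Rightarrow> enat" where
  "min_generators R I =
     (INF S \<in> {S. finite S \<and> S \<subseteq> carrier R \<and> Idl\<^bsub>R\<^esub> S = I}. enat (card S))"

section \<open>Multivariate polynomials\<close>

text \<open>A monomial is a finitely supported exponent vector \<open>'x \<Rightarrow>\<^sub>0 nat\<close>.\<close>

type_synonym ('x, 'k) mpoly = "('x \<Rightarrow>\<^sub>0 nat) \<Rightarrow>\<^sub>0 'k"

definition mvar :: "'x \<Rightarrow> ('x, 'k::field) mpoly" where
  "mvar x = Poly_Mapping.single (Poly_Mapping.single x 1) 1"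

definition mconst :: "'k::field \<Rightarrow> ('x, 'k) mpoly" where
  "mconst c = Poly_Mapping.single 0 c"

definition poly_ring :: "'x set \<Rightarrow> ('x, 'k::field) mpoly ring" where
  "poly_ring X =
     \<lparr>carrier = {p. \<forall>m \<in> Poly_Mapping.keys p. Poly_Mapping.keys m \<subseteq> X},
      mult = (*), one = 1, zero = 0, add = (+)\<rparr>"

text \<open>The homomorphism of \<open>k\<close>-algebras that sends each variable \<open>x\<close> to \<open>f x\<close>.\<close>

definition poly_subst :: "('x \<Rightarrow> ('y, 'k) mpoly) \<Rightarrow> ('x, 'k::field) mpoly \<Rightarrow> ('y, 'k) mpoly" where
  "poly_subst f p =
     (\<Sum>m \<in> Poly_Mapping.keys p. mconst (Poly_Mapping.lookup p m) *
        (\<Prod>x \<in> Poly_Mapping.keys m. f x ^ Poly_Mapping.lookup m x))"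

section \<open>Toric ideals of graphs\<close>

text \<open>The variables of the source ring are the edges and those of the target ring are the
  vertices.\<close>

definition toric_hom :: "('v set, 'k::field) mpoly \<Rightarrow> ('v, 'k) mpoly" where
  "toric_hom = poly_subst (\<lambda>e. \<Prod>v\<in>e. mvar v)"

definition toric_ideal :: "'v set \<Rightarrow> 'v set set \<Rightarrow> ('v set, 'k::field) mpoly set" where
  "toric_ideal V E = a_kernel (poly_ring E) (poly_ring V) toric_hom"

definition complete_intersection :: "'k::field itself \<Rightarrow> 'v set \<Rightarrow> 'v set set \<Rightarrow> bool" where
  "complete_intersection _ V E \<longleftrightarrow>
     (let R = poly_ring E; P = (toric_ideal V E :: ('v set, 'k) mpoly set)
      in min_generators R P = height R P)"

end

theory Submission
  imports Defs
begin

text \<open>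
  Give a monomial in the edges its degree vector on the vertices. The toric ideal \<open>P\<close> consists of
  the polynomials whose coefficients add up to zero over all monomials of any fixed degree. Let
  \<open>q\<close> be the dimension of the rational kernel of the incidence matrix; it appears below as
  \<open>card (E - B)\<close> for a maximal set \<open>B\<close> of linearly independent columns.

  The height of \<open>P\<close> is \<open>q\<close> (\<open>toric_height\<close>). A chain of \<open>q\<close> primes below \<open>P\<close> comes from making
  the edges outside \<open>B\<close> independent one after the other. No chain is longer, since every step down
  a chain of primes adds an algebraically independent element to the \<open>card B\<close> monomials that are
  independent modulo \<open>P\<close>, and there are at most \<open>card E\<close> of them.

  Generators are counted degree by degree. Link two monomials of the same degree if they share a
  variable. A class of linked monomials is a slot if it is not the distinguished class of its
  degree. Every generating set has at least as many elements as there are slots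
  (\<open>card_slots_le_generators\<close>), and the differences between slots and distinguished classes span
  the kernel (\<open>slots_span\<close>), so there are at least \<open>q\<close> slots. A complete intersection therefore has exactly \<open>q\<close> slots.

  In a cubic graph, the kernel vectors that vanish on the edges at a vertex \<open>v\<close> have codimension
  at most two and are spanned by the slots whose degree vanishes at \<open>v\<close>. So in a complete
  intersection at most two slots involve \<open>v\<close>. On the other hand each slot involves at least four
  vertices, and \<open>2 * q \<ge> card V\<close> because there are \<open>3 * card V / 2\<close> edges and \<open>B\<close> has at most
  \<open>card V\<close> of them. Counting incidences forces equality everywhere (\<open>ci_slot_counts\<close>): each slot
  is a four-cycle of the graph, each vertex lies on exactly two of them, and no component is
  bipartite. The two squares at a vertex share an edge, its rung, and the squares string the rungs
  together to a closed ladder, which is a band or a Moebius band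
  (\<open>component_is_band\<close>); the complete graph on four vertices is the Moebius band with two rungs.
  Even bands and odd Moebius bands are bipartite, hence excluded.

  Conversely, in an odd band or an even Moebius band with \<open>r\<close> rungs the relations of its \<open>r\<close>
  squares, rail times opposite rail minus rung times next rung, generate all relations: rewriting
  rails into rungs leads to a normal form that is determined by the degree
  (\<open>squares_generate\<close>, \<open>cyclic_ladder_balanced\<close>). So \<open>card V / 2 \<le> q\<close> elements generate \<open>P\<close>, and
  fewer than \<open>q\<close> never suffice.
\<close>


section \<open>Homogeneous linear systems\<close>

text \<open>Every dimension count in the proof is an application of this lemma; it is Gaussian elimination,
  which uses one equation to eliminate one unknown.\<close>

lemma nontrivial_solution:
  fixes A :: "'i \<Rightarrow> 'j \<Rightarrow> 'k::field"
  assumes "finite J" "finite I" "card J < card I"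
  shows "\<exists>c. (\<exists>i\<in>I. c i \<noteq> 0) \<and> (\<forall>j\<in>J. (\<Sum>i\<in>I. c i * A i j) = 0)"
  using assms
proof (induction J arbitrary: I A rule: finite_induct)
  case empty
  then obtain i where "i \<in> I" by fastforce
  then show ?case by (intro exI[of _ "\<lambda>_. 1"]) auto
next
  case (insert j J)
  show ?case
  proof (cases "\<forall>i\<in>I. A i j = 0")
    case True
    from insert.IH[of I A] insert.prems insert.hyps obtain c where
      c: "\<exists>i\<in>I. c i \<noteq> 0" "\<forall>j\<in>J. (\<Sum>i\<in>I. c i * A i j) = 0" by auto
    then show ?thesis using True by (intro exI[of _ c]) auto
  next
    case False
    then obtain i0 where i0: "i0 \<in> I" "A i0 j \<noteq> 0" by auto
    define A' where "A' = (\<lambda>i l. A i l - A i j / A i0 j * A i0 l)"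
    have "card J < card (I - {i0})"
      using insert.prems insert.hyps i0 by simp
    from insert.IH[of "I - {i0}" A'] this insert.prems obtain c where
      c: "\<exists>i\<in>I - {i0}. c i \<noteq> 0" "\<forall>l\<in>J. (\<Sum>i\<in>I - {i0}. c i * A' i l) = 0" by auto
    define d where "d = (\<lambda>i. if i = i0 then - (\<Sum>i\<in>I - {i0}. c i * A i j / A i0 j) else c i)"
    have split: "(\<Sum>i\<in>I. d i * A i l) = (\<Sum>i\<in>I - {i0}. c i * A' i l)" for l
    proof -
      have "(\<Sum>i\<in>I. d i * A i l) = d i0 * A i0 l + (\<Sum>i\<in>I - {i0}. d i * A i l)"
        using insert.prems(1) i0(1) by (simp add: sum.remove)
      also have "(\<Sum>i\<in>I - {i0}. d i * A i l) = (\<Sum>i\<in>I - {i0}. c i * A i l)"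
        by (intro sum.cong) (auto simp: d_def)
      also have "d i0 * A i0 l = (\<Sum>i\<in>I - {i0}. - (c i * A i j / A i0 j * A i0 l))"
        by (simp add: d_def sum_distrib_right sum_negf)
      finally show ?thesis
        by (simp add: A'_def sum.distrib[symmetric] algebra_simps)
    qed
    have "(\<Sum>i\<in>I. d i * A i l) = 0" if "l \<in> insert j J" for l
    proof (cases "l = j")
      case True
      then show ?thesis unfolding split using i0 by (simp add: A'_def)
    qed (use that split c in auto)
    moreover have "\<exists>i\<in>I. d i \<noteq> 0" using c by (auto simp: d_def)
    ultimately show ?thesis by blast
  qed
qed

section \<open>Linear functionals and monomial maps on polynomials\<close>

abbreviation keys :: "('a \<Rightarrow>\<^sub>0 'b::zero) \<Rightarrow> 'a set" where "keys \<equiv> Poly_Mapping.keys"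
abbreviation lookup :: "('a \<Rightarrow>\<^sub>0 'b::zero) \<Rightarrow> 'a \<Rightarrow> 'b" where "lookup \<equiv> Poly_Mapping.lookup"
abbreviation single :: "'a \<Rightarrow> 'b::zero \<Rightarrow> 'a \<Rightarrow>\<^sub>0 'b" where "single \<equiv> Poly_Mapping.single"

lemma poly_mapping_as_sum: "(\<Sum>m\<in>keys p. single m (lookup p m)) = p"
proof (rule poly_mapping_eqI)
  fix k
  have "lookup (\<Sum>m\<in>keys p. single m (lookup p m)) k = (\<Sum>m\<in>keys p. if m = k then lookup p m else 0)"
    by (simp add: lookup_sum lookup_single when_def)
  then show "lookup (\<Sum>m\<in>keys p. single m (lookup p m)) k = lookup p k"
    by (simp add: in_keys_iff)
qed

lemma sum_over_superset:
  assumes "finite M" "keys p \<subseteq> M" "\<And>m. h m 0 = 0"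
  shows "(\<Sum>m\<in>keys p. h m (lookup p m)) = (\<Sum>m\<in>M. h m (lookup p m))"
  by (rule sum.mono_neutral_left) (use assms in \<open>auto simp: in_keys_iff\<close>)

definition lin :: "('m \<Rightarrow> 'k) \<Rightarrow> ('m \<Rightarrow>\<^sub>0 'k::field) \<Rightarrow> 'k" where
  "lin w p = (\<Sum>m\<in>keys p. w m * lookup p m)"

lemma lin_superset:
  assumes "finite M" "keys p \<subseteq> M"
  shows "lin w p = (\<Sum>m\<in>M. w m * lookup p m)"
  unfolding lin_def by (rule sum_over_superset[OF assms]) simp

lemma lin_zero [simp]: "lin w 0 = 0"
  by (simp add: lin_def)

lemma lin_add: "lin w (p + q) = lin w p + lin w q"
proof -
  let ?M = "keys p \<union> keys q"
  have "keys (p + q) \<subseteq> ?M" by (rule keys_add)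
  then show ?thesis
    by (simp add: lin_superset[of ?M] lookup_add sum.distrib algebra_simps)
qed

lemma lin_uminus: "lin w (- p) = - lin w p"
  using lin_add[of w p "- p"] by (simp add: eq_neg_iff_add_eq_0 add.commute)

lemma lin_diff: "lin w (p - q) = lin w p - lin w q"
  using lin_add[of w p "- q"] by (simp add: lin_uminus)

lemma lin_sum: "lin w (sum f A) = (\<Sum>a\<in>A. lin w (f a))"
  by (induction A rule: infinite_finite_induct) (auto simp: lin_add)

lemma lin_single [simp]: "lin w (single m c) = w m * c"
  by (simp add: lin_def)

lemma lookup_eq_lin: "lookup p k = lin (\<lambda>m. of_bool (m = k)) p"
proof -
  have "lin (\<lambda>m. of_bool (m = k)) p = (\<Sum>m\<in>keys p. if m = k then lookup p m else 0)"
    unfolding lin_def by (intro sum.cong) auto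
  also have "\<dots> = lookup p k"
    by (simp add: in_keys_iff)
  finally show ?thesis by simp
qed

lemma lin_single_mult:
  fixes p :: "('m::comm_monoid_add) \<Rightarrow>\<^sub>0 'k::field"
  shows "lin w (single a c * p) = c * lin (\<lambda>m. w (a + m)) p"
proof -
  have "lin w (single a c * p) = lin w (\<Sum>m\<in>keys p. single a c * single m (lookup p m))"
    by (simp add: sum_distrib_left[symmetric] poly_mapping_as_sum)
  also have "\<dots> = c * lin (\<lambda>m. w (a + m)) p"
    by (simp add: mult_single lin_sum lin_def[of _ p] sum_distrib_left mult_ac)
  finally show ?thesis .
qed

lemma lin_mult:
  fixes p :: "('m::comm_monoid_add) \<Rightarrow>\<^sub>0 'k::field"
  shows "lin w (h * p) = (\<Sum>a\<in>keys h. lookup h a * lin (\<lambda>m. w (a + m)) p)"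
proof -
  have "lin w (h * p) = lin w ((\<Sum>a\<in>keys h. single a (lookup h a)) * p)"
    by (simp add: poly_mapping_as_sum)
  also have "\<dots> = (\<Sum>a\<in>keys h. lookup h a * lin (\<lambda>m. w (a + m)) p)"
    by (simp add: sum_distrib_right lin_sum lin_single_mult)
  finally show ?thesis .
qed

definition mon_hom :: "('m \<Rightarrow> 'n) \<Rightarrow> ('m \<Rightarrow>\<^sub>0 'k::field) \<Rightarrow> ('n \<Rightarrow>\<^sub>0 'k)" where
  "mon_hom \<psi> p = (\<Sum>m\<in>keys p. single (\<psi> m) (lookup p m))"

lemma lookup_mon_hom: "lookup (mon_hom \<psi> p) n = lin (\<lambda>m. of_bool (\<psi> m = n)) p"
  unfolding mon_hom_def lin_def lookup_sum
  by (intro sum.cong) (auto simp: lookup_single when_def)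

lemma mon_hom_eq_0_iff: "mon_hom \<psi> p = 0 \<longleftrightarrow> (\<forall>n. lin (\<lambda>m. of_bool (\<psi> m = n)) p = 0)"
  by (simp add: poly_mapping_eq_iff fun_eq_iff lookup_mon_hom)

lemma mon_hom_mult:
  fixes p q :: "('m::comm_monoid_add) \<Rightarrow>\<^sub>0 'k::field" and \<psi> :: "'m \<Rightarrow> 'n::comm_monoid_add"
  assumes "\<And>a b. \<psi> (a + b) = \<psi> a + \<psi> b"
  shows "mon_hom \<psi> (p * q) = mon_hom \<psi> p * mon_hom \<psi> q"
proof (rule poly_mapping_eqI)
  fix n
  have "lookup (mon_hom \<psi> (p * q)) n =
    (\<Sum>a\<in>keys p. lookup p a * lin (\<lambda>m. of_bool (\<psi> a + \<psi> m = n)) q)"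
    by (simp add: lookup_mon_hom lin_mult assms)
  also have "\<dots> = (\<Sum>a\<in>keys p. \<Sum>b\<in>keys q. lookup p a * (of_bool (\<psi> a + \<psi> b = n) * lookup q b))"
    by (simp only: lin_def sum_distrib_left)
  also have "\<dots> = lookup (\<Sum>a\<in>keys p. \<Sum>b\<in>keys q. single (\<psi> a + \<psi> b) (lookup p a * lookup q b)) n"
    unfolding lookup_sum by (intro sum.cong) (auto simp: lookup_single when_def)
  also have "(\<Sum>a\<in>keys p. \<Sum>b\<in>keys q. single (\<psi> a + \<psi> b) (lookup p a * lookup q b)) =
      mon_hom \<psi> p * mon_hom \<psi> q"
    by (simp add: mon_hom_def sum_product mult_single)
  finally show "lookup (mon_hom \<psi> (p * q)) n = lookup (mon_hom \<psi> p * mon_hom \<psi> q) n" .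
qed

text \<open>A functional whose weights are constant on the fibres of \<open>\<phi>\<close> only sees the sums of the
  coefficients over the fibres.\<close>

lemma lin_fiber_const:
  fixes p :: "'m \<Rightarrow>\<^sub>0 'k::field"
  assumes fib: "\<And>d. lin (\<lambda>m. of_bool (\<phi> m = d)) p = 0"
    and const: "\<And>m m'. m \<in> keys p \<Longrightarrow> m' \<in> keys p \<Longrightarrow> \<phi> m = \<phi> m' \<Longrightarrow> w m = w m'"
  shows "lin w p = 0"
proof -
  have "lin w p = (\<Sum>d\<in>\<phi> ` keys p. \<Sum>m\<in>{m \<in> keys p. \<phi> m = d}. w m * lookup p m)"
    unfolding lin_def by (rule sum.image_gen) simp
  also have "\<dots> = (\<Sum>d\<in>\<phi> ` keys p. 0)"
  proof (rule sum.cong[OF refl])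
    fix d assume "d \<in> \<phi> ` keys p"
    then obtain m0 where m0: "m0 \<in> keys p" "\<phi> m0 = d" by auto
    have "(\<Sum>m\<in>{m \<in> keys p. \<phi> m = d}. w m * lookup p m) =
        (\<Sum>m\<in>keys p. w m0 * (of_bool (\<phi> m = d) * lookup p m))"
    proof (rule sum.mono_neutral_cong_left)
      show "w m * lookup p m = w m0 * (of_bool (\<phi> m = d) * lookup p m)"
        if "m \<in> {m \<in> keys p. \<phi> m = d}" for m
        using const[of m m0] m0 that by simp
    qed auto
    also have "\<dots> = w m0 * lin (\<lambda>m. of_bool (\<phi> m = d)) p"
      by (simp only: lin_def sum_distrib_left)
    finally show "(\<Sum>m\<in>{m \<in> keys p. \<phi> m = d}. w m * lookup p m) = 0" using fib by simp
  qed
  finally show ?thesis by simp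
qed

section \<open>Polynomial rings\<close>

definition mons :: "'x set \<Rightarrow> ('x \<Rightarrow>\<^sub>0 nat) set" where
  "mons X = {m. keys m \<subseteq> X}"

lemma zero_in_mons [simp]: "0 \<in> mons X"
  by (simp add: mons_def)

lemma keys_add_nat: "keys (a + b :: 'x \<Rightarrow>\<^sub>0 nat) = keys a \<union> keys b"
  by (auto simp: in_keys_iff lookup_add)

lemma add_in_mons_iff [simp]: "a + b \<in> mons X \<longleftrightarrow> a \<in> mons X \<and> b \<in> mons X"
  by (auto simp: mons_def keys_add_nat)

lemma single_in_mons: "x \<in> X \<Longrightarrow> single x n \<in> mons X"
  by (auto simp: mons_def)

lemma poly_ring_simps [simp]:
  "x \<otimes>\<^bsub>poly_ring X\<^esub> y = x * y" "x \<oplus>\<^bsub>poly_ring X\<^esub> y = x + y"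
  "\<one>\<^bsub>poly_ring X\<^esub> = 1" "\<zero>\<^bsub>poly_ring X\<^esub> = 0"
  by (simp_all add: poly_ring_def)

lemma carrier_poly_ring: "carrier (poly_ring X) = {p. keys p \<subseteq> mons X}"
  by (auto simp: poly_ring_def mons_def)

lemma carrier_zero: "0 \<in> carrier (poly_ring X)"
  by (simp add: carrier_poly_ring)

lemma carrier_one: "1 \<in> carrier (poly_ring X)"
  by (simp add: carrier_poly_ring)

lemma carrier_single: "m \<in> mons X \<Longrightarrow> single m c \<in> carrier (poly_ring X)"
  by (simp add: carrier_poly_ring)

lemma carrier_mconst: "mconst c \<in> carrier (poly_ring X)"
  by (simp add: mconst_def carrier_single)

lemma carrier_mvar: "x \<in> X \<Longrightarrow> mvar x \<in> carrier (poly_ring X)"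
  by (simp add: mvar_def carrier_single single_in_mons)

lemma carrier_add:
  "p \<in> carrier (poly_ring X) \<Longrightarrow> q \<in> carrier (poly_ring X) \<Longrightarrow> p + q \<in> carrier (poly_ring X)"
  unfolding carrier_poly_ring using keys_add[of p q] by blast

lemma keys_uminus: "keys (- p :: 'a \<Rightarrow>\<^sub>0 'b::ab_group_add) = keys p"
  by (auto simp: in_keys_iff)

lemma carrier_uminus: "p \<in> carrier (poly_ring X) \<Longrightarrow> - p \<in> carrier (poly_ring X)"
  by (simp add: carrier_poly_ring keys_uminus)

lemma carrier_diff:
  "p \<in> carrier (poly_ring X) \<Longrightarrow> q \<in> carrier (poly_ring X) \<Longrightarrow> p - q \<in> carrier (poly_ring X)"
  using carrier_add[OF _ carrier_uminus, of p X q] by simp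

lemma carrier_mult:
  assumes "p \<in> carrier (poly_ring X)" "q \<in> carrier (poly_ring X)"
  shows "p * q \<in> carrier (poly_ring X)"
proof -
  have "keys (p * q) \<subseteq> {a + b |a b. a \<in> keys p \<and> b \<in> keys q}" by (rule keys_mult)
  then show ?thesis using assms unfolding carrier_poly_ring by fastforce
qed

lemma carrier_power: "p \<in> carrier (poly_ring X) \<Longrightarrow> p ^ n \<in> carrier (poly_ring X)"
  by (induction n) (auto simp: carrier_one carrier_mult)

lemma carrier_sum:
  "(\<And>a. a \<in> A \<Longrightarrow> f a \<in> carrier (poly_ring X)) \<Longrightarrow> sum f A \<in> carrier (poly_ring X)"
  by (induction A rule: infinite_finite_induct) (auto simp: carrier_zero carrier_add)

lemmas carrier_intros = carrier_zero carrier_one carrier_single carrier_mconst carrier_mvar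
  carrier_add carrier_uminus carrier_diff carrier_mult carrier_power carrier_sum

lemma poly_ring_cring: "cring (poly_ring X)"
proof (rule cringI)
  show "abelian_group (poly_ring X)"
  proof (rule abelian_groupI)
    fix x assume x: "x \<in> carrier (poly_ring X)"
    show "\<exists>y\<in>carrier (poly_ring X). y \<oplus>\<^bsub>poly_ring X\<^esub> x = \<zero>\<^bsub>poly_ring X\<^esub>"
      using carrier_uminus[OF x] by (intro bexI[of _ "- x"]) simp_all
  qed (simp_all add: carrier_add carrier_zero add_ac)
  show "comm_monoid (poly_ring X)"
    by (rule comm_monoidI) (simp_all add: carrier_mult carrier_one mult_ac)
qed (simp add: algebra_simps)

lemma poly_ring_ring: "ring (poly_ring X)"
  using poly_ring_cring by (rule cring.axioms)

lemma poly_ring_idealI: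
  assumes sub: "I \<subseteq> carrier (poly_ring X)" and z: "0 \<in> I"
    and add: "\<And>a b. a \<in> I \<Longrightarrow> b \<in> I \<Longrightarrow> a + b \<in> I"
    and mult: "\<And>a h. a \<in> I \<Longrightarrow> h \<in> carrier (poly_ring X) \<Longrightarrow> h * a \<in> I"
  shows "ideal I (poly_ring X :: ('x, 'k::field) mpoly ring)"
proof (rule idealI)
  let ?R = "poly_ring X :: ('x, 'k) mpoly ring"
  interpret cring ?R by (rule poly_ring_cring)
  have neg: "- a \<in> I" if "a \<in> I" for a
    using mult[OF that carrier_uminus[OF carrier_one]] by simp
  show "ring ?R" by (rule poly_ring_ring)
  show "subgroup I (add_monoid ?R)"
  proof (rule add.subgroupI)
    show "I \<subseteq> carrier ?R" "I \<noteq> {}" using sub z by auto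
    show "\<ominus>\<^bsub>?R\<^esub> a \<in> I" if "a \<in> I" for a
    proof -
      have "\<ominus>\<^bsub>?R\<^esub> a = - a"
        by (rule minus_equality) (use that sub in \<open>auto intro: carrier_intros\<close>)
      then show ?thesis using neg that by simp
    qed
  qed (use add in auto)
qed (use mult in \<open>auto simp: mult.commute\<close>)

lemma poly_ring_idealD:
  assumes "ideal I (poly_ring X :: ('x, 'k::field) mpoly ring)"
  shows "I \<subseteq> carrier (poly_ring X)" "0 \<in> I"
    "a \<in> I \<Longrightarrow> b \<in> I \<Longrightarrow> a + b \<in> I" "a \<in> I \<Longrightarrow> b \<in> I \<Longrightarrow> a - b \<in> I"
    "a \<in> I \<Longrightarrow> h \<in> carrier (poly_ring X) \<Longrightarrow> h * a \<in> I"
proof -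
  interpret ideal I "poly_ring X :: ('x, 'k) mpoly ring" by fact
  show "I \<subseteq> carrier (poly_ring X)" "0 \<in> I" using a_subset additive_subgroup.zero_closed[OF is_additive_subgroup] by simp_all
  show add: "a \<in> I \<Longrightarrow> b \<in> I \<Longrightarrow> a + b \<in> I" for a b
    using additive_subgroup.a_closed[OF is_additive_subgroup] by simp
  show mult: "a \<in> I \<Longrightarrow> h \<in> carrier (poly_ring X) \<Longrightarrow> h * a \<in> I" for a h
    using I_l_closed by simp
  show "a \<in> I \<Longrightarrow> b \<in> I \<Longrightarrow> a - b \<in> I"
    using add[of a "- b"] mult[OF _ carrier_uminus[OF carrier_one], of b] by simp
qed

lemma poly_ring_ideal_sum:
  assumes "ideal I (poly_ring X :: ('x, 'k::field) mpoly ring)" "\<And>a. a \<in> A \<Longrightarrow> f a \<in> I"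
  shows "sum f A \<in> I"
  using assms(2) by (induction A rule: infinite_finite_induct) (auto intro: poly_ring_idealD[OF assms(1)])

section \<open>Weighted degrees and the ideals of their fibres\<close>

definition wdeg :: "('x \<Rightarrow> nat) \<Rightarrow> ('x \<Rightarrow>\<^sub>0 nat) \<Rightarrow> nat" where
  "wdeg W m = (\<Sum>x\<in>keys m. W x * lookup m x)"

lemma wdeg_superset: "finite M \<Longrightarrow> keys m \<subseteq> M \<Longrightarrow> wdeg W m = (\<Sum>x\<in>M. W x * lookup m x)"
  unfolding wdeg_def by (rule sum_over_superset) auto

lemma wdeg_zero [simp]: "wdeg W 0 = 0"
  by (simp add: wdeg_def)

lemma wdeg_add [simp]: "wdeg W (a + b) = wdeg W a + wdeg W b"
  using wdeg_superset[of "keys a \<union> keys b"]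
  by (simp add: keys_add_nat lookup_add sum.distrib algebra_simps)

lemma wdeg_single [simp]: "wdeg W (single x n) = W x * n"
  by (simp add: wdeg_def)

lemma wdeg_eq_0_iff: "wdeg W m = 0 \<longleftrightarrow> (\<forall>x\<in>keys m. W x = 0)"
  by (auto simp: wdeg_def in_keys_iff)

lemma wdeg_of_bool [simp]: "wdeg (\<lambda>y. of_bool (y = x)) m = lookup m x"
proof -
  have "wdeg (\<lambda>y. of_bool (y = x)) m = (\<Sum>y\<in>keys m. if y = x then lookup m y else 0)"
    unfolding wdeg_def by (intro sum.cong) auto
  then show ?thesis by (simp add: in_keys_iff)
qed

text \<open>For the exponents of a monomial parametrisation as \<open>\<phi>\<close>, this is the toric ideal of the
  parametrisation. In this form its multiplicative structure is hidden, but ideals for finer and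
  coarser \<open>\<phi>\<close> are easily compared.\<close>

definition fib_ideal :: "'x set \<Rightarrow> (('x \<Rightarrow>\<^sub>0 nat) \<Rightarrow> 'd) \<Rightarrow> ('x, 'k::field) mpoly set" where
  "fib_ideal X \<phi> = {p \<in> carrier (poly_ring X). \<forall>d. lin (\<lambda>m. of_bool (\<phi> m = d)) p = 0}"

lemma fib_ideal_lin_zero:
  assumes "p \<in> fib_ideal X \<phi>"
    and "\<And>m m'. m \<in> mons X \<Longrightarrow> m' \<in> mons X \<Longrightarrow> \<phi> m = \<phi> m' \<Longrightarrow> w m = w m'"
  shows "lin w p = 0"
proof (rule lin_fiber_const[of \<phi> p])
  show "lin (\<lambda>m. of_bool (\<phi> m = d)) p = 0" for d
    using assms(1) by (simp add: fib_ideal_def)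
  show "w m = w m'" if "m \<in> keys p" "m' \<in> keys p" "\<phi> m = \<phi> m'" for m m'
    by (rule assms(2)[OF _ _ that(3)]) (use that(1,2) assms(1) in \<open>auto simp: fib_ideal_def carrier_poly_ring\<close>)
qed

lemma fib_ideal_mono:
  assumes "\<And>m m'. m \<in> mons X \<Longrightarrow> m' \<in> mons X \<Longrightarrow> \<phi> m = \<phi> m' \<Longrightarrow> \<phi>' m = \<phi>' m'"
  shows "fib_ideal X \<phi> \<subseteq> (fib_ideal X \<phi>' :: ('x, 'k::field) mpoly set)"
proof
  fix p :: "('x, 'k) mpoly" assume p: "p \<in> fib_ideal X \<phi>"
  have "lin (\<lambda>m. of_bool (\<phi>' m = d)) p = 0" for d
  proof (rule fib_ideal_lin_zero[OF p])
    fix m m' assume "m \<in> mons X" "m' \<in> mons X" "\<phi> m = \<phi> m'"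
    then have "\<phi>' m = \<phi>' m'" by (rule assms)
    then show "of_bool (\<phi>' m = d) = (of_bool (\<phi>' m' = d) :: 'k)" by simp
  qed
  then show "p \<in> fib_ideal X \<phi>'" using p by (simp add: fib_ideal_def)
qed

lemma binomial_in_fib_ideal_iff:
  assumes "m \<in> mons X" "m' \<in> mons X"
  shows "single m 1 - single m' 1 \<in> fib_ideal X \<phi> \<longleftrightarrow> \<phi> m = \<phi> m'"
  using assms by (auto simp: fib_ideal_def lin_diff carrier_intros split: if_splits)

text \<open>The weights \<open>c\<close> are the powers of the base \<open>D\<close>, and the numbers \<open>x j\<close> are the digits.\<close>

lemma digit_weights:
  assumes "finite J"
  shows "\<exists>c :: 'j \<Rightarrow> nat. \<forall>x y. (\<forall>j\<in>J. x j < D \<and> y j < D) \<longrightarrow>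
    (\<Sum>j\<in>J. c j * x j) = (\<Sum>j\<in>J. c j * y j) \<longrightarrow> (\<forall>j\<in>J. x j = y j)"
  using assms
proof (induction J rule: finite_induct)
  case (insert j0 J)
  from insert.IH obtain c :: "'j \<Rightarrow> nat" where
    c: "\<forall>x y. (\<forall>j\<in>J. x j < D \<and> y j < D) \<longrightarrow>
      (\<Sum>j\<in>J. c j * x j) = (\<Sum>j\<in>J. c j * y j) \<longrightarrow> (\<forall>j\<in>J. x j = y j)" by (rule exE)
  define c' where "c' = (\<lambda>j. if j = j0 then 1 else D * c j)"
  have ex: "(\<Sum>j\<in>insert j0 J. c' j * x j) = x j0 + D * (\<Sum>j\<in>J. c j * x j)" for x
  proof -
    have "(\<Sum>j\<in>J. c' j * x j) = (\<Sum>j\<in>J. D * (c j * x j))"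
      using insert.hyps by (intro sum.cong) (auto simp: c'_def)
    then show ?thesis using insert.hyps by (simp add: c'_def sum_distrib_left)
  qed
  show ?case
  proof (intro exI[of _ c'] allI impI)
    fix x y :: "'j \<Rightarrow> nat"
    assume b: "\<forall>j\<in>insert j0 J. x j < D \<and> y j < D"
      and eq: "(\<Sum>j\<in>insert j0 J. c' j * x j) = (\<Sum>j\<in>insert j0 J. c' j * y j)"
    let ?X = "\<Sum>j\<in>J. c j * x j" and ?Y = "\<Sum>j\<in>J. c j * y j"
    have e: "x j0 + D * ?X = y j0 + D * ?Y" using eq by (simp only: ex)
    then have "(x j0 + D * ?X) mod D = (y j0 + D * ?Y) mod D" by simp
    then have 1: "x j0 = y j0" using b by simp
    moreover have "?X = ?Y" using e 1 b by (cases "D = 0") auto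
    moreover from this have "\<forall>j\<in>J. x j = y j" 
      using b by (intro c[THEN spec, THEN spec, THEN mp, THEN mp, of x y]) auto
    ultimately show "\<forall>j\<in>insert j0 J. x j = y j" by simp
  qed
qed simp

text \<open>A product of two polynomials is tested after the substitution \<open>x \<mapsto> t ^ W x\<close> into the
  polynomials in one variable \<open>t\<close>, which form a domain. The exponents \<open>W\<close> depend on the two
  polynomials: they are chosen such that the substitution does not merge distinct fibres that
  meet the two factors.\<close>

lemma fib_ideal_prime:
  fixes A :: "'j \<Rightarrow> 'x \<Rightarrow> nat"
  assumes "finite J" and zero: "\<And>j x. j \<notin> J \<Longrightarrow> x \<in> X \<Longrightarrow> A j x = 0"
  shows "primeideal (fib_ideal X (\<lambda>m j. wdeg (A j) m)) (poly_ring X :: ('x, 'k::field) mpoly ring)"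
proof (rule primeidealI)
  let ?R = "poly_ring X :: ('x, 'k) mpoly ring"
  let ?\<phi> = "\<lambda>m j. wdeg (A j) m"
  let ?I = "fib_ideal X ?\<phi> :: ('x, 'k) mpoly set"
  show "ideal ?I ?R"
  proof (rule poly_ring_idealI)
    fix a h :: "('x, 'k) mpoly" assume a: "a \<in> ?I" and h: "h \<in> carrier ?R"
    have "lin (\<lambda>m. of_bool (?\<phi> m = d)) (h * a) = 0" for d
      unfolding lin_mult
      by (intro sum.neutral ballI mult_eq_0_iff[THEN iffD2] disjI2 fib_ideal_lin_zero[OF a])
        (simp add: fun_eq_iff)
    then show "h * a \<in> ?I" using a h by (auto simp: fib_ideal_def carrier_intros)
  qed (auto simp: fib_ideal_def lin_add carrier_intros)
  show "cring ?R" by (rule poly_ring_cring)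
  have "lin (\<lambda>m. of_bool (?\<phi> m = (\<lambda>j. 0))) (1 :: ('x, 'k) mpoly) = 1"
    using lin_single[of "\<lambda>m. of_bool (?\<phi> m = (\<lambda>j. 0))" 0 "1 :: 'k"] by simp
  then have "1 \<notin> ?I" by (auto simp: fib_ideal_def) (metis zero_neq_one)
  then show "carrier ?R \<noteq> ?I" using carrier_one by blast
  fix f g assume f: "f \<in> carrier ?R" and g: "g \<in> carrier ?R" and fg: "f \<otimes>\<^bsub>?R\<^esub> g \<in> ?I"
  \<comment> \<open>\<open>D\<close> exceeds every degree that occurs in one of the two factors.\<close>
  define M where "M = keys f \<union> keys g"
  define D where "D = Suc (\<Sum>m\<in>M. \<Sum>j\<in>J. wdeg (A j) m)"
  have D: "wdeg (A j) m < D" if "m \<in> M" "j \<in> J" for m j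
  proof -
    have "wdeg (A j) m \<le> (\<Sum>j\<in>J. wdeg (A j) m)"
      using \<open>finite J\<close> that by (intro member_le_sum) auto
    also have "\<dots> \<le> (\<Sum>m\<in>M. \<Sum>j\<in>J. wdeg (A j) m)"
      using that by (intro member_le_sum) (auto simp: M_def)
    finally show ?thesis by (simp add: D_def)
  qed
  obtain c :: "'j \<Rightarrow> nat" where
    c: "\<forall>x y. (\<forall>j\<in>J. x j < D \<and> y j < D) \<longrightarrow>
      (\<Sum>j\<in>J. c j * x j) = (\<Sum>j\<in>J. c j * y j) \<longrightarrow> (\<forall>j\<in>J. x j = y j)"
    using digit_weights[OF \<open>finite J\<close>, of D] by (rule exE)
  define \<psi> where "\<psi> = (\<lambda>m. \<Sum>j\<in>J. c j * wdeg (A j) m)"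
  have \<psi>_add: "\<psi> (a + b) = \<psi> a + \<psi> b" for a b
    by (simp add: \<psi>_def algebra_simps sum.distrib)
  have outside: "wdeg (A j) m = 0" if "j \<notin> J" "m \<in> mons X" for j m
    using zero that by (auto simp: wdeg_eq_0_iff mons_def)
  have sep: "?\<phi> m = ?\<phi> m'" if "m \<in> M" "m' \<in> M" "\<psi> m = \<psi> m'" for m m'
  proof
    fix j
    show "wdeg (A j) m = wdeg (A j) m'"
    proof (cases "j \<in> J")
      case True
      then show ?thesis
        using c[rule_format, of "\<lambda>j. wdeg (A j) m" "\<lambda>j. wdeg (A j) m'"] that D
        by (simp add: \<psi>_def)
    next
      case False
      then show ?thesis using outside that f g by (auto simp: M_def carrier_poly_ring subset_iff)
    qed
  qed
  have ker: "p \<in> ?I" if p: "mon_hom \<psi> p = 0" "p \<in> carrier ?R" "keys p \<subseteq> M"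
    for p :: "('x, 'k) mpoly"
  proof -
    have "lin (\<lambda>m. of_bool (?\<phi> m = d)) p = 0" for d
    proof (rule lin_fiber_const[of \<psi>])
      show "lin (\<lambda>m. of_bool (\<psi> m = n)) p = 0" for n
        using p(1) by (simp only: mon_hom_eq_0_iff)
      fix m m' assume "m \<in> keys p" "m' \<in> keys p" "\<psi> m = \<psi> m'"
      then have "?\<phi> m = ?\<phi> m'" using p(3) by (intro sep) auto
      then show "of_bool (?\<phi> m = d) = (of_bool (?\<phi> m' = d) :: 'k)" by simp
    qed
    then show ?thesis using p by (simp add: fib_ideal_def)
  qed
  have fg0: "lin (\<lambda>m. of_bool (\<psi> m = n)) (f * g) = 0" for n
  proof (rule fib_ideal_lin_zero)
    show "f * g \<in> ?I" using fg by simp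
    fix m m' assume "?\<phi> m = ?\<phi> m'"
    then have "wdeg (A j) m = wdeg (A j) m'" for j by (rule fun_cong)
    then have "\<psi> m = \<psi> m'" by (simp add: \<psi>_def)
    then show "of_bool (\<psi> m = n) = of_bool (\<psi> m' = n)" by simp
  qed
  then have "mon_hom \<psi> (f * g) = 0" by (simp only: mon_hom_eq_0_iff) simp
  then have "mon_hom \<psi> f * mon_hom \<psi> g = 0" by (simp add: mon_hom_mult \<psi>_add)
  then have "mon_hom \<psi> f = 0 \<or> mon_hom \<psi> g = 0" by simp
  then show "f \<in> ?I \<or> g \<in> ?I" using ker f g by (auto simp: M_def)
qed

section \<open>The toric ideal as an ideal of fibres\<close>

definition vdeg :: "('v set \<Rightarrow>\<^sub>0 nat) \<Rightarrow> 'v \<Rightarrow> nat" where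
  "vdeg m v = wdeg (\<lambda>e. of_bool (v \<in> e)) m"

lemma vdeg_zero [simp]: "vdeg 0 = (\<lambda>v. 0)"
  by (simp add: vdeg_def fun_eq_iff)

lemma vdeg_add: "vdeg (a + b) v = vdeg a v + vdeg b v"
  by (simp add: vdeg_def)

lemma vdeg_single: "vdeg (single e n) v = (if v \<in> e then n else 0)"
  by (simp add: vdeg_def)

lemma vdeg_eq_sum:
  assumes "finite E" "m \<in> mons E"
  shows "vdeg m v = (\<Sum>e\<in>{e \<in> E. v \<in> e}. lookup m e)"
proof -
  have "vdeg m v = (\<Sum>e\<in>E. of_bool (v \<in> e) * lookup m e)"
    unfolding vdeg_def using assms by (intro wdeg_superset) (auto simp: mons_def)
  also have "\<dots> = (\<Sum>e\<in>{e \<in> E. v \<in> e}. lookup m e)"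
    using assms by (intro sum.mono_neutral_cong_right) auto
  finally show ?thesis .
qed

lemma vdeg_pos_iff: "vdeg m v > 0 \<longleftrightarrow> (\<exists>e\<in>keys m. v \<in> e)"
  unfolding vdeg_def by (auto simp: neq0_conv[symmetric] wdeg_eq_0_iff)

lemma vdeg_add_left_cancel: "vdeg (a + b) = vdeg (a + c) \<longleftrightarrow> vdeg b = vdeg c"
  by (simp add: fun_eq_iff vdeg_add)

lemma simple_graph_finite_edges: "simple_graph V E \<Longrightarrow> finite E"
  unfolding simple_graph_def by (rule finite_subset[of E "Pow V"]) auto

lemma prod_single_one: "(\<Prod>i\<in>I. single (f i) (1 :: 'k::field)) = single (\<Sum>i\<in>I. f i :: 'x \<Rightarrow>\<^sub>0 nat) 1"
  by (induction I rule: infinite_finite_induct) (simp_all add: mult_single)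

lemma power_single_one: "single (a :: 'x \<Rightarrow>\<^sub>0 nat) (1 :: 'k::field) ^ n = single (\<Sum>i<n. a) 1"
  using prod_single_one[of "\<lambda>_. a" "{..<n}"] by (simp del: sum_constant)

lemma toric_ideal_eq_fib_ideal:
  assumes "simple_graph V E"
  shows "(toric_ideal V E :: ('v set, 'k::field) mpoly set) = fib_ideal E vdeg"
proof -
  define tdeg :: "('v set \<Rightarrow>\<^sub>0 nat) \<Rightarrow> 'v \<Rightarrow>\<^sub>0 nat" where
    "tdeg m = (\<Sum>e\<in>keys m. \<Sum>i<lookup m e. \<Sum>v\<in>e. single v 1)" for m
  have hom: "toric_hom p = mon_hom tdeg p" for p :: "('v set, 'k) mpoly"
    unfolding toric_hom_def poly_subst_def mon_hom_def tdeg_def mvar_def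
    by (simp only: prod_single_one power_single_one mconst_def mult_single add_0 mult_1_right)
  have lk: "lookup (tdeg m) v = vdeg m v" if "m \<in> mons E" for m v
  proof -
    have fin: "finite e" if "e \<in> keys m" for e
      using that \<open>m \<in> mons E\<close> assms
      by (auto simp: mons_def simple_graph_def) (metis card.infinite subsetD zero_neq_numeral)
    have "lookup (tdeg m) v = (\<Sum>e\<in>keys m. \<Sum>i<lookup m e. \<Sum>u\<in>e. if u = v then 1 else 0)"
      by (simp add: tdeg_def lookup_sum lookup_single when_def del: One_nat_def)
    also have "\<dots> = (\<Sum>e\<in>keys m. of_bool (v \<in> e) * lookup m e)"
      by (intro sum.cong refl) (simp add: fin)
    finally show ?thesis by (simp only: vdeg_def wdeg_def)
  qed
  have iff: "tdeg m = tdeg m' \<longleftrightarrow> vdeg m = vdeg m'" if "m \<in> mons E" "m' \<in> mons E" for m m'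
    using lk that by (auto simp: poly_mapping_eq_iff fun_eq_iff)
  have "(toric_ideal V E :: ('v set, 'k) mpoly set) = fib_ideal E tdeg"
    by (simp only: toric_ideal_def a_kernel_def' hom poly_ring_simps mon_hom_eq_0_iff fib_ideal_def)
  also have "\<dots> = fib_ideal E vdeg"
    by (intro equalityI fib_ideal_mono) (simp_all add: iff)
  finally show ?thesis .
qed

text \<open>These primes interpolate between \<open>0\<close> and the toric ideal: the image of an edge in \<open>T\<close> is
  multiplied by a new variable of its own, so that a relation must not change the exponent of that
  edge.\<close>

definition label :: "'v set set \<Rightarrow> 'v + 'v set \<Rightarrow> 'v set \<Rightarrow> nat" where
  "label T j e = (case j of Inl v \<Rightarrow> of_bool (v \<in> e) | Inr f \<Rightarrow> of_bool (e = f \<and> f \<in> T))"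

definition fine_ideal :: "'v set set \<Rightarrow> 'v set set \<Rightarrow> ('v set, 'k::field) mpoly set" where
  "fine_ideal E T = fib_ideal E (\<lambda>m j. wdeg (label T j) m)"

lemma fine_ideal_prime:
  assumes "simple_graph V E"
  shows "primeideal (fine_ideal E T) (poly_ring E :: ('v set, 'k::field) mpoly ring)"
  unfolding fine_ideal_def
proof (rule fib_ideal_prime)
  show "finite (Inl ` V \<union> Inr ` E)"
    using assms simple_graph_finite_edges[OF assms] by (simp add: simple_graph_def)
  show "label T j e = 0" if "j \<notin> Inl ` V \<union> Inr ` E" "e \<in> E" for j e
    using that assms by (cases j) (auto simp: label_def simple_graph_def)
qed

lemma label_degree_eq_iff:
  "(\<lambda>j. wdeg (label T j) m) = (\<lambda>j. wdeg (label T j) m') \<longleftrightarrow>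
    vdeg m = vdeg m' \<and> (\<forall>f\<in>T. lookup m f = lookup m' f)"
proof -
  have l: "wdeg (label T (Inl v)) m = vdeg m v" for v m
  proof -
    have "label T (Inl v) = (\<lambda>e. of_bool (v \<in> e))" by (simp add: label_def fun_eq_iff)
    then show ?thesis by (simp add: vdeg_def)
  qed
  have r: "wdeg (label T (Inr f)) m = (if f \<in> T then lookup m f else 0)" for f m
  proof -
    have "label T (Inr f) = (\<lambda>e. if f \<in> T then of_bool (e = f) else 0)"
      by (simp add: label_def fun_eq_iff)
    then show ?thesis by (simp add: wdeg_eq_0_iff)
  qed
  have "(\<lambda>j. wdeg (label T j) m) = (\<lambda>j. wdeg (label T j) m') \<longleftrightarrow>
      (\<forall>v. vdeg m v = vdeg m' v) \<and> (\<forall>f. (if f \<in> T then lookup m f else 0) = (if f \<in> T then lookup m' f else 0))"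
    by (simp add: fun_eq_iff l r split_sum_all)
  then show ?thesis by (auto simp: fun_eq_iff)
qed

lemma toric_ideal_eq_fine_ideal:
  "simple_graph V E \<Longrightarrow> (toric_ideal V E :: ('v set, 'k::field) mpoly set) = fine_ideal E {}"
  unfolding toric_ideal_eq_fib_ideal fine_ideal_def
  by (intro equalityI fib_ideal_mono) (simp_all add: label_degree_eq_iff)

lemma toric_ideal_prime:
  "simple_graph V E \<Longrightarrow> primeideal (toric_ideal V E) (poly_ring E :: ('v set, 'k::field) mpoly ring)"
  by (simp add: toric_ideal_eq_fine_ideal fine_ideal_prime)

section \<open>Linear relations between the edges\<close>

text \<open>The rational kernel of the incidence matrix. Differences of exponents of monomials of equal degree
  are its integral points.\<close>

definition kern :: "'v set set \<Rightarrow> ('v set \<Rightarrow> rat) \<Rightarrow> bool" where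
  "kern E z \<longleftrightarrow> (\<forall>e. e \<notin> E \<longrightarrow> z e = 0) \<and> (\<forall>v. (\<Sum>e\<in>{e \<in> E. v \<in> e}. z e) = 0)"

lemma kern_monomials:
  assumes "finite E" "a \<in> mons E" "b \<in> mons E" "vdeg a = vdeg b"
  shows "kern E (\<lambda>e. of_nat (lookup a e) - of_nat (lookup b e))"
  unfolding kern_def
proof (intro conjI allI impI)
  fix v
  have "(\<Sum>e\<in>{e \<in> E. v \<in> e}. of_nat (lookup a e) - of_nat (lookup b e)) =
      (of_nat (vdeg a v) - of_nat (vdeg b v) :: rat)"
    unfolding vdeg_eq_sum[OF assms(1,2)] vdeg_eq_sum[OF assms(1,3)] by (simp add: sum_subtractf)
  then show "(\<Sum>e\<in>{e \<in> E. v \<in> e}. of_nat (lookup a e) - of_nat (lookup b e)) = (0 :: rat)"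
    using assms by simp
next
  fix e assume "e \<notin> E"
  then have "lookup a e = 0 \<and> lookup b e = 0"
    using assms(2,3) by (auto simp: mons_def in_keys_iff subset_iff)
  then show "of_nat (lookup a e) - of_nat (lookup b e) = (0 :: rat)"
    by simp
qed

lemma common_denominator:
  fixes z :: "'a \<Rightarrow> rat"
  assumes "finite F"
  shows "\<exists>D>0. \<exists>i :: 'a \<Rightarrow> int. \<forall>e\<in>F. of_nat D * z e = of_int (i e)"
  using assms
proof (induction F rule: finite_induct)
  case empty
  show ?case by (intro exI[of _ "1::nat"]) auto
next
  case (insert f F)
  then obtain D i where D: "D > 0" "\<forall>e\<in>F. of_nat D * z e = of_int (i e)" by blast
  obtain a b where ab: "quotient_of (z f) = (a, b)" by (cases "quotient_of (z f)")
  then have b: "b > 0" "z f = of_int a / of_int b"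
    using quotient_of_denom_pos quotient_of_div by auto
  have nb: "of_nat (nat b) = (of_int b :: rat)" using b by simp
  have "of_nat (nat b * D) * z e = of_int ((if e = f then D * a else b * i e))"
    if "e \<in> insert f F" for e
  proof (cases "e = f")
    case True
    then show ?thesis using b by (simp add: nb)
  next
    case False
    then have "of_nat D * z e = of_int (i e)" using that D by auto
    then show ?thesis using False by (simp add: nb mult.assoc)
  qed
  then show ?case using D b
    by (intro exI[of _ "nat b * D"] conjI exI[of _ "\<lambda>e. if e = f then D * a else b * i e"]) auto
qed

lemma poly_mapping_of_fun:
  assumes "finite E"
  shows "\<exists>m \<in> mons E. \<forall>e. lookup m e = (if e \<in> E then h e else (0 :: nat))"
proof -
  let ?h = "\<lambda>e. if e \<in> E then h e else 0"
  have "finite {e. ?h e \<noteq> 0}" by (rule finite_subset[OF _ assms]) auto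
  then have *: "lookup (Abs_poly_mapping ?h) = ?h" by (rule lookup_Abs_poly_mapping)
  then have "keys (Abs_poly_mapping ?h) \<subseteq> E" by (auto simp: in_keys_iff split: if_splits)
  with * show ?thesis by (intro bexI[of _ "Abs_poly_mapping ?h"]) (auto simp: mons_def)
qed

text \<open>Clear the denominators and separate the positive from the negative entries.\<close>

lemma kern_scaled_monomials:
  assumes "finite E" "kern E z"
  obtains D a b where "D > (0::nat)" "a \<in> mons E" "b \<in> mons E" "vdeg a = vdeg b"
    "\<And>e. of_nat D * z e = of_nat (lookup a e) - of_nat (lookup b e)"
    "\<And>e. z e = 0 \<Longrightarrow> lookup a e = 0 \<and> lookup b e = 0"
proof -
  obtain D i where D: "D > 0" "\<And>e. e \<in> E \<Longrightarrow> of_nat D * z e = of_int (i e)"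
    using common_denominator[OF assms(1), of z] by auto
  obtain a where a: "a \<in> mons E" "\<And>e. lookup a e = (if e \<in> E then nat (i e) else 0)"
    using poly_mapping_of_fun[OF assms(1), of "\<lambda>e. nat (i e)"] by auto
  obtain b where b: "b \<in> mons E" "\<And>e. lookup b e = (if e \<in> E then nat (- i e) else 0)"
    using poly_mapping_of_fun[OF assms(1), of "\<lambda>e. nat (- i e)"] by auto
  have eq: "of_nat D * z e = of_nat (lookup a e) - of_nat (lookup b e)" for e
  proof (cases "e \<in> E")
    case True
    have "of_int (i e) = (of_nat (nat (i e)) - of_nat (nat (- i e)) :: rat)" by (cases "i e \<ge> 0") auto
    then show ?thesis using True D a b by simp
  next
    case False
    then show ?thesis using a b assms by (simp add: kern_def)
  qed
  have "vdeg a v = vdeg b v" for v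
  proof -
    have "(of_nat (vdeg a v) - of_nat (vdeg b v) :: rat) =
        (\<Sum>e\<in>{e \<in> E. v \<in> e}. of_nat (lookup a e) - of_nat (lookup b e))"
      using assms a b by (simp add: vdeg_eq_sum sum_subtractf)
    also have "\<dots> = of_nat D * (\<Sum>e\<in>{e \<in> E. v \<in> e}. z e)"
      by (simp add: eq[symmetric] sum_distrib_left)
    finally show ?thesis using assms by (simp add: kern_def)
  qed
  moreover have "lookup a e = 0 \<and> lookup b e = 0" if "z e = 0" for e
  proof (cases "e \<in> E")
    case True
    then have "i e = 0" using D(2)[OF True] that by simp
    then show ?thesis using a b by simp
  qed (use a b in auto)
  ultimately show ?thesis using that D a b eq by blast
qed

text \<open>The columns of the incidence matrix that belong to \<open>B\<close> are linearly independent. For a basis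
  \<open>B\<close>, each edge outside \<open>B\<close> has a relation with \<open>B\<close>, and these relations form a basis of the
  kernel, whence \<open>card (E - B)\<close> is its dimension.\<close>

definition edge_indep :: "'v set set \<Rightarrow> 'v set set \<Rightarrow> bool" where
  "edge_indep E B \<longleftrightarrow> B \<subseteq> E \<and> (\<forall>z. kern E z \<longrightarrow> (\<forall>e. e \<notin> B \<longrightarrow> z e = 0) \<longrightarrow> (\<forall>e. z e = 0))"

definition edge_basis :: "'v set set \<Rightarrow> 'v set set \<Rightarrow> bool" where
  "edge_basis E B \<longleftrightarrow> edge_indep E B \<and> (\<forall>f\<in>E - B. \<not> edge_indep E (insert f B))"

lemma edge_basis_exists:
  assumes "finite E"
  shows "\<exists>B. edge_basis E B"
proof -
  have "finite {B. edge_indep E B}"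
    by (rule finite_subset[of _ "Pow E"]) (use assms in \<open>auto simp: edge_indep_def\<close>)
  moreover have "{} \<in> {B. edge_indep E B}" by (auto simp: edge_indep_def)
  ultimately obtain B where B: "edge_indep E B" "\<And>B'. edge_indep E B' \<Longrightarrow> B \<subseteq> B' \<Longrightarrow> B = B'"
    using finite_has_maximal[of "{B. edge_indep E B}"] by blast
  have "edge_basis E B"
    unfolding edge_basis_def
  proof (intro conjI ballI notI)
    fix f assume "f \<in> E - B" "edge_indep E (insert f B)"
    then show False using B(2)[of "insert f B"] by blast
  qed (fact B(1))
  then show ?thesis by blast
qed

lemma edge_basis_relation:
  assumes "edge_basis E B" "f \<in> E - B"
  obtains z where "kern E z" "z f \<noteq> 0" "\<And>e. e \<in> E - B \<Longrightarrow> e \<noteq> f \<Longrightarrow> z e = 0"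
proof -
  from assms have "\<not> edge_indep E (insert f B)" "B \<subseteq> E" "f \<in> E"
    by (auto simp: edge_basis_def edge_indep_def)
  then obtain z where z: "kern E z" "\<And>e. e \<notin> insert f B \<Longrightarrow> z e = 0" "\<exists>e. z e \<noteq> 0"
    unfolding edge_indep_def by blast
  have "z f \<noteq> 0"
  proof
    assume "z f = 0"
    then have "\<forall>e. e \<notin> B \<longrightarrow> z e = 0" using z(2) by (metis insertE)
    then show False using z assms(1) unfolding edge_basis_def edge_indep_def by blast
  qed
  then show ?thesis using z by (intro that[of z]) auto
qed

section \<open>Chains of primes below the toric ideal\<close>

text \<open>The sets \<open>T\<close> run through the final segments of a list of the edges outside \<open>B\<close>. When an edge
  leaves \<open>T\<close>, the binomial of its relation with \<open>B\<close> enters the ideal.\<close>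

lemma toric_prime_chain:
  assumes G: "simple_graph V E" and B: "edge_basis E B"
  shows "\<exists>c. prime_chain (poly_ring E :: ('v set, 'k::field) mpoly ring) (toric_ideal V E) (card (E - B)) c"
proof -
  have finE: "finite E" using simple_graph_finite_edges[OF G] .
  then obtain fs where fs: "set fs = E - B" "distinct fs"
    using finite_distinct_list[of "E - B"] by auto
  then have len: "length fs = card (E - B)" by (metis distinct_card)
  define c :: "nat \<Rightarrow> ('v set, 'k) mpoly set" where "c i = fine_ideal E (set (drop i fs))" for i
  have strict: "c i \<subset> c (Suc i)" if i: "i < length fs" for i
  proof
    have drop: "drop i fs = fs ! i # drop (Suc i) fs" using Cons_nth_drop_Suc[OF i] by simp
    show "c i \<subseteq> c (Suc i)" unfolding c_def fine_ideal_def
    proof (rule fib_ideal_mono)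
      fix m m' :: "'v set \<Rightarrow>\<^sub>0 nat"
      assume "(\<lambda>j. wdeg (label (set (drop i fs)) j) m) = (\<lambda>j. wdeg (label (set (drop i fs)) j) m')"
      then show "(\<lambda>j. wdeg (label (set (drop (Suc i) fs)) j) m) =
          (\<lambda>j. wdeg (label (set (drop (Suc i) fs)) j) m')"
        unfolding label_degree_eq_iff by (simp add: drop)
    qed
    obtain z where z: "kern E z" "z (fs ! i) \<noteq> 0" "\<And>e. e \<in> E - B \<Longrightarrow> e \<noteq> fs ! i \<Longrightarrow> z e = 0"
      using edge_basis_relation[OF B, of "fs ! i"] fs(1) nth_mem[OF i] by metis
    obtain D a b where ab: "D > (0::nat)" "a \<in> mons E" "b \<in> mons E" "vdeg a = vdeg b"
      "\<And>e. of_nat D * z e = of_nat (lookup a e) - of_nat (lookup b e)"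
      "\<And>e. z e = 0 \<Longrightarrow> lookup a e = 0 \<and> lookup b e = 0"
      using kern_scaled_monomials[OF finE z(1)] by metis
    let ?f = "single a 1 - single b 1 :: ('v set, 'k) mpoly"
    have "lookup a e = lookup b e" if "e \<in> set (drop (Suc i) fs)" for e
    proof -
      have "e \<in> E - B" using that fs(1) by (auto dest: in_set_dropD)
      moreover have "e \<noteq> fs ! i"
        using that fs(2) drop distinct_drop[OF fs(2), of i] by auto
      ultimately show ?thesis using z(3) ab(6) by simp
    qed
    then have "?f \<in> c (Suc i)"
      unfolding c_def fine_ideal_def binomial_in_fib_ideal_iff[OF ab(2,3)] label_degree_eq_iff
      using ab(4) by blast
    moreover have "lookup a (fs ! i) \<noteq> lookup b (fs ! i)"
      using ab(5)[of "fs ! i"] ab(1) z(2) by auto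
    then have "?f \<notin> c i"
      unfolding c_def fine_ideal_def binomial_in_fib_ideal_iff[OF ab(2,3)] label_degree_eq_iff drop
      by auto
    ultimately show "c i \<noteq> c (Suc i)" by blast
  qed
  have "prime_chain (poly_ring E) (toric_ideal V E) (card (E - B)) c"
    unfolding prime_chain_def
    using strict len fine_ideal_prime[OF G]
    by (auto simp: c_def toric_ideal_eq_fine_ideal[OF G])
  then show ?thesis by blast
qed

lemma toric_height_ge:
  assumes G: "simple_graph V E" and B: "edge_basis E B"
  shows "enat (card (E - B)) \<le>
    height (poly_ring E :: ('v set, 'k::field) mpoly ring) (toric_ideal V E)"
  unfolding height_def
proof (rule INF_greatest)
  let ?R = "poly_ring E :: ('v set, 'k) mpoly ring"
  let ?P = "toric_ideal V E :: ('v set, 'k) mpoly set"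
  let ?q = "card (E - B)"
  fix Q assume Q: "Q \<in> {Q. primeideal Q ?R \<and> ?P \<subseteq> Q}"
  obtain c where c: "prime_chain ?R ?P ?q c"
    using toric_prime_chain[OF assms, where 'k='k] by blast
  have "(c(?q := Q)) i \<subset> (c(?q := Q)) (Suc i)" if "i < ?q" for i
  proof -
    have "c i \<subset> c (Suc i)" using c that by (simp add: prime_chain_def)
    moreover have "c (Suc i) \<subseteq> Q" if "Suc i = ?q" using c Q that by (auto simp: prime_chain_def)
    ultimately show ?thesis using that by (cases "Suc i = ?q") auto
  qed
  then have "prime_chain ?R Q ?q (c(?q := Q))"
    using c Q unfolding prime_chain_def by auto
  then show "enat ?q \<le> prime_height ?R Q"
    unfolding prime_height_def by (intro SUP_upper) auto
qed

section \<open>Algebraic independence bounds the length of chains of primes\<close>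

fun lmon :: "'a::comm_monoid_mult list \<Rightarrow> nat list \<Rightarrow> 'a" where
  "lmon (y # ys) (a # as) = y ^ a * lmon ys as"
| "lmon _ _ = 1"

text \<open>The elements \<open>ys\<close> are algebraically independent modulo the ideal \<open>I\<close>.\<close>

definition indep_mod :: "('x, 'k::field) mpoly set \<Rightarrow> ('x, 'k) mpoly list \<Rightarrow> bool" where
  "indep_mod I ys \<longleftrightarrow> (\<forall>(c :: nat list \<Rightarrow> 'k) A. finite A \<longrightarrow> (\<forall>as\<in>A. length as = length ys) \<longrightarrow>
    (\<Sum>as\<in>A. mconst (c as) * lmon ys as) \<in> I \<longrightarrow> (\<forall>as\<in>A. c as = 0))"

lemma lmon_carrier:
  "set ys \<subseteq> carrier (poly_ring X) \<Longrightarrow> lmon ys as \<in> carrier (poly_ring X)"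
  by (induction ys as rule: lmon.induct) (auto intro: carrier_intros)

lemma prime_power_cancel:
  assumes P: "primeideal P (poly_ring X :: ('x, 'k::field) mpoly ring)"
    and "f \<in> carrier (poly_ring X)" "f \<notin> P" "x \<in> carrier (poly_ring X)" "f ^ s * x \<in> P"
  shows "x \<in> P"
  using assms(5)
proof (induction s)
  case (Suc s)
  have "f ^ s * x \<in> carrier (poly_ring X)" using assms by (intro carrier_intros)
  moreover have "f * (f ^ s * x) \<in> P" using Suc.prems by (simp add: mult.assoc)
  ultimately show ?case
    using primeideal.I_prime[OF P, of f "f ^ s * x"] assms Suc.IH by auto
qed simp

text \<open>In a relation for \<open>f # ys\<close> modulo the smaller prime, the lowest power of \<open>f\<close> can be
  cancelled because \<open>f\<close> is not in that prime. Modulo the larger prime, which contains \<open>f\<close>, only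
  the terms of lowest degree in \<open>f\<close> survive, and they form a relation for \<open>ys\<close>.\<close>

lemma indep_mod_Cons:
  assumes P: "primeideal P (poly_ring X :: ('x, 'k::field) mpoly ring)"
    and Q: "ideal Q (poly_ring X :: ('x, 'k::field) mpoly ring)"
    and sub: "P \<subseteq> Q" and f: "f \<in> Q" "f \<notin> P"
    and ys: "set ys \<subseteq> carrier (poly_ring X)" and ind: "indep_mod Q ys"
  shows "indep_mod P (f # ys)"
  unfolding indep_mod_def
proof (intro allI impI, rule ccontr)
  let ?R = "poly_ring X :: ('x, 'k) mpoly ring"
  fix c :: "nat list \<Rightarrow> 'k" and A
  assume A: "finite A" "\<forall>as\<in>A. length as = length (f # ys)"
    and S: "(\<Sum>as\<in>A. mconst (c as) * lmon (f # ys) as) \<in> P"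
    and nz: "\<not> (\<forall>as\<in>A. c as = 0)"
  have fc: "f \<in> carrier ?R" using poly_ring_idealD(1)[OF Q] f by auto
  define A' where "A' = {as \<in> A. c as \<noteq> 0}"
  have A': "finite A'" "A' \<noteq> {}" using A nz by (auto simp: A'_def)
  define s where "s = Min (hd ` A')"
  have s_le: "s \<le> hd as" if "as \<in> A'" for as using that A' by (auto simp: s_def)
  have "s \<in> hd ` A'" unfolding s_def using A' by (intro Min_in) auto
  define t where "t = (\<lambda>as. mconst (c as) * (f ^ (hd as - s) * lmon ys (tl as)))"
  have tc: "t as \<in> carrier ?R" for as
    unfolding t_def using fc ys by (intro carrier_intros lmon_carrier)
  define A0 where "A0 = {as \<in> A'. hd as = s}"
  have cons: "as = hd as # tl as" if "as \<in> A'" for as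
    using that A by (cases as) (auto simp: A'_def)
  have "(\<Sum>as\<in>A. mconst (c as) * lmon (f # ys) as) = (\<Sum>as\<in>A'. mconst (c as) * lmon (f # ys) as)"
    by (rule sum.mono_neutral_right) (use A in \<open>auto simp: A'_def mconst_def\<close>)
  also have "\<dots> = (\<Sum>as\<in>A'. f ^ s * t as)"
  proof (rule sum.cong[OF refl])
    fix as assume as: "as \<in> A'"
    have "lmon (f # ys) as = f ^ hd as * lmon ys (tl as)"
      by (subst cons[OF as]) simp
    also have "f ^ hd as = f ^ s * f ^ (hd as - s)"
      using s_le[OF as] by (simp add: power_add[symmetric])
    finally show "mconst (c as) * lmon (f # ys) as = f ^ s * t as"
      by (simp add: t_def mult_ac)
  qed
  finally have "f ^ s * sum t A' \<in> P" using S by (simp add: sum_distrib_left)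
  with carrier_sum[OF tc] have "sum t A' \<in> P"
    by (rule prime_power_cancel[OF P fc f(2)])
  then have "sum t A' \<in> Q" using sub by auto
  moreover have "t as \<in> Q" if "as \<in> A' - A0" for as
  proof -
    define k where "k = hd as - s - 1"
    have "hd as - s = Suc k" using s_le[of as] that by (auto simp: A0_def k_def)
    then have "t as = (mconst (c as) * (f ^ k * lmon ys (tl as))) * f"
      by (simp add: t_def mult_ac)
    moreover have "mconst (c as) * (f ^ k * lmon ys (tl as)) \<in> carrier ?R"
      using fc ys by (intro carrier_intros lmon_carrier)
    ultimately show ?thesis using poly_ring_idealD(5)[OF Q f(1)] by simp
  qed
  then have "sum t (A' - A0) \<in> Q" by (rule poly_ring_ideal_sum[OF Q])
  moreover have "sum t A0 = sum t A' - sum t (A' - A0)"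
    using A' by (simp add: sum_diff A0_def)
  ultimately have "sum t A0 \<in> Q" using poly_ring_idealD(4)[OF Q] by simp
  have inj: "inj_on tl A0"
  proof (rule inj_onI)
    fix as bs assume "as \<in> A0" "bs \<in> A0" "tl as = tl bs"
    then show "as = bs" using cons[of as] cons[of bs] by (auto simp: A0_def)
  qed
  have "sum t A0 = (\<Sum>as\<in>A0. mconst (c (s # tl as)) * lmon ys (tl as))"
    using cons by (intro sum.cong) (auto simp: A0_def t_def)
  also have "\<dots> = (\<Sum>bs\<in>tl ` A0. mconst (c (s # bs)) * lmon ys bs)"
    by (simp add: sum.reindex[OF inj])
  finally have mem: "(\<Sum>bs\<in>tl ` A0. mconst (c (s # bs)) * lmon ys bs) \<in> Q"
    using \<open>sum t A0 \<in> Q\<close> by simp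
  have fin: "finite (tl ` A0)" using A' by (simp add: A0_def)
  have len: "\<forall>bs\<in>tl ` A0. length bs = length ys" using A by (auto simp: A0_def A'_def)
  have zero: "\<forall>bs\<in>tl ` A0. c (s # bs) = 0"
    using ind[unfolded indep_mod_def, rule_format, of "tl ` A0" "\<lambda>bs. c (s # bs)"] fin len mem by blast
  obtain as where as: "as \<in> A0" using \<open>s \<in> hd ` A'\<close> by (auto simp: A0_def)
  then have "s # tl as = as" using cons[of as] by (auto simp: A0_def)
  then have "c as = 0" using zero as by force
  then show False using as by (simp add: A0_def A'_def)
qed

definition ebound :: "nat \<Rightarrow> ('x, 'k::field) mpoly \<Rightarrow> bool" where
  "ebound K p \<longleftrightarrow> (\<forall>m\<in>keys p. \<forall>x. lookup m x \<le> K)"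

lemma ebound_mono: "ebound a p \<Longrightarrow> a \<le> b \<Longrightarrow> ebound b p"
  unfolding ebound_def using le_trans by blast

lemma ebound_one: "ebound 0 1"
  by (simp add: ebound_def)

lemma ebound_mult: "ebound a p \<Longrightarrow> ebound b q \<Longrightarrow> ebound (a + b) (p * q)"
  unfolding ebound_def
  using keys_mult[of p q] by (force simp: lookup_add intro: add_mono)

lemma ebound_power: "ebound a p \<Longrightarrow> ebound (n * a) (p ^ n)"
  by (induction n) (auto simp: ebound_one intro: ebound_mult)

lemma ebound_lmon:
  assumes "\<forall>y\<in>set ys. ebound d y" "length as = length ys" "\<forall>a\<in>set as. a < D"
  shows "ebound (length ys * (D * d)) (lmon ys as)"
  using assms
proof (induction ys as rule: lmon.induct)
  case (1 y ys a as)
  have "ebound (a * d) (y ^ a)" using 1 by (auto intro: ebound_power)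
  then have "ebound (D * d) (y ^ a)" using 1 by (auto intro: ebound_mono)
  moreover have "ebound (length ys * (D * d)) (lmon ys as)" using 1 by auto
  ultimately show ?case by (auto intro: ebound_mult)
qed (auto simp: ebound_one)

lemma ebound_exists:
  assumes "finite Y"
  shows "\<exists>d. \<forall>y\<in>Y. ebound d y"
proof (intro exI ballI)
  fix y assume y: "y \<in> Y"
  let ?g = "\<lambda>y :: ('a, 'b) mpoly. \<Sum>m\<in>keys y. \<Sum>x\<in>keys m. lookup m x"
  show "ebound (\<Sum>y\<in>Y. ?g y) y" unfolding ebound_def
  proof (intro ballI allI)
    fix m x assume m: "m \<in> keys y"
    have "lookup m x \<le> (\<Sum>x\<in>keys m. lookup m x)"
      by (cases "x \<in> keys m") (auto simp: in_keys_iff intro: member_le_sum)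
    also have "\<dots> \<le> ?g y" using m by (intro member_le_sum) auto
    also have "\<dots> \<le> (\<Sum>y\<in>Y. ?g y)" using y assms by (intro member_le_sum) auto
    finally show "lookup m x \<le> (\<Sum>y\<in>Y. ?g y)" .
  qed
qed

lemma bounded_monomials:
  assumes "finite X"
  shows "finite {m \<in> mons X. \<forall>x. lookup m x \<le> K}" (is "finite ?M")
    and "card {m \<in> mons X. \<forall>x. lookup m x \<le> K} \<le> Suc K ^ card X"
proof -
  have fin: "finite (X \<rightarrow>\<^sub>E {..K})" using assms by (intro finite_PiE) auto
  have card: "card (X \<rightarrow>\<^sub>E {..K}) = Suc K ^ card X" using assms by (simp add: card_PiE)
  have "inj_on (\<lambda>m. restrict (lookup m) X) ?M"
  proof (rule inj_onI, rule poly_mapping_eqI)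
    fix m m' x assume *: "m \<in> ?M" "m' \<in> ?M" "restrict (lookup m) X = restrict (lookup m') X"
    show "lookup m x = lookup m' x"
    proof (cases "x \<in> X")
      case True
      then show ?thesis using *(3) by (metis restrict_apply')
    next
      case False
      then have "x \<notin> keys m" "x \<notin> keys m'" using * by (auto simp: mons_def)
      then show ?thesis by (simp add: in_keys_iff)
    qed
  qed
  moreover have "(\<lambda>m. restrict (lookup m) X) ` ?M \<subseteq> X \<rightarrow>\<^sub>E {..K}" by auto
  ultimately show "finite ?M" "card ?M \<le> Suc K ^ card X"
    using fin card by (auto intro: inj_on_finite card_inj_on_le simp: card[symmetric])
qed

text \<open>The \<open>D ^ n\<close> products of powers below \<open>D\<close> of \<open>n\<close> polynomials involve only \<open>O(D ^ card X)\<close>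
  monomials, so they are linearly dependent for large \<open>D\<close> if \<open>n > card X\<close>.\<close>

lemma indep_mod_length:
  assumes X: "finite X" and ys: "set ys \<subseteq> carrier (poly_ring X :: ('x, 'k::field) mpoly ring)"
    and ind: "indep_mod I ys" and "0 \<in> I"
  shows "length ys \<le> card X"
proof (rule ccontr)
  let ?N = "length ys" and ?n = "card X"
  assume "\<not> ?N \<le> ?n"
  then have lt: "?n < ?N" by simp
  obtain d where d: "\<forall>y\<in>set ys. ebound d y" using ebound_exists[of "set ys"] by auto
  \<comment> \<open>\<open>K\<close> bounds the exponents in the products; \<open>D\<close> is so large that \<open>(K + 1) ^ card X < D ^ length ys\<close>.\<close>
  define D where "D = Suc (Suc (?N * d) ^ ?n)"
  define K where "K = ?N * (D * d)"
  define M where "M = {m \<in> mons X. \<forall>x. lookup m x \<le> K}"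
  define A where "A = {as. set as \<subseteq> {..<D} \<and> length as = ?N}"
  have finA: "finite A" and cardA: "card A = D ^ ?N"
    unfolding A_def by (simp_all add: finite_lists_length_eq card_lists_length_eq)
  have "Suc K \<le> D * Suc (?N * d)" by (simp add: K_def D_def algebra_simps)
  then have "Suc K ^ ?n \<le> (D * Suc (?N * d)) ^ ?n" by (rule power_mono) simp
  also have "\<dots> = D ^ ?n * Suc (?N * d) ^ ?n" by (rule power_mult_distrib)
  also have "\<dots> < D ^ ?n * D" by (rule mult_strict_left_mono) (simp_all add: D_def)
  also have "\<dots> = D ^ Suc ?n" by simp
  also have "\<dots> \<le> D ^ ?N" using lt by (intro power_increasing) (auto simp: D_def)
  finally have "card M < card A" using bounded_monomials(2)[OF X, of K] cardA by (simp add: M_def)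
  moreover have "finite M" unfolding M_def by (rule bounded_monomials[OF X])
  ultimately obtain c where c: "\<exists>as\<in>A. c as \<noteq> 0"
    "\<forall>m\<in>M. (\<Sum>as\<in>A. c as * lookup (lmon ys as) m) = 0"
    using nontrivial_solution[of M A "\<lambda>as m. lookup (lmon ys as) m"] finA by auto
  have "(\<Sum>as\<in>A. mconst (c as) * lmon ys as) = 0"
  proof (rule poly_mapping_eqI)
    fix m
    have eq: "lookup (\<Sum>as\<in>A. mconst (c as) * lmon ys as) m = (\<Sum>as\<in>A. c as * lookup (lmon ys as) m)"
      unfolding lookup_sum by (intro sum.cong refl) (simp add: lookup_eq_lin mconst_def lin_single_mult)
    show "lookup (\<Sum>as\<in>A. mconst (c as) * lmon ys as) m = lookup 0 m"
    proof (cases "m \<in> M")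
      case False
      have "lookup (lmon ys as) m = 0" if "as \<in> A" for as
      proof (rule ccontr)
        assume "lookup (lmon ys as) m \<noteq> 0"
        then have "m \<in> keys (lmon ys as)" by (simp add: in_keys_iff)
        moreover have "ebound K (lmon ys as)"
          unfolding K_def using d that by (intro ebound_lmon) (auto simp: A_def)
        moreover have "lmon ys as \<in> carrier (poly_ring X)" using ys by (rule lmon_carrier)
        ultimately show False using False by (auto simp: M_def ebound_def carrier_poly_ring)
      qed
      then show ?thesis unfolding eq by simp
    qed (simp add: eq c(2))
  qed
  then have "(\<Sum>as\<in>A. mconst (c as) * lmon ys as) \<in> I" using \<open>0 \<in> I\<close> by simp
  moreover have "\<forall>as\<in>A. length as = length ys" by (simp add: A_def)
  ultimately have "\<forall>as\<in>A. c as = 0" using ind finA unfolding indep_mod_def by blast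
  then show False using c(1) by blast
qed

lemma prime_chain_indep:
  assumes ch: "prime_chain (poly_ring X :: ('x, 'k::field) mpoly ring) P n c"
    and ys: "set ys \<subseteq> carrier (poly_ring X)" and ind: "indep_mod P ys"
  shows "i \<le> n \<Longrightarrow> \<exists>zs. length zs = i + length ys \<and> set zs \<subseteq> carrier (poly_ring X) \<and> indep_mod (c (n - i)) zs"
proof (induction i)
  case 0
  then show ?case using assms by (intro exI[of _ ys]) (auto simp: prime_chain_def)
next
  case (Suc i)
  then obtain zs where zs: "length zs = i + length ys" "set zs \<subseteq> carrier (poly_ring X)"
    "indep_mod (c (n - i)) zs" by auto
  have eq: "Suc (n - Suc i) = n - i" using Suc.prems by simp
  have primes: "primeideal (c (n - Suc i)) (poly_ring X)" "primeideal (c (n - i)) (poly_ring X)"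
    using ch by (auto simp: prime_chain_def)
  have "c (n - Suc i) \<subset> c (Suc (n - Suc i))"
    using ch Suc.prems unfolding prime_chain_def by auto
  then have sub: "c (n - Suc i) \<subset> c (n - i)" by (simp only: eq)
  then obtain f where f: "f \<in> c (n - i)" "f \<notin> c (n - Suc i)" by auto
  have id: "ideal (c (n - i)) (poly_ring X)" using primes(2) by (rule primeideal.axioms)
  have "indep_mod (c (n - Suc i)) (f # zs)"
    using sub by (intro indep_mod_Cons[OF primes(1) id _ f zs(2,3)]) auto
  moreover have "set (f # zs) \<subseteq> carrier (poly_ring X)"
    using zs(2) f(1) poly_ring_idealD(1)[OF id] by auto
  ultimately show ?case using zs(1) by (intro exI[of _ "f # zs"]) auto
qed

fun expo :: "'x list \<Rightarrow> nat list \<Rightarrow> 'x \<Rightarrow>\<^sub>0 nat" where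
  "expo (x # xs) (a # as) = single x a + expo xs as"
| "expo _ _ = 0"

lemma mvar_power: "mvar x ^ a = single (single x a) 1"
  by (induction a) (simp_all add: mvar_def mult_single single_add[symmetric])

lemma lmon_mvar: "lmon (map mvar xs) as = single (expo xs as) 1"
  by (induction xs as rule: expo.induct) (simp_all add: mvar_power mult_single)

lemma expo_mons: "expo xs as \<in> mons (set xs)"
proof (induction xs as rule: expo.induct)
  case (1 x xs a as)
  then show ?case by (auto simp: mons_def keys_add_nat split: if_splits)
qed auto

lemma expo_inj:
  "distinct xs \<Longrightarrow> length as = length xs \<Longrightarrow> length bs = length xs \<Longrightarrow> expo xs as = expo xs bs \<Longrightarrow> as = bs"
proof (induction xs arbitrary: as bs)
  case (Cons x xs)
  obtain a as' where as: "as = a # as'" using Cons.prems by (cases as) auto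
  obtain b bs' where bs: "bs = b # bs'" using Cons.prems by (cases bs) auto
  have notin: "lookup (expo xs cs) x = 0" for cs
    using Cons.prems(1) expo_mons[of xs cs] by (auto simp: mons_def in_keys_iff)
  have eq: "single x a + expo xs as' = single x b + expo xs bs'" using Cons.prems as bs by simp
  then have "lookup (single x a + expo xs as') x = lookup (single x b + expo xs bs') x" by simp
  then have "a = b" by (simp add: lookup_add notin)
  then have "as' = bs'" using eq Cons as bs by auto
  then show ?case using \<open>a = b\<close> as bs by simp
qed simp

lemma edge_indep_monomials:
  assumes "finite E" "edge_indep E B" "a \<in> mons B" "b \<in> mons B" "vdeg a = vdeg b"
  shows "a = b"
proof (rule poly_mapping_eqI)
  fix e
  let ?z = "\<lambda>e. of_nat (lookup a e) - of_nat (lookup b e) :: rat"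
  have "kern E ?z" using assms by (intro kern_monomials) (auto simp: mons_def edge_indep_def)
  moreover have "lookup a e = 0 \<and> lookup b e = 0" if "e \<notin> B" for e
    using assms(3,4) that by (auto simp: mons_def in_keys_iff subset_iff)
  then have "\<forall>e. e \<notin> B \<longrightarrow> ?z e = 0" by simp
  ultimately have "?z e = 0" using assms(2) unfolding edge_indep_def by blast
  then show "lookup a e = lookup b e" by simp
qed

text \<open>Distinct monomials in independent edges have distinct degrees, so no cancellation is possible
  inside a fibre.\<close>

lemma edge_indep_indep_mod:
  assumes G: "simple_graph V E" and B: "edge_indep E (set bs)" and "distinct bs"
  shows "indep_mod (toric_ideal V E :: ('v set, 'k::field) mpoly set) (map mvar bs)"
  unfolding indep_mod_def
proof (intro allI impI ballI)
  fix c :: "nat list \<Rightarrow> 'k" and A a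
  assume A: "finite A" "\<forall>as\<in>A. length as = length (map mvar bs :: ('v set, 'k) mpoly list)"
    and S: "(\<Sum>as\<in>A. mconst (c as) * lmon (map mvar bs) as) \<in> (toric_ideal V E :: ('v set, 'k) mpoly set)"
    and a: "a \<in> A"
  have iff: "vdeg (expo bs as) = vdeg (expo bs a) \<longleftrightarrow> as = a" if "as \<in> A" for as
    using edge_indep_monomials[OF simple_graph_finite_edges[OF G] B expo_mons expo_mons]
      expo_inj[OF \<open>distinct bs\<close>] A(2) a that by (metis length_map)
  have "0 = lin (\<lambda>m. of_bool (vdeg m = vdeg (expo bs a))) (\<Sum>as\<in>A. mconst (c as) * lmon (map mvar bs) as)"
    using S by (simp add: toric_ideal_eq_fib_ideal[OF G] fib_ideal_def)
  also have "\<dots> = (\<Sum>as\<in>A. of_bool (vdeg (expo bs as) = vdeg (expo bs a)) * c as)"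
    by (simp add: lmon_mvar mconst_def mult_single lin_sum)
  also have "\<dots> = (\<Sum>as\<in>A. if as = a then c as else 0)"
    by (intro sum.cong refl) (simp add: iff)
  also have "\<dots> = c a" using A a by simp
  finally show "c a = 0" by simp
qed

lemma toric_height_le:
  assumes G: "simple_graph V E" and B: "edge_indep E B"
  shows "height (poly_ring E :: ('v set, 'k::field) mpoly ring) (toric_ideal V E) \<le> enat (card (E - B))"
proof -
  let ?R = "poly_ring E :: ('v set, 'k) mpoly ring"
  let ?P = "toric_ideal V E :: ('v set, 'k) mpoly set"
  have finE: "finite E" using simple_graph_finite_edges[OF G] .
  have BE: "B \<subseteq> E" using B by (simp add: edge_indep_def)
  then obtain bs where bs: "set bs = B" "distinct bs"
    using finite_distinct_list[of B] finE finite_subset by blast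
  then have len: "length bs = card B" by (metis distinct_card)
  have ys: "set (map mvar bs) \<subseteq> carrier ?R" using bs BE by (auto intro: carrier_mvar)
  have "height ?R ?P \<le> prime_height ?R ?P"
    unfolding height_def using toric_ideal_prime[OF G] by (intro INF_lower) auto
  also have "\<dots> \<le> enat (card (E - B))"
    unfolding prime_height_def
  proof (rule SUP_least)
    fix n assume "n \<in> {n. \<exists>c. prime_chain ?R ?P n c}"
    then obtain c where c: "prime_chain ?R ?P n c" by blast
    have "indep_mod ?P (map mvar bs)" using edge_indep_indep_mod[OF G, of bs] B bs by simp
    then obtain zs where zs: "length zs = n + length (map mvar bs :: ('v set, 'k) mpoly list)"
      "set zs \<subseteq> carrier ?R" "indep_mod (c (n - n)) zs"
      using prime_chain_indep[OF c ys, of n] by auto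
    have "ideal (c (n - n)) ?R" using c by (auto simp: prime_chain_def intro: primeideal.axioms)
    then have "length zs \<le> card E"
      using indep_mod_length[OF finE zs(2,3)] poly_ring_idealD(2) by blast
    then have "n + card B \<le> card E" using zs(1) len by simp
    then show "enat n \<le> enat (card (E - B))"
      using card_Diff_subset[OF finite_subset[OF BE finE] BE] by simp
  qed
  finally show ?thesis .
qed

theorem toric_height:
  assumes "simple_graph V E" "edge_basis E B"
  shows "height (poly_ring E :: ('v set, 'k::field) mpoly ring) (toric_ideal V E) = enat (card (E - B))"
  using assms(2) unfolding edge_basis_def
  by (intro antisym[OF toric_height_le[OF assms(1)] toric_height_ge[OF assms]]) simp

section \<open>Monomials of equal degree that share a variable\<close>

text \<open>The classes of linked monomials are represented by one chosen member each (\<open>rep\<close>), and one class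
  of every degree is distinguished (\<open>base\<close>). The other representatives are the slots; each of
  them stands for the binomial \<open>m - base E m\<close> of a minimal system of generators.\<close>

definition link :: "'v set set \<Rightarrow> (('v set \<Rightarrow>\<^sub>0 nat) \<times> ('v set \<Rightarrow>\<^sub>0 nat)) set" where
  "link E = {(m, m'). m \<in> mons E \<and> m' \<in> mons E \<and> vdeg m = vdeg m' \<and> keys m \<inter> keys m' \<noteq> {}}"

definition rep :: "'v set set \<Rightarrow> ('v set \<Rightarrow>\<^sub>0 nat) \<Rightarrow> ('v set \<Rightarrow>\<^sub>0 nat)" where
  "rep E m = (SOME m'. (m, m') \<in> (link E)\<^sup>*)"

definition base :: "'v set set \<Rightarrow> ('v set \<Rightarrow>\<^sub>0 nat) \<Rightarrow> ('v set \<Rightarrow>\<^sub>0 nat)" where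
  "base E m = rep E (SOME m'. m' \<in> mons E \<and> vdeg m' = vdeg m)"

definition slots :: "'v set set \<Rightarrow> ('v set \<Rightarrow>\<^sub>0 nat) set" where
  "slots E = {m \<in> mons E. rep E m = m \<and> base E m \<noteq> m}"

lemma link_sym: "sym (link E)"
  by (auto simp: sym_def link_def)

lemma link_rtrancl_vdeg: "(m, m') \<in> (link E)\<^sup>* \<Longrightarrow> vdeg m = vdeg m'"
  by (induction rule: rtrancl_induct) (auto simp: link_def)

lemma link_rtrancl_mons: "(m, m') \<in> (link E)\<^sup>* \<Longrightarrow> m \<in> mons E \<Longrightarrow> m' \<in> mons E"
  by (induction rule: rtrancl_induct) (auto simp: link_def)

lemma rep_link: "(m, rep E m) \<in> (link E)\<^sup>*"
  unfolding rep_def by (rule someI) (rule rtrancl_refl)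

lemma rep_eqI:
  assumes "(m, m') \<in> (link E)\<^sup>*"
  shows "rep E m = rep E m'"
proof -
  have "(m', m) \<in> (link E)\<^sup>*" using assms sym_rtrancl[OF link_sym] by (metis symD)
  then have "(m, x) \<in> (link E)\<^sup>* \<longleftrightarrow> (m', x) \<in> (link E)\<^sup>*" for x
    using assms by (meson rtrancl_trans)
  then show ?thesis by (simp add: rep_def)
qed

lemma rep_rep [simp]: "rep E (rep E m) = rep E m"
  using rep_eqI[OF rep_link] by metis

lemma rep_mons: "m \<in> mons E \<Longrightarrow> rep E m \<in> mons E"
  by (rule link_rtrancl_mons[OF rep_link])

lemma vdeg_rep [simp]: "vdeg (rep E m) = vdeg m"
  using link_rtrancl_vdeg[OF rep_link] by metis

lemma base_cong: "vdeg m = vdeg m' \<Longrightarrow> base E m = base E m'"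
  by (simp add: base_def)

lemma base_props:
  assumes "m \<in> mons E"
  shows "base E m \<in> mons E" "vdeg (base E m) = vdeg m" "rep E (base E m) = base E m"
proof -
  let ?m = "SOME m'. m' \<in> mons E \<and> vdeg m' = vdeg m"
  have "?m \<in> mons E \<and> vdeg ?m = vdeg m" by (rule someI[of _ m]) (use assms in simp)
  then show "base E m \<in> mons E" "vdeg (base E m) = vdeg m" "rep E (base E m) = base E m"
    by (simp_all add: base_def rep_mons)
qed

lemma slotsD:
  assumes "m \<in> slots E"
  shows "m \<in> mons E" "rep E m = m" "base E m \<noteq> m" "base E m \<in> mons E"
    "vdeg (base E m) = vdeg m" "rep E (base E m) = base E m"
  using assms base_props[of m E] by (auto simp: slots_def)

lemma rep_neq_disjoint:
  assumes "m \<in> mons E" "m' \<in> mons E" "vdeg m = vdeg m'" "rep E m \<noteq> rep E m'"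
  shows "keys m \<inter> keys m' = {}"
proof (rule ccontr)
  assume "keys m \<inter> keys m' \<noteq> {}"
  then have "(m, m') \<in> link E" using assms by (simp add: link_def)
  then show False using assms rep_eqI[of m m' E] by blast
qed

text \<open>Multiplying by a variable moves all monomials of one degree into a single class, where the
  coefficients of an element of the toric ideal cancel.\<close>

lemma slot_functional_mult:
  assumes G: "simple_graph V E" and p: "p \<in> (toric_ideal V E :: ('v set, 'k::field) mpoly set)"
    and h: "h \<in> carrier (poly_ring E)"
  shows "lin (\<lambda>x. of_bool (rep E x = m)) (h * p) = lookup h 0 * lin (\<lambda>x. of_bool (rep E x = m)) p"
proof -
  have zero: "lin (\<lambda>x. of_bool (rep E (a + x) = m)) p = 0" if a: "a \<in> keys h" "a \<noteq> 0" for a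
  proof (rule fib_ideal_lin_zero)
    show "p \<in> fib_ideal E vdeg" using p by (simp add: toric_ideal_eq_fib_ideal[OF G])
    fix x y assume xy: "x \<in> mons E" "y \<in> mons E" "vdeg x = vdeg y"
    have "a \<in> mons E" using a h by (auto simp: carrier_poly_ring)
    moreover obtain e where "e \<in> keys a"
      using a(2) by (metis in_keys_iff lookup_zero poly_mapping_eqI)
    ultimately have "(a + x, a + y) \<in> link E"
      using xy unfolding link_def
      by (intro CollectI case_prodI conjI) (auto simp: vdeg_add_left_cancel keys_add_nat)
    then have "rep E (a + x) = rep E (a + y)" by (intro rep_eqI) auto
    then show "of_bool (rep E (a + x) = m) = (of_bool (rep E (a + y) = m) :: 'k)" by simp
  qed
  have "lin (\<lambda>x. of_bool (rep E x = m)) (h * p) =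
      (\<Sum>a\<in>keys h. lookup h a * lin (\<lambda>x. of_bool (rep E (a + x) = m)) p)"
    by (rule lin_mult)
  also have "\<dots> = (\<Sum>a\<in>insert 0 (keys h). if a = 0 then lookup h 0 * lin (\<lambda>x. of_bool (rep E x = m)) p else 0)"
    by (rule sum.mono_neutral_cong_left) (auto simp: zero in_keys_iff)
  finally show ?thesis by simp
qed

text \<open>Each class of linked monomials beyond the first one of its degree forces a generator: the
  sum of the coefficients over the class is a linear functional on the toric ideal which sees
  only the constant terms of the multipliers, and these functionals are independent.\<close>

lemma card_slots_le_generators:
  assumes G: "simple_graph V E" and S: "finite S" "S \<subseteq> carrier (poly_ring E)"
    and gen: "Idl\<^bsub>poly_ring E\<^esub> S = (toric_ideal V E :: ('v set, 'k::field) mpoly set)"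
  shows "finite (slots E) \<and> card (slots E) \<le> card S"
proof (rule finite_if_finite_subsets_card_bdd)
  let ?R = "poly_ring E :: ('v set, 'k) mpoly ring"
  let ?P = "toric_ideal V E :: ('v set, 'k) mpoly set"
  let ?l = "\<lambda>m. lin (\<lambda>x. of_bool (rep E x = m)) :: ('v set, 'k) mpoly \<Rightarrow> 'k"
  interpret ring ?R by (rule poly_ring_ring)
  have P: "ideal ?P ?R" using toric_ideal_prime[OF G] by (rule primeideal.axioms)
  have SP: "S \<subseteq> ?P" using genideal_self[OF S(2)] gen by simp
  fix F assume F: "F \<subseteq> slots E" "finite F"
  show "card F \<le> card S"
  proof (rule ccontr)
    assume "\<not> card F \<le> card S"
    then obtain c where c: "\<exists>m\<in>F. c m \<noteq> 0" "\<forall>s\<in>S. (\<Sum>m\<in>F. c m * ?l m s) = 0"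
      using nontrivial_solution[OF S(1) F(2), of ?l] by auto
    define L where "L p = (\<Sum>m\<in>F. c m * ?l m p)" for p
    define J where "J = {p \<in> ?P. L p = 0}"
    have "ideal J ?R"
    proof (rule poly_ring_idealI)
      show "J \<subseteq> carrier ?R" using poly_ring_idealD(1)[OF P] by (auto simp: J_def)
      show "0 \<in> J" using poly_ring_idealD(2)[OF P] by (simp add: J_def L_def)
      show "a + b \<in> J" if "a \<in> J" "b \<in> J" for a b
        using that poly_ring_idealD(3)[OF P]
        by (auto simp: J_def L_def lin_add algebra_simps sum.distrib)
      show "h * a \<in> J" if "a \<in> J" "h \<in> carrier ?R" for a h
      proof -
        have "L (h * a) = (\<Sum>m\<in>F. c m * (lookup h 0 * ?l m a))"
          unfolding L_def
          by (intro sum.cong refl) (use that in \<open>simp add: J_def slot_functional_mult[OF G]\<close>)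
        also have "\<dots> = lookup h 0 * L a" by (simp add: L_def sum_distrib_left mult_ac)
        finally show ?thesis using that poly_ring_idealD(5)[OF P] by (auto simp: J_def)
      qed
    qed
    moreover have "S \<subseteq> J" using SP c(2) by (auto simp: J_def L_def)
    ultimately have "?P \<subseteq> J" using genideal_minimal gen by metis
    obtain m0 where m0: "m0 \<in> F" "c m0 \<noteq> 0" using c(1) by auto
    let ?b = "single m0 1 - single (base E m0) 1 :: ('v set, 'k) mpoly"
    have sl: "m0 \<in> slots E" using m0 F by auto
    have "?b \<in> ?P"
      unfolding toric_ideal_eq_fib_ideal[OF G]
      using slotsD[OF sl] by (subst binomial_in_fib_ideal_iff) auto
    then have "L ?b = 0" using \<open>?P \<subseteq> J\<close> by (auto simp: J_def)
    have "?l m ?b = (if m = m0 then 1 else 0)" if "m \<in> F" for m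
    proof -
      have "m \<in> slots E" using that F by auto
      have "base E m0 \<noteq> m"
      proof
        assume eq: "base E m0 = m"
        then have "base E m = m" using slotsD(5)[OF sl] base_cong by metis
        then show False using slotsD(3)[OF \<open>m \<in> slots E\<close>] by simp
      qed
      then show ?thesis using slotsD[OF sl] by (auto simp: lin_diff)
    qed
    then have "L ?b = (\<Sum>m\<in>F. if m = m0 then c m0 else 0)"
      unfolding L_def by (intro sum.cong refl) auto
    also have "\<dots> = c m0" using F(2) m0 by simp
    finally show False using \<open>L ?b = 0\<close> m0 by simp
  qed
qed

section \<open>Linear relations are spanned by the classes\<close>

definition eval_at :: "'v set set \<Rightarrow> ('v set \<Rightarrow> rat) \<Rightarrow> ('v set \<Rightarrow>\<^sub>0 nat) \<Rightarrow> rat" where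
  "eval_at E g m = (\<Sum>e\<in>E. of_nat (lookup m e) * g e)"

lemma eval_at_add: "eval_at E g (a + b) = eval_at E g a + eval_at E g b"
  by (simp add: eval_at_def lookup_add algebra_simps sum.distrib)

lemma split_off_variable:
  assumes "e \<in> keys (a :: 'x \<Rightarrow>\<^sub>0 nat)"
  shows "\<exists>a'. a = single e 1 + a'"
proof
  show "a = single e 1 + (a - single e 1)"
    by (rule poly_mapping_eqI)
      (use assms in \<open>auto simp: lookup_add lookup_minus lookup_single when_def in_keys_iff\<close>)
qed

text \<open>Linked monomials differ by a relation of smaller degree, so only the steps from one class
  to another contribute new relations.\<close>

lemma slots_span:
  assumes G: "simple_graph V E"
    and g: "\<And>m. m \<in> slots E \<Longrightarrow> \<forall>v\<in>Z. vdeg m v = 0 \<Longrightarrow> eval_at E g m = eval_at E g (base E m)"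
  shows "a \<in> mons E \<Longrightarrow> b \<in> mons E \<Longrightarrow> vdeg a = vdeg b \<Longrightarrow> \<forall>v\<in>Z. vdeg a v = 0 \<Longrightarrow>
    eval_at E g a = eval_at E g b"
proof (induction "\<Sum>v\<in>V. vdeg a v" arbitrary: a b rule: less_induct)
  case less
  have one_link: "eval_at E g x = eval_at E g y" if xy: "(x, y) \<in> link E" "vdeg x = vdeg a" for x y
  proof -
    obtain e where e: "e \<in> keys x" "e \<in> keys y" and mem: "x \<in> mons E" "y \<in> mons E"
      and vd: "vdeg x = vdeg y" using xy(1) by (auto simp: link_def)
    obtain x' y' where x': "x = single e 1 + x'" and y': "y = single e 1 + y'"
      using split_off_variable[OF e(1)] split_off_variable[OF e(2)] by auto
    have vd': "vdeg x' = vdeg y'" using vd by (simp add: x' y' vdeg_add_left_cancel)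
    have eE: "e \<in> E" using e mem by (auto simp: mons_def)
    then have "e \<subseteq> V" "e \<noteq> {}" "finite V" using G by (auto simp: simple_graph_def)
    then obtain v where v: "v \<in> e" "v \<in> V" by auto
    have "(\<Sum>v\<in>V. vdeg x' v) < (\<Sum>v\<in>V. vdeg x v)"
    proof (rule sum_strict_mono_ex1)
      show "\<exists>v\<in>V. vdeg x' v < vdeg x v"
        using v by (intro bexI[of _ v]) (auto simp: x' vdeg_add vdeg_single)
    qed (use \<open>finite V\<close> in \<open>auto simp: x' vdeg_add\<close>)
    moreover have "\<forall>v\<in>Z. vdeg x' v = 0"
      using less.prems(4) xy(2) by (metis x' vdeg_add add_eq_0_iff_both_eq_0)
    ultimately have "eval_at E g x' = eval_at E g y'"
      using less.hyps[of x' y'] mem vd' xy(2) by (auto simp: x' y')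
    then show ?thesis by (simp add: x' y' eval_at_add)
  qed
  have linked: "eval_at E g x = eval_at E g y" if "(x, y) \<in> (link E)\<^sup>*" "vdeg x = vdeg a" for x y
    using that
  proof (induction rule: rtrancl_induct)
    case (step y z)
    then have "vdeg y = vdeg a" using link_rtrancl_vdeg by metis
    then have "eval_at E g y = eval_at E g z" by (rule one_link[OF step.hyps(2)])
    then show ?case using step.IH step.prems by simp
  qed simp
  have to_base: "eval_at E g x = eval_at E g (base E a)" if x: "x \<in> mons E" "vdeg x = vdeg a" for x
  proof -
    have "eval_at E g x = eval_at E g (rep E x)" by (rule linked[OF rep_link x(2)])
    moreover have "base E (rep E x) = base E a" using x by (intro base_cong) simp
    moreover have "rep E x \<in> slots E \<or> base E (rep E x) = rep E x"
      using rep_mons[OF x(1)] by (auto simp: slots_def)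
    moreover have "\<forall>v\<in>Z. vdeg (rep E x) v = 0" using less.prems(4) x by simp
    ultimately show ?thesis using g[of "rep E x"] by metis
  qed
  have "eval_at E g a = eval_at E g (base E a)" using less.prems by (intro to_base) auto
  moreover have "eval_at E g b = eval_at E g (base E a)" using less.prems by (intro to_base) auto
  ultimately show ?case by simp
qed

text \<open>The vectors \<open>y i\<close> span the kernel, in the dual form that a functional vanishing on all of them
  vanishes on the kernel. If there were fewer than \<open>card (E - B)\<close> of them, some nonzero functional
  supported outside \<open>B\<close> would vanish on them, but it cannot vanish on the relations of the edges
  outside \<open>B\<close>.\<close>

lemma edge_basis_card_le:
  assumes "finite E" "edge_basis E B" "finite I"
    and kill: "\<And>g z. \<forall>i\<in>I. (\<Sum>e\<in>E. y i e * g e) = 0 \<Longrightarrow> kern E z \<Longrightarrow> (\<Sum>e\<in>E. z e * g e) = 0"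
  shows "card (E - B) \<le> card I"
proof (rule ccontr)
  assume "\<not> card (E - B) \<le> card I"
  then obtain c where c: "\<exists>f\<in>E - B. c f \<noteq> 0" "\<forall>i\<in>I. (\<Sum>f\<in>E - B. c f * y i f) = 0"
    using nontrivial_solution[of I "E - B" "\<lambda>f i. y i f"] assms(1,3) by auto
  define g where "g e = (if e \<in> E - B then c e else 0)" for e
  have g: "(\<Sum>e\<in>E. w e * g e) = (\<Sum>f\<in>E - B. c f * w f)" for w :: "_ \<Rightarrow> rat"
    by (rule sum.mono_neutral_cong_right) (use assms(1) in \<open>auto simp: g_def\<close>)
  obtain f where f: "f \<in> E - B" "c f \<noteq> 0" using c(1) by auto
  obtain z where z: "kern E z" "z f \<noteq> 0" "\<And>e. e \<in> E - B \<Longrightarrow> e \<noteq> f \<Longrightarrow> z e = 0"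
    using edge_basis_relation[OF assms(2) f(1)] by metis
  have "(\<Sum>e\<in>E - B. c e * z e) = (\<Sum>e\<in>E - B. if e = f then c f * z f else 0)"
    by (intro sum.cong refl) (auto simp: z(3))
  also have "\<dots> = c f * z f" using f assms(1) by simp
  finally have "(\<Sum>e\<in>E. z e * g e) \<noteq> 0" using g f z(2) by simp
  moreover have "\<forall>i\<in>I. (\<Sum>e\<in>E. y i e * g e) = 0" using g c(2) by simp
  ultimately show False using kill[OF _ z(1)] by blast
qed

lemma eval_at_diff:
  "(\<Sum>e\<in>E. (of_nat (lookup a e) - of_nat (lookup b e)) * g e) = eval_at E g a - eval_at E g b"
  by (simp add: eval_at_def algebra_simps sum_subtractf)

lemma kern_killed:
  assumes G: "simple_graph V E"
    and g: "\<And>m. m \<in> slots E \<Longrightarrow> \<forall>v\<in>Z. vdeg m v = 0 \<Longrightarrow>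
      (\<Sum>e\<in>E. (of_nat (lookup m e) - of_nat (lookup (base E m) e)) * g e) = 0"
    and z: "kern E z" "\<And>v e. v \<in> Z \<Longrightarrow> e \<in> E \<Longrightarrow> v \<in> e \<Longrightarrow> z e = 0"
  shows "(\<Sum>e\<in>E. z e * g e) = 0"
proof -
  have finE: "finite E" using simple_graph_finite_edges[OF G] .
  obtain D a b where ab: "D > (0::nat)" "a \<in> mons E" "b \<in> mons E" "vdeg a = vdeg b"
      "\<And>e. of_nat D * z e = of_nat (lookup a e) - of_nat (lookup b e)"
      "\<And>e. z e = 0 \<Longrightarrow> lookup a e = 0 \<and> lookup b e = 0"
    using kern_scaled_monomials[OF finE z(1)] by metis
  have "\<forall>v\<in>Z. vdeg a v = 0" using z(2) ab(6) by (simp add: vdeg_eq_sum[OF finE ab(2)])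
  then have "eval_at E g a = eval_at E g b"
    using slots_span[OF G, of Z g a b] g ab by (simp add: eval_at_diff)
  then have "(\<Sum>e\<in>E. of_nat D * z e * g e) = 0" unfolding ab(5) eval_at_diff by simp
  then have "of_nat D * (\<Sum>e\<in>E. z e * g e) = 0" by (simp add: sum_distrib_left mult.assoc)
  then show ?thesis using ab(1) by simp
qed

lemma card_slots_ge:
  assumes "simple_graph V E" "edge_basis E B" "finite (slots E)"
  shows "card (E - B) \<le> card (slots E)"
  by (rule edge_basis_card_le[OF simple_graph_finite_edges[OF assms(1)] assms(2,3),
      of "\<lambda>m e. of_nat (lookup m e) - of_nat (lookup (base E m) e)"])
    (rule kern_killed[OF assms(1), of "{}"], auto)

lemma kern_diff_scaled:
  assumes "kern E z" "kern E y"
  shows "kern E (\<lambda>e. z e - c * y e)"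
  using assms by (simp add: kern_def sum_subtractf sum_distrib_left[symmetric])

text \<open>Vanishing on the three edges at \<open>v\<close> imposes only two conditions on a relation, because its
  values there add up to zero.\<close>

lemma card_slots_avoiding_ge:
  assumes G: "simple_graph V E" and B: "edge_basis E B" and fin: "finite (slots E)"
    and deg: "degree E v = 3"
  shows "card (E - B) \<le> card {m \<in> slots E. vdeg m v = 0} + 2"
proof -
  let ?S = "{m \<in> slots E. vdeg m v = 0}"
  obtain e1 e2 e3 where e: "{e \<in> E. v \<in> e} = {e1, e2, e3}" "e1 \<noteq> e2" "e1 \<noteq> e3" "e2 \<noteq> e3"
    using deg unfolding degree_def card_3_iff by blast
  \<comment> \<open>\<open>y1\<close> and \<open>y2\<close> reduce the entries at \<open>e1\<close> and \<open>e2\<close> to zero; the zero vector is the default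
    if these entries vanish anyway.\<close>
  define y1 where "y1 = (if \<exists>z. kern E z \<and> z e1 \<noteq> 0 then SOME z. kern E z \<and> z e1 \<noteq> 0 else (\<lambda>_. 0))"
  define y2 where "y2 = (if \<exists>z. kern E z \<and> z e1 = 0 \<and> z e2 \<noteq> 0
    then SOME z. kern E z \<and> z e1 = 0 \<and> z e2 \<noteq> 0 else (\<lambda>_. 0))"
  have y1: "kern E y1 \<and> y1 e1 \<noteq> 0" if "kern E z" "z e1 \<noteq> 0" for z
    unfolding y1_def using that someI[of "\<lambda>z. kern E z \<and> z e1 \<noteq> 0" z] by auto
  have y2: "kern E y2 \<and> y2 e1 = 0 \<and> y2 e2 \<noteq> 0" if "kern E z" "z e1 = 0" "z e2 \<noteq> 0" for z
    unfolding y2_def using that someI[of "\<lambda>z. kern E z \<and> z e1 = 0 \<and> z e2 \<noteq> 0" z] by auto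
  define y where "y i = (case i of Inl m \<Rightarrow> \<lambda>e. of_nat (lookup m e) - of_nat (lookup (base E m) e)
    | Inr t \<Rightarrow> if t then y1 else y2)" for i :: "('a set \<Rightarrow>\<^sub>0 nat) + bool"
  let ?I = "Inl ` ?S \<union> range Inr :: (('a set \<Rightarrow>\<^sub>0 nat) + bool) set"
  have "card (E - B) \<le> card ?I"
  proof (rule edge_basis_card_le[OF simple_graph_finite_edges[OF G] B, of _ y])
    show "finite ?I" using fin by simp
    fix g z assume g: "\<forall>i\<in>?I. (\<Sum>e\<in>E. y i e * g e) = 0" and z: "kern E z"
    have mem: "Inr t \<in> ?I" for t by blast
    have g1: "(\<Sum>e\<in>E. y1 e * g e) = 0" using bspec[OF g mem[of True]] by (simp add: y_def)
    have g2: "(\<Sum>e\<in>E. y2 e * g e) = 0" using bspec[OF g mem[of False]] by (simp add: y_def)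
    have gs: "(\<Sum>e\<in>E. (of_nat (lookup m e) - of_nat (lookup (base E m) e)) * g e) = 0" if "m \<in> ?S" for m
      using g[rule_format, of "Inl m"] that by (simp add: y_def)
    have sub: "(\<Sum>e\<in>E. (w e - c * u e) * g e) = (\<Sum>e\<in>E. w e * g e) - c * (\<Sum>e\<in>E. u e * g e)" for w u c
      by (simp add: algebra_simps sum_subtractf sum_distrib_left)
    have 0: "(\<Sum>e\<in>E. w e * g e) = 0" if w: "kern E w" "w e1 = 0" "w e2 = 0" for w
    proof (rule kern_killed[OF G, of "{v}"])
      have "w e1 + w e2 + w e3 = (\<Sum>e\<in>{e \<in> E. v \<in> e}. w e)" using e by simp
      then have w3: "w e3 = 0" using w by (simp add: kern_def)
      show "w e' = 0" if "u \<in> {v}" "e' \<in> E" "u \<in> e'" for u e'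
      proof -
        have "e' \<in> {e1, e2, e3}" using that e(1) by blast
        then show ?thesis using w(2,3) w3 by auto
      qed
      show "(\<Sum>e\<in>E. (of_nat (lookup m e) - of_nat (lookup (base E m) e)) * g e) = 0"
        if "m \<in> slots E" "\<forall>u\<in>{v}. vdeg m u = 0" for m
        by (rule gs) (use that in simp)
    qed (fact w(1))
    have 1: "(\<Sum>e\<in>E. w e * g e) = 0" if w: "kern E w" "w e1 = 0" for w
    proof (cases "w e2 = 0")
      case False
      note y = y2[OF w False]
      have "(\<Sum>e\<in>E. (w e - w e2 / y2 e2 * y2 e) * g e) = 0"
        by (rule 0, rule kern_diff_scaled) (use w y in auto)
      then show ?thesis unfolding sub g2 by simp
    qed (use 0 w in auto)
    show "(\<Sum>e\<in>E. z e * g e) = 0"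
    proof (cases "z e1 = 0")
      case False
      note y = y1[OF z False]
      have "(\<Sum>e\<in>E. (z e - z e1 / y1 e1 * y1 e) * g e) = 0"
        by (rule 1, rule kern_diff_scaled) (use z y in auto)
      then show ?thesis unfolding sub g1 by simp
    qed (use 1 z in auto)
  qed
  also have "card ?I = card (Inl ` ?S :: (('a set \<Rightarrow>\<^sub>0 nat) + bool) set) + card (range Inr :: (('a set \<Rightarrow>\<^sub>0 nat) + bool) set)"
    using fin by (intro card_Un_disjoint) auto
  also have "\<dots> = card ?S + 2" by (simp add: card_image)
  finally show ?thesis .
qed

section \<open>Counting in a cubic graph\<close>

lemma edge_indep_card_le_equations:
  fixes E :: "'v set set"
  assumes "finite E" "edge_indep E B" "finite J"
    and solve: "\<And>z :: 'v set \<Rightarrow> rat. \<forall>e. e \<notin> B \<longrightarrow> z e = 0 \<Longrightarrow> \<forall>v\<in>J. (\<Sum>e\<in>{e \<in> E. v \<in> e}. z e) = 0 \<Longrightarrow>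
      \<forall>v. (\<Sum>e\<in>{e \<in> E. v \<in> e}. z e) = 0"
  shows "card B \<le> card J"
proof (rule ccontr)
  have B: "B \<subseteq> E" "finite B" using assms finite_subset by (auto simp: edge_indep_def)
  assume "\<not> card B \<le> card J"
  then obtain c where c: "\<exists>e\<in>B. c e \<noteq> 0" "\<forall>v\<in>J. (\<Sum>e\<in>B. c e * of_bool (v \<in> e)) = (0 :: rat)"
    using nontrivial_solution[of J B "\<lambda>e v. of_bool (v \<in> e)"] B assms(3) by auto
  define z where "z e = (if e \<in> B then c e else 0)" for e
  have "(\<Sum>e\<in>{e \<in> E. v \<in> e}. z e) = (\<Sum>e\<in>B. c e * of_bool (v \<in> e))" for v
  proof -
    have "(\<Sum>e\<in>{e \<in> E. v \<in> e}. z e) = (\<Sum>e\<in>{e \<in> B. v \<in> e}. c e)"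
      by (rule sum.mono_neutral_cong_right) (use assms(1) B in \<open>auto simp: z_def\<close>)
    also have "\<dots> = (\<Sum>e\<in>B. c e * of_bool (v \<in> e))"
      by (rule sum.mono_neutral_cong_left) (use B in auto)
    finally show ?thesis .
  qed
  then have "\<forall>v\<in>J. (\<Sum>e\<in>{e \<in> E. v \<in> e}. z e) = 0" using c(2) by simp
  moreover have supp: "\<forall>e. e \<notin> B \<longrightarrow> z e = 0" by (simp add: z_def)
  ultimately have "\<forall>v. (\<Sum>e\<in>{e \<in> E. v \<in> e}. z e) = 0" by (intro solve)
  moreover have "\<forall>e. e \<notin> E \<longrightarrow> z e = 0" using supp B(1) by blast
  ultimately have "kern E z" unfolding kern_def by (rule conjI[rotated])
  then have "\<forall>e. z e = 0" using assms(2) supp unfolding edge_indep_def by simp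
  then show False using c(1) by (metis z_def)
qed

lemma edge_indep_card_le:
  assumes G: "simple_graph V E" and "edge_indep E B"
  shows "card B \<le> card V"
proof (rule edge_indep_card_le_equations[OF simple_graph_finite_edges[OF G] assms(2)])
  show "finite V" using G by (simp add: simple_graph_def)
  fix z :: "'a set \<Rightarrow> rat"
  assume z: "\<forall>v\<in>V. (\<Sum>e\<in>{e \<in> E. v \<in> e}. z e) = 0"
  have "{e \<in> E. v \<in> e} = {}" if "v \<notin> V" for v using that G by (auto simp: simple_graph_def)
  then show "\<forall>v. (\<Sum>e\<in>{e \<in> E. v \<in> e}. z e) = 0" using z by (metis sum.empty)
qed

text \<open>A signing \<open>\<epsilon>\<close> of the vertices that cancels along every edge, as given by a bipartite
  component, makes one of the vertex equations redundant.\<close>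

lemma edge_indep_card_less:
  assumes G: "simple_graph V E" and "edge_indep E B"
    and \<epsilon>: "\<And>e. e \<in> E \<Longrightarrow> (\<Sum>v\<in>e. \<epsilon> v) = (0 :: rat)" "v0 \<in> V" "\<epsilon> v0 \<noteq> 0"
  shows "card B < card V"
proof -
  have fin: "finite V" "finite E" using G simple_graph_finite_edges by (auto simp: simple_graph_def)
  have "card B \<le> card (V - {v0})"
  proof (rule edge_indep_card_le_equations[OF fin(2) assms(2)])
    show "finite (V - {v0})" using fin by simp
    fix z :: "'a set \<Rightarrow> rat"
    assume z: "\<forall>v\<in>V - {v0}. (\<Sum>e\<in>{e \<in> E. v \<in> e}. z e) = 0"
    let ?s = "\<lambda>v. \<Sum>e\<in>{e \<in> E. v \<in> e}. z e"
    have "(\<Sum>v\<in>V. \<epsilon> v * ?s v) = (\<Sum>v\<in>V. \<Sum>e\<in>E. if v \<in> e then \<epsilon> v * z e else 0)"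
      by (intro sum.cong refl) (subst sum_distrib_left, rule sum.inter_filter[OF fin(2)])
    also have "\<dots> = (\<Sum>e\<in>E. \<Sum>v\<in>V. if v \<in> e then \<epsilon> v * z e else 0)" by (rule sum.swap)
    also have "\<dots> = (\<Sum>e\<in>E. 0)"
    proof (intro sum.cong refl)
      fix e assume "e \<in> E"
      then have "e \<subseteq> V" using G by (auto simp: simple_graph_def)
      then have "(\<Sum>v\<in>V. if v \<in> e then \<epsilon> v * z e else 0) = (\<Sum>v\<in>e. \<epsilon> v * z e)"
        using fin(1) by (intro sum.mono_neutral_cong_right) auto
      then show "(\<Sum>v\<in>V. if v \<in> e then \<epsilon> v * z e else 0) = 0"
        using \<epsilon>(1)[OF \<open>e \<in> E\<close>] by (simp add: sum_distrib_right[symmetric])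
    qed
    finally have "(\<Sum>v\<in>V. \<epsilon> v * ?s v) = 0" by simp
    moreover have "(\<Sum>v\<in>V. \<epsilon> v * ?s v) = \<epsilon> v0 * ?s v0 + (\<Sum>v\<in>V - {v0}. \<epsilon> v * ?s v)"
      using fin \<epsilon>(2) by (simp add: sum.remove)
    moreover have "(\<Sum>v\<in>V - {v0}. \<epsilon> v * ?s v) = 0" using z by (intro sum.neutral) auto
    ultimately have "?s v0 = 0" using \<epsilon>(3) by simp
    moreover have "?s v = 0" if "v \<notin> V" for v
    proof -
      have "{e \<in> E. v \<in> e} = {}" using that G by (auto simp: simple_graph_def)
      then show ?thesis by (metis sum.empty)
    qed
    ultimately show "\<forall>v. ?s v = 0" using z by blast
  qed
  then show ?thesis using fin \<epsilon>(2) by (metis card_Diff1_less le_less_trans)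
qed

lemma regular_edge_count:
  assumes G: "simple_graph V E" and "regular d V E"
  shows "2 * card E = d * card V"
proof -
  have fin: "finite V" "finite E" using G simple_graph_finite_edges by (auto simp: simple_graph_def)
  have "d * card V = (\<Sum>v\<in>V. card {e \<in> E. v \<in> e})"
    using assms(2) by (simp add: regular_def degree_def)
  also have "\<dots> = (\<Sum>v\<in>V. \<Sum>e\<in>E. if v \<in> e then 1 else 0)"
    by (intro sum.cong refl) (simp add: sum.inter_filter[OF fin(2), symmetric])
  also have "\<dots> = (\<Sum>e\<in>E. \<Sum>v\<in>V. if v \<in> e then 1 else 0)" by (rule sum.swap)
  also have "\<dots> = (\<Sum>e\<in>E. 2)"
  proof (intro sum.cong refl)
    fix e assume "e \<in> E"
    then have "e \<subseteq> V" "card e = 2" using G by (auto simp: simple_graph_def)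
    then have "{v \<in> V. v \<in> e} = e" by auto
    then show "(\<Sum>v\<in>V. if v \<in> e then 1 else 0) = (2 :: nat)"
      using \<open>card e = 2\<close> by (simp add: sum.inter_filter[OF fin(1), symmetric])
  qed
  finally show ?thesis by simp
qed


section \<open>Classes supported on four vertices are squares\<close>

definition supp :: "('v set \<Rightarrow>\<^sub>0 nat) \<Rightarrow> 'v set" where
  "supp m = {v. vdeg m v > 0}"

lemma supp_eq_Union: "supp m = \<Union> (keys m)"
  by (auto simp: supp_def vdeg_pos_iff)

lemma vdeg_eq_zero_imp:
  assumes "m \<in> mons E" "\<forall>e\<in>E. card e = 2" "\<And>v. vdeg m v = 0"
  shows "m = 0"
proof (rule poly_mapping_eqI, rule ccontr)
  fix e assume "lookup m e \<noteq> lookup 0 e"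
  then have e: "e \<in> keys m" by (simp add: in_keys_iff)
  then have "card e = 2" using assms by (auto simp: mons_def)
  then obtain v where "v \<in> e" by fastforce
  then have "vdeg m v > 0" using e by (auto simp: vdeg_pos_iff)
  then show False using assms(3)[of v] by simp
qed

lemma cover_edge:
  assumes "u \<in> \<Union> K" "\<forall>g\<in>K. card g = 2"
  obtains t where "{u, t} \<in> K" "t \<noteq> u"
proof -
  obtain g where g: "g \<in> K" "u \<in> g" using assms(1) by auto
  then obtain x y where "g = {x, y}" "x \<noteq> y" using assms(2) by (auto simp: card_2_iff)
  then show ?thesis using g that[of x] that[of y] by (auto simp: insert_commute)
qed

text \<open>On at most three vertices the edges of one cover leave too little for a second, disjoint
  cover.\<close>

lemma disjoint_covers_card:
  assumes "\<forall>g\<in>K \<union> K'. card g = 2" "K \<inter> K' = {}" "\<Union> K = \<Union> K'" "K \<noteq> {}" "finite (\<Union> K)"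
  shows "card (\<Union> K) \<ge> 4"
proof (rule ccontr)
  assume small: "\<not> card (\<Union> K) \<ge> 4"
  let ?W = "\<Union> K"
  obtain g where "g \<in> K" using assms(4) by auto
  then obtain a b where ab: "{a, b} \<in> K" "a \<noteq> b" using assms(1) by (metis UnI1 card_2_iff)
  have "a \<in> \<Union> K'" using ab assms(3) by auto
  then obtain c where c: "{a, c} \<in> K'" "c \<noteq> a" by (rule cover_edge) (use assms(1) in auto)
  have "b \<noteq> c" using ab c assms(2) by auto
  have sub: "{a, b, c} \<subseteq> ?W" using ab c assms(3) by auto
  moreover have "card {a, b, c} = 3" using ab c \<open>b \<noteq> c\<close> by auto
  ultimately have "card {a, b, c} = card ?W" using small card_mono[OF assms(5) sub] by simp
  then have W: "?W = {a, b, c}" using card_subset_eq[OF assms(5) sub] by simp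
  have "b \<in> \<Union> K'" using ab assms(3) by auto
  then obtain x where x: "{b, x} \<in> K'" "x \<noteq> b" by (rule cover_edge) (use assms(1) in auto)
  then have "x \<in> {a, b, c}" using W assms(3) by auto
  then have bc: "{b, c} \<in> K'" using x ab assms(2) by (auto simp: insert_commute)
  have "c \<in> \<Union> K" using W by auto
  then obtain y where y: "{c, y} \<in> K" "y \<noteq> c" by (rule cover_edge) (use assms(1) in auto)
  then have "y \<in> {a, b, c}" using W by auto
  then have "{c, y} \<in> K'" using y bc c by (auto simp: insert_commute)
  then show False using y assms(2) by auto
qed

text \<open>A cover of four vertices without a perfect matching is a star, which leaves no edge at its
  centre for the other cover.\<close>

lemma disjoint_covers_matching:
  assumes "\<forall>g\<in>K \<union> K'. card g = 2" "K \<inter> K' = {}" "\<Union> K = W" "\<Union> K' = W" "card W = 4"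
  shows "\<exists>g\<in>K. \<exists>h\<in>K. g \<inter> h = {} \<and> g \<union> h = W"
proof -
  have c2: "\<forall>g\<in>K. card g = 2" "\<forall>g\<in>K'. card g = 2" using assms(1) by auto
  have "W \<noteq> {}" using assms(5) by auto
  then obtain a where "a \<in> W" by auto
  then obtain b where ab: "{a, b} \<in> K" "b \<noteq> a" using cover_edge[of a K] assms(3) c2 by metis
  have abW: "{a, b} \<subseteq> W" using ab assms(3) by auto
  have finW: "finite W" using assms(5) by (metis card.infinite zero_neq_numeral)
  have "card (W - {a, b}) = 2" using assms(5) ab abW finW by (simp add: card_Diff_subset)
  then obtain c d where cd: "W - {a, b} = {c, d}" "c \<noteq> d" by (auto simp: card_2_iff)
  have W: "W = {a, b, c, d}" and neq: "c \<noteq> a" "c \<noteq> b" "d \<noteq> a" "d \<noteq> b" using cd abW by auto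
  obtain s where s: "{c, s} \<in> K" "s \<noteq> c" using cover_edge[of c K] assms(3) c2 W by auto
  obtain t where t: "{d, t} \<in> K" "t \<noteq> d" using cover_edge[of d K] assms(3) c2 W by auto
  obtain p where p: "{a, p} \<in> K'" "p \<noteq> a" using cover_edge[of a K'] assms(4) c2 W by auto
  obtain q where q: "{b, q} \<in> K'" "q \<noteq> b" using cover_edge[of b K'] assms(4) c2 W by auto
  have "s \<in> W" "t \<in> W" using s t assms(3) by auto
  moreover have "p \<in> W" "q \<in> W" using p q assms(4) by auto
  ultimately have mem: "s \<in> {a, b, d}" "t \<in> {a, b, c}" "p \<in> {b, c, d}" "q \<in> {a, c, d}"
    using W s t p q by auto
  have fin: ?thesis if "{c, d} \<in> K"
    by (rule bexI[of _ "{a, b}"], rule bexI[of _ "{c, d}"]) (use that ab neq cd(2) W in auto)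
  have no_star: "\<not> (s = a \<and> t = a)" "\<not> (s = b \<and> t = b)"
    using mem(3,4) s t p q ab assms(2) by (auto simp: insert_commute)
  consider "s = d" | "t = c" | "s = a" "t = b" | "s = b" "t = a" using mem no_star by auto
  then show ?thesis
  proof cases
    case 1 then show ?thesis using fin s by simp
  next
    case 2 then show ?thesis using fin t by (simp add: insert_commute)
  next
    case 3 then show ?thesis 
      by (intro bexI[of _ "{c, a}"] bexI[of _ "{d, b}"]) (use s t neq cd(2) ab W in auto)
  next
    case 4 then show ?thesis 
      by (intro bexI[of _ "{c, b}"] bexI[of _ "{d, a}"]) (use s t neq cd(2) ab W in auto)
  qed
qed

lemma slot_disjoint: "m \<in> slots E \<Longrightarrow> keys m \<inter> keys (base E m) = {}"
  by (rule rep_neq_disjoint[of m E]) (use slotsD[of m E] in auto)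

text \<open>The only monomial of degree zero is the constant one.\<close>

lemma slot_nonzero:
  assumes "simple_graph V E" "m \<in> slots E"
  shows "keys m \<noteq> {}"
proof
  assume "keys m = {}"
  then have "m = 0" by simp
  then have "vdeg (base E m) v = 0" for v using slotsD(5)[OF assms(2)] by simp
  then have "base E m = 0"
    using assms slotsD(4)[OF assms(2)] by (intro vdeg_eq_zero_imp) (auto simp: simple_graph_def)
  then show False using slotsD(3)[OF assms(2)] \<open>m = 0\<close> by simp
qed

lemma supp_subset:
  assumes "simple_graph V E" "m \<in> mons E"
  shows "supp m \<subseteq> V" "finite (supp m)"
  using assms by (auto simp: supp_eq_Union simple_graph_def mons_def intro: finite_subset)

lemma mons_card_two:
  assumes "simple_graph V E" "m \<in> mons E" "m' \<in> mons E"
  shows "\<forall>g\<in>keys m \<union> keys m'. card g = 2"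
  using assms by (auto simp: simple_graph_def mons_def)

lemma slot_supp_base: "m \<in> slots E \<Longrightarrow> supp (base E m) = supp m"
  by (simp add: supp_def slotsD)

lemma slot_supp_card:
  assumes G: "simple_graph V E" and m: "m \<in> slots E"
  shows "card (supp m) \<ge> 4"
  unfolding supp_eq_Union
proof (rule disjoint_covers_card[of _ "keys (base E m)"])
  note mD = slotsD[OF m]
  show "\<forall>g\<in>keys m \<union> keys (base E m). card g = 2" using mons_card_two[OF G mD(1,4)] .
  show "keys m \<inter> keys (base E m) = {}" by (rule slot_disjoint[OF m])
  show "\<Union> (keys m) = \<Union> (keys (base E m))" using slot_supp_base[OF m] by (simp add: supp_eq_Union)
  show "keys m \<noteq> {}" by (rule slot_nonzero[OF G m])
  show "finite (\<Union> (keys m))" using supp_subset[OF G mD(1)] by (simp add: supp_eq_Union)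
qed

lemma vdeg_matching:
  assumes "g \<inter> h = {}" "g \<union> h = W"
  shows "vdeg (single g 1 + single h 1) v = of_bool (v \<in> W)"
  using assms by (auto simp: vdeg_add vdeg_single)

text \<open>If both classes contained a multiple of a perfect matching, exchanging the matching would
  link the two classes; hence both monomials are perfect matchings themselves.\<close>

lemma slot_four_matchings:
  assumes G: "simple_graph V E" and m: "m \<in> slots E" and W: "supp m = W" "card W = 4"
  obtains g h g' h' where "m = single g 1 + single h 1" "g \<inter> h = {}" "g \<union> h = W"
    "base E m = single g' 1 + single h' 1" "g' \<inter> h' = {}" "g' \<union> h' = W"
proof -
  let ?b = "base E m"
  note mD = slotsD[OF m]
  have c2E: "\<forall>e\<in>E. card e = 2" using G by (auto simp: simple_graph_def)
  note c2 = mons_card_two[OF G mD(1,4)]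
  have U: "\<Union> (keys m) = W" "\<Union> (keys ?b) = W"
    using W slot_supp_base[OF m] by (auto simp: supp_eq_Union)
  note dj = slot_disjoint[OF m]
  obtain g h where gh: "g \<in> keys m" "h \<in> keys m" "g \<inter> h = {}" "g \<union> h = W"
    using disjoint_covers_matching[OF c2 dj U W(2)] by blast
  obtain g' h' where gh': "g' \<in> keys ?b" "h' \<in> keys ?b" "g' \<inter> h' = {}" "g' \<union> h' = W"
    using disjoint_covers_matching[OF c2[unfolded Un_commute[of "keys m"]]
        dj[unfolded Int_commute[of "keys m"]] U(2,1) W(2)] by blast
  have neq: "g \<noteq> h" "g' \<noteq> h'" using gh gh' W(2) by auto
  have split: "\<exists>n. x = single p 1 + single q 1 + n"
    if pq: "p \<in> keys x" "q \<in> keys x" "p \<noteq> q" for x :: "'a set \<Rightarrow>\<^sub>0 nat" and p q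
  proof -
    obtain y where y: "x = single p 1 + y" using split_off_variable[OF pq(1)] by auto
    then have "q \<in> keys y" using pq by (auto simp: keys_add_nat)
    then obtain n where "y = single q 1 + n" using exE[OF split_off_variable] by metis
    then have "x = single p 1 + single q 1 + n" using y by (simp only: add.assoc)
    then show ?thesis by (rule exI)
  qed
  obtain n where n: "m = single g 1 + single h 1 + n" using split[OF gh(1,2) neq(1)] by auto
  obtain n' where n': "?b = single g' 1 + single h' 1 + n'" using split[OF gh'(1,2) neq(2)] by auto
  have nE: "n \<in> mons E" "n' \<in> mons E" using mD n n' by auto
  define x where "x = single g' 1 + single h' 1 + n"
  have xE: "x \<in> mons E" using mD(4) n' nE by (auto simp: x_def)
  have vx: "vdeg x = vdeg m"
    using vdeg_matching[OF gh(3,4)] vdeg_matching[OF gh'(3,4)] by (simp add: x_def n vdeg_add fun_eq_iff)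
  have "n = 0"
  proof (rule ccontr)
    assume "n \<noteq> 0"
    then obtain e where "e \<in> keys n" by (metis in_keys_iff lookup_zero poly_mapping_eqI)
    then have "e \<in> keys m" "e \<in> keys x" by (auto simp: x_def n keys_add_nat)
    then have 1: "rep E m = rep E x" using rep_neq_disjoint[OF mD(1) xE] vx by auto
    have "g' \<in> keys x" by (simp add: x_def keys_add_nat)
    then have "rep E x = rep E ?b"
      using rep_neq_disjoint[OF xE mD(4)] vx mD(5) gh'(1) by auto
    then show False using 1 mD by simp
  qed
  moreover have "n' = 0"
  proof (rule vdeg_eq_zero_imp[OF nE(2) c2E])
    fix v
    have "vdeg ?b v = vdeg m v" using mD(5) by simp
    then show "vdeg n' v = 0"
      using vdeg_matching[OF gh(3,4), of v] vdeg_matching[OF gh'(3,4), of v] \<open>n = 0\<close> n n'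
      by (simp add: vdeg_add)
  qed
  ultimately show ?thesis using that n n' gh(3,4) gh'(3,4) by simp
qed

definition c4 :: "'v set set \<Rightarrow> 'v \<Rightarrow> 'v \<Rightarrow> 'v \<Rightarrow> 'v \<Rightarrow> bool" where
  "c4 E v x w y \<longleftrightarrow> distinct [v, x, w, y] \<and> {v, x} \<in> E \<and> {x, w} \<in> E \<and> {w, y} \<in> E \<and> {y, v} \<in> E"

definition squares_at :: "'v set set \<Rightarrow> 'v \<Rightarrow> 'v set set" where
  "squares_at E v = {W. \<exists>x w y. c4 E v x w y \<and> W = {v, x, w, y}}"

definition k4_at :: "'v set set \<Rightarrow> 'v \<Rightarrow> bool" where
  "k4_at E v \<longleftrightarrow> (\<exists>W. v \<in> W \<and> card W = 4 \<and> (\<forall>a\<in>W. \<forall>b\<in>W. a \<noteq> b \<longrightarrow> {a, b} \<in> E))"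

lemma c4_rotate: "c4 E v x w y \<Longrightarrow> c4 E x w y v"
  by (auto simp: c4_def)

lemma c4_squares_at:
  assumes "c4 E v x w y"
  shows "\<forall>u\<in>{v, x, w, y}. {v, x, w, y} \<in> squares_at E u"
proof -
  note r1 = c4_rotate[OF assms] note r2 = c4_rotate[OF r1] note r3 = c4_rotate[OF r2]
  show ?thesis unfolding squares_at_def using assms r1 r2 r3 by (auto intro!: exI)
qed

text \<open>At an end \<open>w\<close> of \<open>g\<close>, the second matching has an edge to an end of \<open>h\<close>, and this edge
  determines the other one.\<close>

lemma matchings_c4:
  assumes "g \<inter> h = {}" "g \<union> h = W" "g' \<inter> h' = {}" "g' \<union> h' = W" "card W = 4"
    "card g = 2" "card h = 2" "card g' = 2" "card h' = 2" "{g, h} \<inter> {g', h'} = {}" "{g, h, g', h'} \<subseteq> E"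
  shows "\<exists>w x y z. c4 E w x z y \<and> W = {w, x, z, y} \<and> {g, h} = {{w, x}, {z, y}} \<and>
    {g', h'} = {{y, w}, {x, z}}"
proof -
  obtain w x where g: "g = {w, x}" "w \<noteq> x" using assms(6) by (auto simp: card_2_iff)
  have *: "\<exists>y z. c4 E w x z y \<and> W = {w, x, z, y} \<and> {g, h} = {{w, x}, {z, y}} \<and> {p, q} = {{y, w}, {x, z}}"
    if F: "w \<in> p" "p \<inter> q = {}" "p \<union> q = W" "card p = 2" "{g, h} \<inter> {p, q} = {}" "{g, h, p, q} \<subseteq> E"
    for p q
  proof -
    obtain y where y: "p = {w, y}" "y \<noteq> w" using F(1,4) by (auto simp: card_2_iff insert_commute)
    have "y \<noteq> x" using y g F(5) by auto
    then have "y \<in> h" using F(3) y assms(1,2) g by auto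
    then obtain z where h: "h = {y, z}" "z \<noteq> y" using assms(7) by (auto simp: card_2_iff insert_commute)
    have wz: "w \<noteq> z" "x \<noteq> z" "w \<noteq> y" using assms(1) g h by auto
    have W: "W = {w, x, y, z}" using assms(2) g h by auto
    have "q = W - p" using F(2,3) by auto
    then have q: "q = {x, z}" using W y \<open>y \<noteq> x\<close> wz h g by auto
    have "c4 E w x z y"
      using F(6) g h y q \<open>y \<noteq> x\<close> wz by (auto simp: c4_def insert_commute)
    moreover have "W = {w, x, z, y}" using W by auto
    moreover have "{g, h} = {{w, x}, {z, y}}" using g h by (simp add: insert_commute)
    moreover have "{p, q} = {{y, w}, {x, z}}" using y q by (simp add: insert_commute)
    ultimately show ?thesis by blast
  qed
  have "w \<in> g' \<or> w \<in> h'" using g assms(2,4) by auto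
  then show ?thesis
  proof
    assume "w \<in> g'"
    show ?thesis
      by (rule exI[of _ w], rule exI[of _ x], rule *[OF \<open>w \<in> g'\<close> assms(3,4,8,10,11)])
  next
    assume "w \<in> h'"
    have eq: "{g', h'} = {h', g'}" by auto
    have "h' \<inter> g' = {}" "h' \<union> g' = W" "{g, h} \<inter> {h', g'} = {}" "{g, h, h', g'} \<subseteq> E"
      using assms by auto
    note swap = *[OF \<open>w \<in> h'\<close> this(1,2) assms(9) this(3,4)]
    show ?thesis unfolding eq by (rule exI[of _ w], rule exI[of _ x], rule swap)
  qed
qed

lemma slot_four_square:
  assumes G: "simple_graph V E" and m: "m \<in> slots E" and W: "supp m = W" "card W = 4"
  obtains w x y z where "c4 E w x z y" "W = {w, x, z, y}" "keys m = {{w, x}, {z, y}}"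
    "keys (base E m) = {{y, w}, {x, z}}"
proof -
  obtain g h g' h' where gh: "m = single g 1 + single h 1" "g \<inter> h = {}" "g \<union> h = W"
    "base E m = single g' 1 + single h' 1" "g' \<inter> h' = {}" "g' \<union> h' = W"
    using slot_four_matchings[OF assms] by metis
  note mD = slotsD[OF m]
  have k: "keys m = {g, h}" unfolding gh(1) by (auto simp: keys_add_nat)
  have k': "keys (base E m) = {g', h'}" unfolding gh(4) by (auto simp: keys_add_nat)
  note k = k k'
  have "\<forall>e\<in>{g, h, g', h'}. card e = 2" using mons_card_two[OF G mD(1,4)] k by auto
  moreover have "{g, h} \<inter> {g', h'} = {}" using slot_disjoint[OF m] k by simp
  moreover have "{g, h, g', h'} \<subseteq> E" using mD(1,4) k by (auto simp: mons_def)
  ultimately obtain w x y z where "c4 E w x z y" "W = {w, x, z, y}" "{g, h} = {{w, x}, {z, y}}"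
    "{g', h'} = {{y, w}, {x, z}}"
    using matchings_c4[OF gh(2,3,5,6) W(2), of E] by auto
  then show thesis using that k by metis
qed

lemma slot_four_vdeg:
  assumes G: "simple_graph V E" and m: "m \<in> slots E" and W: "supp m = W" "card W = 4"
  shows "vdeg m = (\<lambda>v. of_bool (v \<in> W))"
proof -
  obtain g h g' h' where gh: "m = single g 1 + single h 1" "g \<inter> h = {}" "g \<union> h = W"
    using slot_four_matchings[OF assms] by metis
  then show ?thesis by (intro ext) (simp only: gh(1) vdeg_matching[OF gh(2,3)])
qed

lemma edge_degree_unique:
  assumes c2: "\<forall>e\<in>E. card e = 2" and n: "n \<in> mons E" "vdeg n = vdeg (single f 1)" and f: "card f = 2"
  shows "n = single f 1"
proof -
  obtain u where u: "u \<in> f" using f by fastforce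
  then have "vdeg n u > 0" using n by (simp add: vdeg_single)
  then obtain g where g: "g \<in> keys n" by (auto simp: vdeg_pos_iff)
  have "x \<in> f" if "x \<in> g" for x
  proof -
    have "vdeg n x > 0" using that g by (auto simp: vdeg_pos_iff)
    then show ?thesis using n(2) by (simp add: vdeg_single split: if_splits)
  qed
  moreover have "card g = 2" "finite f"
    using g n c2 f by (auto simp: mons_def card_eq_0_iff intro: card_ge_0_finite)
  ultimately have "g = f" using f by (metis card_subset_eq subsetI)
  then obtain n' where n': "n = single f 1 + n'" using split_off_variable[OF g] by auto
  have "n' = 0"
  proof (rule vdeg_eq_zero_imp[OF _ c2])
    show "n' \<in> mons E" using n n' by simp
    show "vdeg n' v = 0" for v using n(2) n' by (simp add: fun_eq_iff vdeg_add)
  qed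
  then show ?thesis using n' by simp
qed

lemma matching_rep:
  assumes c2: "\<forall>e\<in>E. card e = 2" and gh: "card g = 2" "card h = 2"
  shows "rep E (single g 1 + single h 1) = single g 1 + single h 1"
proof -
  let ?m = "single g 1 + single h 1 :: _ \<Rightarrow>\<^sub>0 nat"
  have one: "m' = ?m" if "(?m, m') \<in> link E" for m'
  proof -
    have aux: "m' = single p 1 + single q 1"
      if pq: "(single p 1 + single q 1, m') \<in> link E" "p \<in> keys m'" "card q = 2" for p q
    proof -
      obtain n where n: "m' = single p 1 + n" using split_off_variable[OF pq(2)] by auto
      have "n \<in> mons E" "vdeg n = vdeg (single q 1)"
        using pq(1) n by (auto simp: link_def vdeg_add_left_cancel)
      then show ?thesis using edge_degree_unique[OF c2] pq(3) n by metis
    qed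
    have "g \<in> keys m' \<or> h \<in> keys m'" using that by (auto simp: link_def keys_add_nat)
    then show ?thesis using aux[of g h] aux[of h g] that gh by (auto simp: add.commute)
  qed
  have "m' = ?m" if "(?m, m') \<in> (link E)\<^sup>*" for m'
    using that
  proof (induction rule: rtrancl_induct)
    case (step y z)
    then have "(?m, z) \<in> link E" by (simp only:)
    then show ?case by (rule one)
  qed (rule refl)
  then show ?thesis using rep_link by metis
qed

text \<open>The two perfect matchings of a square are not linked to any other monomial, so they represent
  different classes of their degree, and at least one of these is not the distinguished one.\<close>

lemma c4_slot:
  assumes G: "simple_graph V E" and c: "c4 E v x w y"
  shows "\<exists>m\<in>slots E. supp m = {v, x, w, y}"
proof -
  let ?a = "single {v, x} 1 + single {w, y} 1 :: _ \<Rightarrow>\<^sub>0 nat"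
  let ?b = "single {x, w} 1 + single {y, v} 1 :: _ \<Rightarrow>\<^sub>0 nat"
  have c2: "\<forall>e\<in>E. card e = 2" using G by (auto simp: simple_graph_def)
  have "card {v, x} = 2" "card {w, y} = 2" "card {x, w} = 2" "card {y, v} = 2"
    using c by (auto simp: c4_def)
  then have rep: "rep E ?a = ?a" "rep E ?b = ?b" by (simp_all only: matching_rep[OF c2])
  have mem: "?a \<in> mons E" "?b \<in> mons E" using c by (auto simp: c4_def mons_def keys_add_nat)
  have vd: "vdeg ?a u = of_bool (u \<in> {v, x, w, y})" "vdeg ?b u = of_bool (u \<in> {v, x, w, y})" for u
    using c by (auto simp: c4_def vdeg_add vdeg_single)
  have supp: "supp ?a = {v, x, w, y}" "supp ?b = {v, x, w, y}"
    unfolding supp_def vd by auto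
  have "vdeg ?a = vdeg ?b" using vd by (intro ext) simp
  then have base: "base E ?a = base E ?b" by (rule base_cong)
  have "{v, x} \<in> keys ?a" by (simp add: keys_add_nat)
  moreover have "{v, x} \<notin> keys ?b" using c by (auto simp: keys_add_nat c4_def doubleton_eq_iff)
  ultimately have "?a \<noteq> ?b" by metis
  then have "?a \<in> slots E \<or> ?b \<in> slots E" using rep mem base by (auto simp: slots_def)
  then show ?thesis using supp by metis
qed

section \<open>The squares of a cubic complete intersection\<close>

lemma corank_ge:
  assumes G: "simple_graph V E" and reg: "regular 3 V E" and B: "edge_basis E B"
  shows "card V \<le> 2 * card (E - B)" and "2 * card (E - B) + 2 * card B = 3 * card V"
proof -
  have BE: "B \<subseteq> E" and ind: "edge_indep E B" using B by (auto simp: edge_basis_def edge_indep_def)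
  have finE: "finite E" using simple_graph_finite_edges[OF G] .
  have "card (E - B) + card B = card E"
    using BE finE by (metis add.commute card_Diff_subset card_mono finite_subset le_add_diff_inverse)
  then show *: "2 * card (E - B) + 2 * card B = 3 * card V"
    using regular_edge_count[OF G reg] by linarith
  show "card V \<le> 2 * card (E - B)" using * edge_indep_card_le[OF G ind] by linarith
qed

text \<open>Double counting of the pairs of a slot and a vertex that it involves: there are at least four
  times \<open>card (E - B)\<close> and at most twice \<open>card V\<close> of them.\<close>

lemma ci_slot_counts:
  assumes G: "simple_graph V E" and reg: "regular 3 V E" and B: "edge_basis E B"
    and fin: "finite (slots E)" and le: "card (slots E) \<le> card (E - B)"
  shows "2 * card (E - B) = card V"
    and "\<And>m. m \<in> slots E \<Longrightarrow> card (supp m) = 4"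
    and "\<And>v. v \<in> V \<Longrightarrow> card {m \<in> slots E. v \<in> supp m} = 2"
proof -
  let ?q = "card (E - B)" and ?N = "card (slots E)"
  have finV: "finite V" using G by (simp add: simple_graph_def)
  have q: "card V \<le> 2 * ?q" using corank_ge(1)[OF G reg B] .
  have N: "?q \<le> ?N" using card_slots_ge[OF G B fin] .
  have at: "card {m \<in> slots E. v \<in> supp m} \<le> 2" if "v \<in> V" for v
  proof -
    have "degree E v = 3" using reg that by (simp add: regular_def)
    then have "?q \<le> card {m \<in> slots E. vdeg m v = 0} + 2"
      by (rule card_slots_avoiding_ge[OF G B fin])
    moreover have "?N = card ({m \<in> slots E. vdeg m v = 0} \<union> {m \<in> slots E. v \<in> supp m})"
      by (rule arg_cong[of _ _ card]) (auto simp: supp_def)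
    then have "?N = card {m \<in> slots E. vdeg m v = 0} + card {m \<in> slots E. v \<in> supp m}"
      using fin by (subst (asm) card_Un_disjoint) (auto simp: supp_def)
    ultimately show ?thesis using le by linarith
  qed
  have "(\<Sum>m\<in>slots E. card (supp m)) = (\<Sum>m\<in>slots E. \<Sum>v\<in>V. if v \<in> supp m then 1 else 0)"
  proof (intro sum.cong refl)
    fix m assume "m \<in> slots E"
    then have "{v \<in> V. v \<in> supp m} = supp m" using supp_subset(1)[OF G] slotsD(1) by blast
    then show "card (supp m) = (\<Sum>v\<in>V. if v \<in> supp m then 1 else 0)"
      by (simp add: sum.inter_filter[OF finV, symmetric])
  qed
  also have "\<dots> = (\<Sum>v\<in>V. \<Sum>m\<in>slots E. if v \<in> supp m then 1 else 0)" by (rule sum.swap)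
  also have "\<dots> = (\<Sum>v\<in>V. card {m \<in> slots E. v \<in> supp m})"
    by (simp add: sum.inter_filter[OF fin, symmetric])
  finally have count: "(\<Sum>m\<in>slots E. card (supp m)) = (\<Sum>v\<in>V. card {m \<in> slots E. v \<in> supp m})" .
  have low: "(\<Sum>m\<in>slots E. 4) \<le> (\<Sum>m\<in>slots E. card (supp m))"
    using slot_supp_card[OF G] by (intro sum_mono)
  have high: "(\<Sum>v\<in>V. card {m \<in> slots E. v \<in> supp m}) \<le> (\<Sum>v\<in>V. 2)" using at by (intro sum_mono)
  have eqs: "(\<Sum>m\<in>slots E. 4) = (\<Sum>m\<in>slots E. card (supp m))"
    "(\<Sum>v\<in>V. card {m \<in> slots E. v \<in> supp m}) = (\<Sum>v\<in>V. 2)" and "2 * ?q = card V"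
    using low high count q N le by (simp_all)
  then show "2 * ?q = card V" by simp
  show "card (supp m) = 4" if "m \<in> slots E" for m
    using sum_mono_inv[OF eqs(1) slot_supp_card[OF G] that fin] by simp
  show "card {m \<in> slots E. v \<in> supp m} = 2" if "v \<in> V" for v
    using sum_mono_inv[OF eqs(2) at that finV] by simp
qed

lemma ci_at_most_two_squares:
  assumes G: "simple_graph V E" and two: "card {m \<in> slots E. v \<in> supp m} = 2"
    and W: "W1 \<in> squares_at E v" "W2 \<in> squares_at E v" "W3 \<in> squares_at E v"
  shows "W1 = W2 \<or> W1 = W3 \<or> W2 = W3"
proof (rule ccontr)
  assume neq: "\<not> ?thesis"
  have ex: "\<exists>m. m \<in> slots E \<and> supp m = W \<and> v \<in> W" if "W \<in> squares_at E v" for W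
    using that c4_slot[OF G] unfolding squares_at_def by blast
  obtain m1 m2 m3 where m: "m1 \<in> slots E" "supp m1 = W1" "v \<in> W1" "m2 \<in> slots E" "supp m2 = W2"
    "v \<in> W2" "m3 \<in> slots E" "supp m3 = W3" "v \<in> W3"
    using ex[OF W(1)] ex[OF W(2)] ex[OF W(3)] by blast
  have "card {m1, m2, m3} \<le> card {m \<in> slots E. v \<in> supp m}"
    using two m by (intro card_mono) (auto intro: card_ge_0_finite)
  moreover have "m1 \<noteq> m2" "m1 \<noteq> m3" "m2 \<noteq> m3" using m neq by auto
  ultimately show False using two by simp
qed

text \<open>Two slots with the same four vertices come, together with the distinguished class of their
  degree, from three disjoint perfect matchings, which are all edges on these vertices.\<close>

lemma ci_two_squares:
  assumes G: "simple_graph V E" and two: "card {m \<in> slots E. v \<in> supp m} = 2"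
    and four: "\<And>m. m \<in> slots E \<Longrightarrow> card (supp m) = 4"
  shows "k4_at E v \<or> (\<exists>W1\<in>squares_at E v. \<exists>W2\<in>squares_at E v. W1 \<noteq> W2)"
proof -
  obtain m1 m2 where "{m \<in> slots E. v \<in> supp m} = {m1, m2}" and neq: "m1 \<noteq> m2"
    using two by (auto simp: card_2_iff)
  then have m: "m1 \<in> slots E" "v \<in> supp m1" "m2 \<in> slots E" "v \<in> supp m2" by auto
  have sq: "supp n \<in> squares_at E v" if "n \<in> slots E" "v \<in> supp n" for n
    using slot_four_square[OF G that(1) refl four[OF that(1)]] c4_squares_at that(2) by metis
  show ?thesis
  proof (cases "supp m1 = supp m2")
    case False
    then show ?thesis using sq m by blast
  next
    case True
    let ?W = "supp m1"
    note D1 = slotsD[OF m(1)] note D2 = slotsD[OF m(3)]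
    have "vdeg m1 = vdeg m2"
      using slot_four_vdeg[OF G m(1) refl four[OF m(1)]] slot_four_vdeg[OF G m(3) True[symmetric]] four[OF m(1)]
      by simp
    moreover from this have "base E m1 = base E m2" by (rule base_cong)
    ultimately have dj: "keys m1 \<inter> keys m2 = {}" "keys (base E m1) \<inter> keys m2 = {}"
      using rep_neq_disjoint[OF D1(1) D2(1)] D1 D2 neq slot_disjoint[OF m(3)] by auto
    obtain w x y z where sqr: "c4 E w x z y" "?W = {w, x, z, y}" "keys m1 = {{w, x}, {z, y}}"
      "keys (base E m1) = {{y, w}, {x, z}}"
      using slot_four_square[OF G m(1) refl four[OF m(1)]] by metis
    have U: "\<Union> (keys m2) = {w, x, z, y}" using True sqr(2) by (simp add: supp_eq_Union)
    have c2: "\<forall>g\<in>keys m2. card g = 2" and k2E: "keys m2 \<subseteq> E"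
      using mons_card_two[OF G D2(1) D2(1)] D2(1) by (auto simp: mons_def)
    obtain s where s: "{w, s} \<in> keys m2" "s \<noteq> w" using cover_edge[of w "keys m2"] U c2 by auto
    obtain t where t: "{x, t} \<in> keys m2" "t \<noteq> x" using cover_edge[of x "keys m2"] U c2 by auto
    have mem: "s \<in> {w, x, z, y}" "t \<in> {w, x, z, y}" using s t U by auto
    have "s = z" using mem s dj sqr(3,4) by (auto simp: insert_commute)
    moreover have "t = y" using mem t dj sqr(3,4) by (auto simp: insert_commute)
    ultimately have diag: "{w, z} \<in> E" "{x, y} \<in> E" using s t k2E by auto
    have "\<forall>a\<in>?W. \<forall>b\<in>?W. a \<noteq> b \<longrightarrow> {a, b} \<in> E"
      using diag sqr(1) unfolding sqr(2) by (auto simp: c4_def insert_commute)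
    then show ?thesis using m(2) four[OF m(1)] unfolding k4_at_def by blast
  qed
qed

section \<open>Cubic graphs with two squares at every vertex\<close>

locale cubic_two_squares =
  fixes V :: "'v set" and E :: "'v set set"
  assumes graph: "simple_graph V E"
    and cubic: "\<And>v. v \<in> V \<Longrightarrow> degree E v = 3"
    and at_most: "\<And>v W1 W2 W3. v \<in> V \<Longrightarrow> W1 \<in> squares_at E v \<Longrightarrow> W2 \<in> squares_at E v \<Longrightarrow>
      W3 \<in> squares_at E v \<Longrightarrow> W1 = W2 \<or> W1 = W3 \<or> W2 = W3"
    and at_least: "\<And>v. v \<in> V \<Longrightarrow> \<not> k4_at E v \<Longrightarrow>
      \<exists>W1\<in>squares_at E v. \<exists>W2\<in>squares_at E v. W1 \<noteq> W2"
begin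

definition nb :: "'v \<Rightarrow> 'v set" where "nb v = {u. {v, u} \<in> E}"

definition good :: "'v \<Rightarrow> bool" where "good v \<longleftrightarrow> v \<in> V \<and> \<not> k4_at E v"

lemma nb_sym: "u \<in> nb v \<longleftrightarrow> v \<in> nb u"
  by (simp add: nb_def insert_commute)

lemma nb_irrefl: "u \<in> nb v \<Longrightarrow> u \<noteq> v"
  using graph by (auto simp: nb_def simple_graph_def)

lemma nb_in_V: "u \<in> nb v \<Longrightarrow> u \<in> V" "u \<in> nb v \<Longrightarrow> v \<in> V"
  using graph by (auto simp: nb_def simple_graph_def)

lemma card_nb:
  assumes "v \<in> V"
  shows "card (nb v) = 3"
proof -
  have "{e \<in> E. v \<in> e} = (\<lambda>u. {v, u}) ` nb v"
  proof
    show "{e \<in> E. v \<in> e} \<subseteq> (\<lambda>u. {v, u}) ` nb v"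
    proof
      fix e assume e: "e \<in> {e \<in> E. v \<in> e}"
      then have "card e = 2" using graph by (auto simp: simple_graph_def)
      then obtain u where "e = {v, u}" using e by (auto simp: card_2_iff insert_commute)
      then show "e \<in> (\<lambda>u. {v, u}) ` nb v" using e by (auto simp: nb_def)
    qed
  qed (auto simp: nb_def)
  moreover have "inj_on (\<lambda>u. {v, u}) (nb v)" by (auto simp: inj_on_def doubleton_eq_iff)
  ultimately show ?thesis using cubic[OF assms] by (simp add: degree_def card_image)
qed

lemma nb_eqI:
  assumes "v \<in> V" "a \<in> nb v" "b \<in> nb v" "c \<in> nb v" "a \<noteq> b" "a \<noteq> c" "b \<noteq> c"
  shows "nb v = {a, b, c}"
proof -
  have "{a, b, c} \<subseteq> nb v" "card {a, b, c} = card (nb v)" using assms card_nb by auto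
  moreover have "finite (nb v)" using card_nb[OF assms(1)] by (simp add: card_ge_0_finite)
  ultimately show ?thesis using card_subset_eq by metis
qed

lemma c4_iff: "c4 E v x w y \<longleftrightarrow> v \<noteq> w \<and> x \<noteq> y \<and> x \<in> nb v \<and> y \<in> nb v \<and> x \<in> nb w \<and> y \<in> nb w"
  using nb_irrefl by (auto simp: c4_def nb_def insert_commute)

lemma c4_square: "c4 E v x w y \<Longrightarrow> {v, x, w, y} \<in> squares_at E v"
  by (auto simp: squares_at_def)

text \<open>A complete graph on four vertices uses up all edges at its vertices.\<close>

lemma good_nb:
  assumes "good v" "u \<in> nb v"
  shows "good u"
proof -
  have "\<not> k4_at E u"
  proof
    assume "k4_at E u"
    then obtain W where W: "u \<in> W" "card W = 4" "\<forall>a\<in>W. \<forall>b\<in>W. a \<noteq> b \<longrightarrow> {a, b} \<in> E"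
      by (auto simp: k4_at_def)
    have uV: "u \<in> V" using nb_in_V assms by auto
    have "W - {u} \<subseteq> nb u" using W by (auto simp: nb_def)
    moreover have "card (W - {u}) = card (nb u)" using W card_nb[OF uV] by simp
    moreover have "finite (nb u)" using card_nb[OF uV] by (simp add: card_ge_0_finite)
    ultimately have "W - {u} = nb u" using card_subset_eq by metis
    then have "v \<in> W" using assms nb_sym by blast
    then show False using W assms by (auto simp: k4_at_def good_def)
  qed
  then show ?thesis using nb_in_V assms by (auto simp: good_def)
qed

text \<open>Three common neighbours would give three squares at \<open>v\<close>.\<close>

lemma no_three_common_neighbours:
  assumes "v \<noteq> t" "a \<in> nb v" "b \<in> nb v" "c \<in> nb v" "a \<in> nb t" "b \<in> nb t" "c \<in> nb t"
    "a \<noteq> b" "a \<noteq> c" "b \<noteq> c"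
  shows False
proof -
  have c: "c4 E v a t b" "c4 E v a t c" "c4 E v b t c" using assms by (auto simp: c4_iff)
  have "{v, a, t, b} \<noteq> {v, a, t, c}" "{v, a, t, b} \<noteq> {v, b, t, c}" "{v, a, t, c} \<noteq> {v, b, t, c}"
    using c assms by (auto simp: c4_def)
  then show False using at_most[of v] c4_square c nb_in_V(2) assms(2) by metis
qed

text \<open>The rung at a vertex is the edge that its two squares share.\<close>

definition rung_data :: "'v \<Rightarrow> 'v \<Rightarrow> 'v \<Rightarrow> 'v \<Rightarrow> 'v \<Rightarrow> 'v \<Rightarrow> bool" where
  "rung_data v u x y x' y' \<longleftrightarrow> distinct [v, u, x, y, x', y'] \<and> nb v = {u, x, y} \<and>
    nb u = {v, x', y'} \<and> x' \<in> nb x \<and> y' \<in> nb y"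

definition rung :: "'v \<Rightarrow> 'v \<Rightarrow> bool" where
  "rung v u \<longleftrightarrow> (\<exists>x y x' y'. rung_data v u x y x' y')"

lemma rungI: "rung_data v u x y x' y' \<Longrightarrow> rung v u"
  unfolding rung_def by blast

lemma rung_data_swap: "rung_data v u x y x' y' \<Longrightarrow> rung_data v u y x y' x'"
  by (auto simp: rung_data_def)

lemma rung_data_sym: "rung_data v u x y x' y' \<Longrightarrow> rung_data u v x' y' x y"
  by (auto simp: rung_data_def nb_sym)

lemma rung_sym: "rung v u \<Longrightarrow> rung u v"
  unfolding rung_def using rung_data_sym by blast

lemma rung_nb: "rung v u \<Longrightarrow> u \<in> nb v"
  by (auto simp: rung_def rung_data_def)

lemma rung_data_squares:
  assumes "rung_data v u x y x' y'"
  shows "{v, u, x, x'} \<in> squares_at E v" "{v, u, y, y'} \<in> squares_at E v"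
    "{v, u, x, x'} \<in> squares_at E x" "{v, u, x, x'} \<noteq> {v, u, y, y'}"
proof -
  have m: "x \<in> nb v" "u \<in> nb v" "y \<in> nb v" "x' \<in> nb u" "y' \<in> nb u" "x' \<in> nb x" "y' \<in> nb y"
    and d: "distinct [v, u, x, y, x', y']" using assms by (auto simp: rung_data_def)
  have c: "c4 E v x x' u" "c4 E v y y' u" using m d by (auto simp: c4_iff nb_sym)
  have eq: "{v, x, x', u} = {v, u, x, x'}" "{v, y, y', u} = {v, u, y, y'}" by auto
  show "{v, u, x, x'} \<in> squares_at E v" "{v, u, y, y'} \<in> squares_at E v"
    "{v, u, x, x'} \<in> squares_at E x"
    using c4_squares_at[OF c(1)] c4_squares_at[OF c(2)] unfolding eq by auto
  show "{v, u, x, x'} \<noteq> {v, u, y, y'}" using d by auto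
qed

text \<open>Two squares at \<open>v\<close> use different pairs of neighbours, since otherwise these two neighbours would
  have three common neighbours. The pairs have one neighbour \<open>u\<close> in common. Any further coincidence
  between the vertices of the two squares would again produce three common neighbours or identify
  the squares.\<close>

lemma rung_exists:
  assumes "good v"
  shows "\<exists>u. rung v u"
proof -
  have vV: "v \<in> V" using assms by (simp add: good_def)
  obtain x1 w1 y1 x2 w2 y2 where c: "c4 E v x1 w1 y1" "c4 E v x2 w2 y2"
    and W: "{v, x1, w1, y1} \<noteq> {v, x2, w2, y2}"
    using at_least[OF vV] assms unfolding good_def squares_at_def by blast
  have pairs: "{x1, y1} \<noteq> {x2, y2}"
  proof
    assume eq: "{x1, y1} = {x2, y2}"
    then have "{v, x1, w1, y1} = {v, w1} \<union> {x2, y2}" by auto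
    then have "w1 \<noteq> w2" using W by auto
    moreover have "v \<noteq> w1" "v \<noteq> w2" "x1 \<noteq> y1" using c by (auto simp: c4_iff)
    moreover have "{v, w1, w2} \<subseteq> nb x1 \<inter> nb y1"
      using c eq unfolding c4_iff by (auto simp: doubleton_eq_iff nb_sym)
    ultimately show False using no_three_common_neighbours[of x1 y1 v w1 w2] by auto
  qed
  have key: "\<exists>u. rung v u" if c: "c4 E v u p x" "c4 E v u q y" and xy: "x \<noteq> y"
    and W: "{v, u, p, x} \<noteq> {v, u, q, y}" for u p x q y
  proof -
    have m: "v \<noteq> p" "v \<noteq> q" "u \<noteq> x" "u \<noteq> y" "u \<in> nb v" "x \<in> nb v" "y \<in> nb v" "u \<in> nb p" "x \<in> nb p"
      "u \<in> nb q" "y \<in> nb q" using c by (auto simp: c4_iff)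
    have nv: "nb v = {u, x, y}" using m xy vV by (intro nb_eqI) auto
    have V: "u \<in> V" "x \<in> V" "y \<in> V" using nb_in_V m by auto
    have irr: "v \<noteq> u" "v \<noteq> x" "v \<noteq> y" "p \<noteq> u" "p \<noteq> x" "q \<noteq> u" "q \<noteq> y" using m nb_irrefl by metis+
    have "p \<noteq> y"
    proof
      assume py: "p = y"
      then have "nb y = {u, x, v}" using m xy V irr by (intro nb_eqI) (auto simp: nb_sym)
      moreover have "q \<in> nb y" using m nb_sym by auto
      ultimately have "q = x" using m irr by auto
      then show False using W py by auto
    qed
    moreover have "q \<noteq> x"
    proof
      assume qx: "q = x"
      then have "nb x = {u, y, v}" using m xy V irr by (intro nb_eqI) (auto simp: nb_sym)
      moreover have "p \<in> nb x" using m nb_sym by auto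
      ultimately have "p = y" using m irr by auto
      then show False using W qx by auto
    qed
    moreover have "p \<noteq> q"
    proof
      assume "p = q"
      then show False using no_three_common_neighbours[of v p u x y] m xy by auto
    qed
    moreover have "nb u = {v, p, q}" using m V \<open>p \<noteq> q\<close> by (intro nb_eqI) (auto simp: nb_sym)
    ultimately have "rung_data v u x y p q"
      unfolding rung_data_def using m irr xy nv by (auto simp: nb_sym)
    then show ?thesis using rungI by blast
  qed
  have flip: "c4 E v y w x" if "c4 E v x w y" for x w y using that by (auto simp: c4_iff)
  have sets: "{v, y, w, x} = {v, x, w, y}" for x w y by auto
  have "x1 \<noteq> y1" "x2 \<noteq> y2" "{x1, y1, x2, y2} \<subseteq> nb v" using c by (auto simp: c4_iff)
  then have "{x1, y1} \<inter> {x2, y2} \<noteq> {}"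
  proof -
    have "card {x1, y1, x2, y2} \<le> 3"
      using card_mono[OF _ \<open>{x1, y1, x2, y2} \<subseteq> nb v\<close>] card_nb[OF vV] by (simp add: card_ge_0_finite)
    then have "\<not> distinct [x1, y1, x2, y2]"
      using distinct_card[of "[x1, y1, x2, y2]"] by (intro notI) simp
    then show ?thesis using \<open>x1 \<noteq> y1\<close> \<open>x2 \<noteq> y2\<close> by auto
  qed
  then consider "x1 = x2" | "x1 = y2" | "y1 = x2" | "y1 = y2" by auto
  then show ?thesis
  proof cases
    case 1
    then show ?thesis using key[of x2 w1 y1 w2 y2] c W pairs by auto
  next
    case 2
    then show ?thesis using key[of y2 w1 y1 w2 x2] c(1) flip[OF c(2)] W pairs sets by auto
  next
    case 3
    then show ?thesis using key[of x2 w1 x1 w2 y2] flip[OF c(1)] c(2) W pairs sets by auto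
  next
    case 4
    then show ?thesis using key[of y2 w1 x1 w2 x2] flip[OF c(1)] flip[OF c(2)] W pairs sets by auto
  qed
qed

text \<open>A second rung would provide a third square at \<open>v\<close>.\<close>

lemma rung_unique:
  assumes "v \<in> V" "rung v u" "rung v t"
  shows "u = t"
proof (rule ccontr)
  assume "u \<noteq> t"
  have key: False if d: "rung_data v u t y t' y'" for y t' y'
  proof -
    obtain p q p' q' where e: "rung_data v t p q p' q'" using assms(3) by (auto simp: rung_def)
    have "y \<in> nb v" "y \<noteq> t" using d by (auto simp: rung_data_def)
    moreover have "nb v = {t, p, q}" using e by (simp add: rung_data_def)
    ultimately have "y = p \<or> y = q" by simp
    then obtain s where "{v, t, y, s} \<in> squares_at E v" using rung_data_squares(1,2)[OF e] by blast
    moreover have "y \<notin> {v, u, t, t'}" "t \<notin> {v, u, y, y'}" using d by (auto simp: rung_data_def)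
    then have "{v, t, y, s} \<noteq> {v, u, t, t'}" "{v, t, y, s} \<noteq> {v, u, y, y'}" by blast+
    ultimately show False
      using at_most[OF assms(1) _ rung_data_squares(1,2)[OF d]] rung_data_squares(4)[OF d] by metis
  qed
  obtain x y x' y' where d: "rung_data v u x y x' y'" using assms(2) by (auto simp: rung_def)
  have "t \<in> nb v" using rung_nb assms(3) by auto
  then have "t = x \<or> t = y" using d \<open>u \<noteq> t\<close> by (auto simp: rung_data_def)
  then show False using key d rung_data_swap[OF d] by auto
qed

text \<open>The square that contains the rung \<open>v u\<close> and the edge \<open>v x\<close> is one of the two squares at \<open>x\<close>,
  hence contains the rung at \<open>x\<close>; this rung is not the edge \<open>x v\<close>, because the rung at \<open>v\<close> is
  unique.\<close>

lemma rung_step: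
  assumes g: "good v" and d: "rung_data v u x y x' y'"
  shows "rung x x'"
proof -
  have vV: "v \<in> V" using g by (simp add: good_def)
  have "x \<in> nb v" using d by (auto simp: rung_data_def)
  then have gx: "good x" using good_nb g by auto
  then obtain t where t: "rung x t" using rung_exists by auto
  then obtain p q p' q' where e: "rung_data x t p q p' q'" by (auto simp: rung_def)
  have xV: "x \<in> V" using gx by (simp add: good_def)
  have "{v, u, x, x'} = {x, t, p, p'} \<or> {v, u, x, x'} = {x, t, q, q'}"
    using at_most[OF xV rung_data_squares(3)[OF d] rung_data_squares(1,2)[OF e]] rung_data_squares(4)[OF e]
    by auto
  then have "t \<in> {v, u, x, x'}" by auto
  moreover have "t \<in> nb x" using rung_nb t by auto
  then have "t \<noteq> x" using nb_irrefl by auto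
  moreover have "t \<noteq> u"
  proof
    assume "t = u"
    then have "x \<in> nb u" using \<open>t \<in> nb x\<close> nb_sym by auto
    then show False using d by (auto simp: rung_data_def)
  qed
  moreover have "t \<noteq> v"
  proof
    assume "t = v"
    then have "rung v x" using t rung_sym by auto
    moreover have "rung v u" using d by (rule rungI)
    ultimately have "u = x" using rung_unique vV by auto
    then show False using d by (auto simp: rung_data_def)
  qed
  ultimately have "t = x'" by blast
  then show ?thesis using t by simp
qed

text \<open>Two consecutive rungs \<open>a b\<close> and \<open>a' b'\<close> with their two rails; it continues
  along the third edges at \<open>a'\<close> and \<open>b'\<close>.\<close>

definition ladder :: "'v \<Rightarrow> 'v \<Rightarrow> 'v \<Rightarrow> 'v \<Rightarrow> bool" where
  "ladder a b a' b' \<longleftrightarrow> good a \<and> good a' \<and> rung a b \<and> rung a' b' \<and> a' \<in> nb a \<and> b' \<in> nb b \<and> a \<noteq> b'"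

lemma ladder_start:
  assumes "good v"
  shows "\<exists>b a' b'. ladder v b a' b'"
proof -
  obtain u x y x' y' where d: "rung_data v u x y x' y'"
    using rung_exists[OF assms] by (auto simp: rung_def)
  have "rung x x'" by (rule rung_step[OF assms d])
  moreover have "rung v u" using d by (rule rungI)
  moreover have m: "x \<in> nb v" "x' \<in> nb u" "v \<noteq> x'" using d by (auto simp: rung_data_def)
  moreover have "good x" by (rule good_nb[OF assms m(1)])
  ultimately have "ladder v u x x'" using assms by (simp add: ladder_def)
  then show ?thesis by blast
qed

lemma ladder_step:
  assumes "ladder a b a' b'"
  shows "\<exists>a'' b''. ladder a' b' a'' b'' \<and> nb a' = {b', a, a''} \<and> nb b' = {a', b, b''} \<and>
    distinct [a, b, a', b', a'', b'']"
proof -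
  have L: "good a" "good a'" "rung a b" "rung a' b'" "a' \<in> nb a" "b' \<in> nb b" "a \<noteq> b'"
    using assms by (auto simp: ladder_def)
  have V: "a \<in> V" using L(1) by (simp add: good_def)
  have key: ?thesis if d: "rung_data a' b' a y x' y'" for y x' y'
  proof -
    have "rung a x'" by (rule rung_step[OF L(2) d])
    then have b: "x' = b" by (rule rung_unique[OF V _ L(3)])
    have "rung y y'" by (rule rung_step[OF L(2) rung_data_swap[OF d]])
    moreover have m: "y \<in> nb a'" "y' \<in> nb b'" "a' \<noteq> y'" using d by (auto simp: rung_data_def)
    moreover have "good y" by (rule good_nb[OF L(2) m(1)])
    ultimately have "ladder a' b' y y'" using L(2,4) by (simp add: ladder_def)
    moreover have "nb a' = {b', a, y}" "nb b' = {a', b, y'}" "distinct [a, b, a', b', y, y']"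
      using d b by (auto simp: rung_data_def)
    ultimately show ?thesis by blast
  qed
  obtain x y x' y' where d: "rung_data a' b' x y x' y'" using L(4) by (auto simp: rung_def)
  have "a \<in> nb a'" using L(5) nb_sym by blast
  then have "a = x \<or> a = y" using d L(7) by (simp add: rung_data_def)
  then show ?thesis using key d rung_data_swap[OF d] by auto
qed

lemma ladder_sequence:
  assumes "good v"
  obtains a b :: "nat \<Rightarrow> 'v" where "a 0 = v" "\<And>n. good (a n)" "\<And>n. rung (a n) (b n)"
    "\<And>n. nb (a (Suc n)) = {b (Suc n), a n, a (Suc (Suc n))}"
    "\<And>n. nb (b (Suc n)) = {a (Suc n), b n, b (Suc (Suc n))}"
    "\<And>n. distinct [a n, b n, a (Suc n), b (Suc n), a (Suc (Suc n)), b (Suc (Suc n))]"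
proof -
  define P where "P n s = (case s of ((a, b), (a', b')) \<Rightarrow> ladder a b a' b' \<and> (n = 0 \<longrightarrow> a = v))"
    for n :: nat and s :: "('v \<times> 'v) \<times> 'v \<times> 'v"
  define Q where "Q n s t = (case s of ((a, b), (a', b')) \<Rightarrow> case t of (c, (a'', b'')) \<Rightarrow>
      c = (a', b') \<and> nb a' = {b', a, a''} \<and> nb b' = {a', b, b''} \<and> distinct [a, b, a', b', a'', b''])"
    for n :: nat and s t :: "('v \<times> 'v) \<times> 'v \<times> 'v"
  have "\<exists>f. \<forall>n. P n (f n) \<and> Q n (f n) (f (Suc n))"
  proof (rule dependent_nat_choice)
    show "\<exists>s. P 0 s" using ladder_start[OF assms] by (auto simp: P_def)
    fix s n assume s: "P n s"
    obtain a b a' b' where eq: "s = ((a, b), (a', b'))" by (metis prod.exhaust)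
    then have "ladder a b a' b'" using s by (simp add: P_def)
    from ladder_step[OF this] obtain a'' b'' where "ladder a' b' a'' b''" "nb a' = {b', a, a''}"
      "nb b' = {a', b, b''}" "distinct [a, b, a', b', a'', b'']" by blast
    then have "P (Suc n) ((a', b'), (a'', b'')) \<and> Q n s ((a', b'), (a'', b''))"
      by (simp add: P_def Q_def eq)
    then show "\<exists>t. P (Suc n) t \<and> Q n s t" by blast
  qed
  then obtain f where f: "\<And>n. P n (f n)" "\<And>n. Q n (f n) (f (Suc n))" by blast
  define a b where "a n = fst (fst (f n))" and "b n = snd (fst (f n))" for n
  have next1: "snd (f n) = fst (f (Suc n))" for n
    using f(2)[of n] by (auto simp: Q_def split: prod.splits)
  have fn: "f n = ((a n, b n), (a (Suc n), b (Suc n)))" for n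
    by (rule prod_eqI) (simp_all add: a_def b_def next1)
  show thesis
  proof
    show "a 0 = v" using f(1)[of 0] fn[of 0] by (simp add: P_def)
    show "good (a n)" "rung (a n) (b n)" for n using f(1)[of n] fn[of n] by (simp_all add: P_def ladder_def)
    show "nb (a (Suc n)) = {b (Suc n), a n, a (Suc (Suc n))}"
      "nb (b (Suc n)) = {a (Suc n), b n, b (Suc (Suc n))}"
      "distinct [a n, b n, a (Suc n), b (Suc n), a (Suc (Suc n)), b (Suc (Suc n))]" for n
      using f(2)[of n] fn[of n] fn[of "Suc n"] by (simp_all add: Q_def)
  qed
qed

end

subsection \<open>Connected components\<close>

definition reach :: "'v set set \<Rightarrow> 'v \<Rightarrow> 'v set" where
  "reach E v = {u. (v, u) \<in> (adjacency E)\<^sup>*}"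

lemma components_eq: "components V E = (\<lambda>v. (reach E v, induced_edges E (reach E v))) ` V"
  by (simp add: components_def reach_def Let_def)

lemma reach_refl [simp]: "v \<in> reach E v"
  by (simp add: reach_def)

lemma reach_step: "u \<in> reach E v \<Longrightarrow> {u, w} \<in> E \<Longrightarrow> w \<in> reach E v"
  unfolding reach_def by (auto simp: adjacency_def intro: rtrancl_into_rtrancl)

lemma reach_least:
  assumes "v \<in> U" "\<And>u w. u \<in> U \<Longrightarrow> {u, w} \<in> E \<Longrightarrow> w \<in> U"
  shows "reach E v \<subseteq> U"
proof
  fix u assume "u \<in> reach E v"
  then have "(v, u) \<in> (adjacency E)\<^sup>*" by (simp add: reach_def)
  then show "u \<in> U"
    by (induction rule: rtrancl_induct) (use assms in \<open>auto simp: adjacency_def\<close>)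
qed

lemma reach_subset:
  assumes "simple_graph V E" "v \<in> V"
  shows "reach E v \<subseteq> V"
  by (rule reach_least) (use assms in \<open>auto simp: simple_graph_def\<close>)

lemma edge_meets_reach:
  assumes "simple_graph V E" "e \<in> E" "u \<in> e" "u \<in> reach E v"
  shows "e \<subseteq> reach E v"
proof
  fix w assume w: "w \<in> e"
  have "card e = 2" using assms by (auto simp: simple_graph_def)
  then have "w = u \<or> e = {u, w}" using assms(3) w by (auto simp: card_2_iff)
  then show "w \<in> reach E v" using reach_step[OF assms(4)] assms(2,4) by auto
qed

lemma simple_graph_component:
  assumes "simple_graph V E" "v \<in> V"
  shows "simple_graph (reach E v) (induced_edges E (reach E v))"
  using assms reach_subset[OF assms] finite_subset
  by (auto simp: simple_graph_def induced_edges_def)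

context cubic_two_squares
begin

lemma k4_component:
  assumes v: "v \<in> V" and k: "k4_at E v"
  shows "is_moebius_band 2 (reach E v) (induced_edges E (reach E v))"
proof -
  obtain W where W: "v \<in> W" "card W = 4" and full: "\<And>a b. a \<in> W \<Longrightarrow> b \<in> W \<Longrightarrow> a \<noteq> b \<Longrightarrow> {a, b} \<in> E"
    using k unfolding k4_at_def by blast
  have closed: "w \<in> W" if u: "u \<in> W" and "{u, w} \<in> E" for u w
  proof -
    have "w \<in> nb u" using that by (simp add: nb_def)
    then have uV: "u \<in> V" using nb_in_V by auto
    have "W - {u} \<subseteq> nb u" using full u by (auto simp: nb_def)
    moreover have "card (W - {u}) = card (nb u)" using W u card_nb[OF uV] by simp
    moreover have "finite (nb u)" using card_nb[OF uV] by (simp add: card_ge_0_finite)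
    ultimately have "W - {u} = nb u" using card_subset_eq by metis
    then show ?thesis using \<open>w \<in> nb u\<close> by auto
  qed
  have "W \<subseteq> reach E v"
  proof
    fix w assume "w \<in> W"
    then show "w \<in> reach E v" using full[OF W(1)] reach_step[OF reach_refl, of v w E] by (cases "w = v") auto
  qed
  moreover have "reach E v \<subseteq> W" using closed W by (intro reach_least) auto
  ultimately have R: "reach E v = W" by auto
  obtain p q s t where pq: "W = {p, q, s, t}" "distinct [p, q, s, t]"
  proof -
    have "finite W" using W(2) by (simp add: card_ge_0_finite)
    then obtain xs where "set xs = W" "distinct xs" using finite_distinct_list by auto
    then have "length xs = 4" using W(2) distinct_card by metis
    then obtain p q s t where "xs = [p, q, s, t]" by (auto simp: length_Suc_conv numeral_eq_Suc)
    then show ?thesis using that \<open>set xs = W\<close> \<open>distinct xs\<close> by auto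
  qed
  define a b where "a i = (if i = 1 then p else q)" and "b i = (if i = 1 then s else t)" for i :: nat
  have I: "{1..2} = {1, 2 :: nat}" by auto
  have lab: "chain_labelling 2 a b" unfolding chain_labelling_def I using pq by (auto simp: a_def b_def)
  have vert: "W = chain_vertices 2 a b" unfolding chain_vertices_def I using pq by (auto simp: a_def b_def)
  have i1: "(1 \<le> i \<and> i < 2) = (i = 1)" and i2: "(1 \<le> i \<and> i \<le> 2) = (i = 1 \<or> i = 2)" for i :: nat by auto
  have edges: "chain_edges 2 a b \<union> {{a 1, b 2}, {a 2, b 1}} =
      {{p, q}, {s, t}, {p, s}, {q, t}, {p, t}, {q, s}}"
  proof -
    have c1: "{{h i, h (i + 1)} |i. 1 \<le> i \<and> i < 2} = {{h 1, h 2}}" for h :: "nat \<Rightarrow> 'v"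
      unfolding i1 by (auto simp: numeral_2_eq_2)
    have c2: "{{a j, b j} |j. 1 \<le> j \<and> j \<le> 2} = {{a 1, b 1}, {a 2, b 2}}"
      unfolding i2 by auto
    have un: "{A} \<union> {B} \<union> {C, D} \<union> {F, H} = {A, B, C, D, F, H}" for A B C D F H :: "'v set"
      by blast
    show ?thesis unfolding chain_edges_def c1 c2 un by (simp add: a_def b_def)
  qed
  have "induced_edges E W = {{p, q}, {s, t}, {p, s}, {q, t}, {p, t}, {q, s}}"
  proof
    show "{{p, q}, {s, t}, {p, s}, {q, t}, {p, t}, {q, s}} \<subseteq> induced_edges E W"
      using full pq by (auto simp: induced_edges_def)
    show "induced_edges E W \<subseteq> {{p, q}, {s, t}, {p, s}, {q, t}, {p, t}, {q, s}}"
    proof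
      fix e assume e: "e \<in> induced_edges E W"
      then have "card e = 2" "e \<subseteq> W" using graph by (auto simp: induced_edges_def simple_graph_def)
      then obtain x y where xy: "e = {x, y}" "x \<noteq> y" "x \<in> {p, q, s, t}" "y \<in> {p, q, s, t}"
        using pq by (auto simp: card_2_iff)
      then show "e \<in> {{p, q}, {s, t}, {p, s}, {q, t}, {p, t}, {q, s}}"
        by (elim insertE emptyE) (auto simp: insert_commute)
    qed
  qed
  then have eq: "induced_edges E W = chain_edges 2 a b \<union> {{a 1, b 2}, {a 2, b 1}}"
    by (simp only: edges)
  show ?thesis
    using simple_graph_component[OF graph v] unfolding is_moebius_band_def R
    by (rule conjI, rule_tac exI[of _ a], rule_tac exI[of _ b]) (intro conjI lab vert eq)
qed

text \<open>Following the rungs along the squares must return to a rung met before, and the first return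
  is to the starting rung since every rung has only two neighbouring rungs. The return may swap
  the two ends of the rung; this decides between the band and the Moebius band.\<close>

lemma good_component:
  assumes g: "good v"
  shows "\<exists>r. is_band r (reach E v) (induced_edges E (reach E v)) \<or>
    is_moebius_band r (reach E v) (induced_edges E (reach E v))"
proof -
  obtain a b where a0: "a 0 = v" and good: "\<And>n. good (a n)" and rung: "\<And>n. rung (a n) (b n)"
    and nba: "\<And>n. nb (a (Suc n)) = {b (Suc n), a n, a (Suc (Suc n))}"
    and nbb: "\<And>n. nb (b (Suc n)) = {a (Suc n), b n, b (Suc (Suc n))}"
    and dist: "\<And>n. distinct [a n, b n, a (Suc n), b (Suc n), a (Suc (Suc n)), b (Suc (Suc n))]"
    using ladder_sequence[OF g] by metis
  have aV: "a n \<in> V" for n using good by (simp add: good_def)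
  have bV: "b n \<in> V" for n using rung_nb[OF rung] nb_in_V by blast
  define R where "R n = {a n, b n}" for n
  have R_eq: "R i = R j" if "x \<in> R i" "x \<in> R j" for x i j
  proof -
    have r1: "rung (b n) (a n)" for n using rung_sym rung by auto
    from that consider "a i = a j" | "a i = b j" | "b i = a j" | "b i = b j" by (auto simp: R_def)
    then show ?thesis
    proof cases
      case 1
      then have "b i = b j" using rung_unique[OF aV rung] rung[of j] by metis
      then show ?thesis using 1 by (simp add: R_def)
    next
      case 2
      then have "b i = a j" using rung_unique[OF aV rung] r1[of j] by metis
      then show ?thesis using 2 by (auto simp: R_def)
    next
      case 3
      then have "a i = b j" using rung_unique[OF bV r1] rung[of j] by metis
      then show ?thesis using 3 by (auto simp: R_def)
    next
      case 4
      then have "a i = a j" using rung_unique[OF bV r1] r1[of j] by metis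
      then show ?thesis using 4 by (simp add: R_def)
    qed
  qed
  have R_step: "R n \<noteq> R (Suc n)" "R n \<noteq> R (Suc (Suc n))" for n
    using dist[of n] by (auto simp: R_def doubleton_eq_iff)
  have R_nbrs: "R i = R j \<or> R i = R (Suc (Suc j))" if eq: "R (Suc i) = R (Suc j)" for i j
  proof -
    have "a (Suc i) = a (Suc j) \<or> a (Suc i) = b (Suc j)" using eq by (auto simp: R_def doubleton_eq_iff)
    then show ?thesis
    proof
      assume e: "a (Suc i) = a (Suc j)"
      have "a i \<in> nb (a (Suc i))" by (simp add: nba)
      then have "a i \<in> {b (Suc j), a j, a (Suc (Suc j))}" by (simp only: e nba)
      moreover have "a i \<noteq> b (Suc j)"
      proof
        assume "a i = b (Suc j)"
        then have "R i = R (Suc j)" using R_eq[of "a i" i "Suc j"] by (auto simp: R_def)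
        then show False using eq R_step(1)[of i] by simp
      qed
      ultimately have "a i = a j \<or> a i = a (Suc (Suc j))" by simp
      then show ?thesis using R_eq[of "a i" i j] R_eq[of "a i" i "Suc (Suc j)"] unfolding R_def by blast
    next
      assume e: "a (Suc i) = b (Suc j)"
      have "a i \<in> nb (a (Suc i))" by (simp add: nba)
      then have "a i \<in> {a (Suc j), b j, b (Suc (Suc j))}" by (simp only: e nbb)
      moreover have "a i \<noteq> a (Suc j)"
      proof
        assume "a i = a (Suc j)"
        then have "R i = R (Suc j)" using R_eq[of "a i" i "Suc j"] by (auto simp: R_def)
        then show False using eq R_step(1)[of i] by simp
      qed
      ultimately have "a i = b j \<or> a i = b (Suc (Suc j))" by simp
      then show ?thesis using R_eq[of "a i" i j] R_eq[of "a i" i "Suc (Suc j)"] unfolding R_def by blast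
    qed
  qed
  have "\<not> inj a"
  proof
    assume "inj a"
    moreover have "range a \<subseteq> V" using aV by auto
    ultimately show False using graph finite_subset finite_imageD
      by (metis infinite_UNIV_nat simple_graph_def)
  qed
  then obtain i j where "i < j" "a i = a j" unfolding inj_def by (metis nat_neq_iff)
  then have "\<exists>j<n. R n = R j" if "n = j" for n
    using R_eq[of "a i" j i] that by (auto simp: R_def)
  then have ex: "\<exists>n. \<exists>j<n. R n = R j" by blast
  \<comment> \<open>\<open>r\<close> is the time of the first return to an earlier rung.\<close>
  define r where "r = (LEAST n. \<exists>j<n. R n = R j)"
  obtain j where j: "j < r" "R r = R j" using LeastI_ex[OF ex] unfolding r_def by blast
  have R_inj: "m = n" if "R m = R n" "m < r" "n < r" for m n
  proof (rule ccontr)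
    assume "m \<noteq> n"
    then have "(\<exists>j<m. R m = R j) \<or> (\<exists>j<n. R n = R j)" using that by (metis nat_neq_iff)
    then show False using not_less_Least that(2,3) unfolding r_def by blast
  qed
  have "j = 0"
  proof (rule ccontr)
    assume "j \<noteq> 0"
    then obtain j' r' where s: "j = Suc j'" "r = Suc r'" using j(1) by (metis Suc_lessE not0_implies_Suc)
    have "R r' = R j' \<or> R r' = R (Suc (Suc j'))" using R_nbrs[of r' j'] j(2) s by simp
    then show False
    proof
      assume "R r' = R j'"
      then have "r' = j'" using s j(1) by (intro R_inj) auto
      then show False using s j(1) by simp
    next
      assume e: "R r' = R (Suc (Suc j'))"
      consider "Suc (Suc j') < r" | "Suc (Suc j') = r" using s j(1) by linarith
      then show False
      proof cases
        case 1
        then have "r' = Suc (Suc j')" using e s by (intro R_inj) auto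
        then show False using j(2) s R_step(2)[of "Suc j'"] by simp
      next
        case 2
        then show False using e s R_step(1)[of r'] by simp
      qed
    qed
  qed
  then have Rr: "R r = R 0" and r0: "r > 0" using j by auto
  have "r \<noteq> 1" "r \<noteq> 2" using Rr R_step[of 0] by (auto simp: numeral_2_eq_2)
  then have r3: "r \<ge> 3" using r0 by simp
  obtain r' where r': "r = Suc r'" "1 < r'" using r3 by (cases r) auto
  have in_R: "a n \<in> R n" "b n \<in> R n" for n by (auto simp: R_def)
  have R1: "R 1 \<noteq> R r'" using R_inj[of 1 r'] r' by auto
  have R01: "R 0 \<noteq> R 1" using R_step(1)[of 0] by simp
  have a10: "a 1 \<in> nb (a 0)" "b 1 \<in> nb (b 0)"
    using nba[of 0] nbb[of 0] nb_sym[of "a 1" "a 0"] nb_sym[of "b 1" "b 0"] by auto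
  have neq: "x \<noteq> y" if "x \<in> R m" "y \<in> R n" "R m \<noteq> R n" for x y m n using R_eq that by blast
  let ?U = "a ` {..<r} \<union> b ` {..<r}"
  let ?a = "\<lambda>i. a (i - 1)" and ?b = "\<lambda>i. b (i - 1)"
  have inj_a: "inj_on a {..<r}" using R_inj R_eq in_R(1) by (metis inj_onI lessThan_iff)
  have inj_b: "inj_on b {..<r}" using R_inj R_eq in_R(2) by (metis inj_onI lessThan_iff)
  have ab: "a i \<noteq> b j" if "i < r" "j < r" for i j
  proof
    assume e: "a i = b j"
    then have "R i = R j" using R_eq in_R by metis
    then have "i = j" using R_inj that by auto
    then show False using e dist[of i] by simp
  qed
  have im: "(\<lambda>i. h (i - 1)) ` {1..r} = h ` {..<r}" for h :: "nat \<Rightarrow> 'v"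
  proof -
    have "(\<lambda>i. i - 1) ` {1..r} = {..<r}"
    proof
      show "{..<r} \<subseteq> (\<lambda>i. i - 1) ` {1..r}"
      proof
        fix i assume "i \<in> {..<r}"
        then show "i \<in> (\<lambda>i. i - 1) ` {1..r}" by (intro image_eqI[of _ _ "Suc i"]) auto
      qed
    qed auto
    then show ?thesis by (metis image_image)
  qed
  have shift: "inj_on (\<lambda>i. h (i - 1)) {1..r}" if "inj_on h {..<r}" for h :: "nat \<Rightarrow> 'v"
  proof (rule inj_onI)
    fix x y assume "x \<in> {1..r}" "y \<in> {1..r}" "h (x - 1) = h (y - 1)"
    moreover from this have "x - 1 = y - 1" by (intro inj_onD[OF that]) auto
    ultimately show "x = y" by auto
  qed
  have lab: "chain_labelling r ?a ?b"
    unfolding chain_labelling_def im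
    using shift[OF inj_a] shift[OF inj_b] ab r0 by auto
  have vert: "chain_vertices r ?a ?b = ?U" by (simp only: chain_vertices_def im)
  define U where "U = a ` {..<r} \<union> b ` {..<r}"
  define CH where "CH = chain_edges r ?a ?b"
  have U_mem: "a i \<in> U" "b i \<in> U" if "i < r" for i using that by (auto simp: U_def)
  have chain_a: "{a i, a (Suc i)} \<in> CH" if "Suc i < r" for i
    unfolding CH_def chain_edges_def using that by (intro UnI1 CollectI exI[of _ "Suc i"]) auto
  have chain_b: "{b i, b (Suc i)} \<in> CH" if "Suc i < r" for i
    unfolding CH_def chain_edges_def using that by (intro UnI1[OF UnI2] CollectI exI[of _ "Suc i"]) auto
  have chain_r: "{a i, b i} \<in> CH" if "i < r" for i
    unfolding CH_def chain_edges_def using that by (intro UnI2 CollectI exI[of _ "Suc i"]) auto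
  have E_a: "{a i, a (Suc i)} \<in> E" and E_b: "{b i, b (Suc i)} \<in> E" and E_r: "{a i, b i} \<in> E" for i
    using nba[of i] nbb[of i] rung_nb[OF rung[of i]] by (auto simp: nb_def insert_commute)
  have chain_E: "e \<in> E \<and> e \<subseteq> U" if "e \<in> CH" for e
  proof -
    from that consider i where "e = {?a i, ?a (i + 1)}" "1 \<le> i" "i < r"
      | i where "e = {?b i, ?b (i + 1)}" "1 \<le> i" "i < r" | i where "e = {?a i, ?b i}" "1 \<le> i" "i \<le> r"
      unfolding CH_def chain_edges_def by blast
    then show ?thesis
    proof cases
      case (1 i)
      then show ?thesis using E_a[of "i - 1"] U_mem(1)[of "i - 1"] U_mem(1)[of i] by simp
    next
      case (2 i)
      then show ?thesis using E_b[of "i - 1"] U_mem(2)[of "i - 1"] U_mem(2)[of i] by simp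
    next
      case (3 i)
      then show ?thesis using E_r[of "i - 1"] U_mem[of "i - 1"] by simp
    qed
  qed
  have sg: "simple_graph (reach E v) (induced_edges E (reach E v))"
    using simple_graph_component[OF graph] aV[of 0] a0 by simp
  \<comment> \<open>\<open>p\<close> and \<open>q\<close> are the neighbours of \<open>a 0\<close> and \<open>b 0\<close> on the last rung, in the order that
    belongs to the band or to the Moebius band.\<close>
  have closing: "reach E v = U \<and> induced_edges E (reach E v) = CH \<union> {{a 0, p}, {b 0, q}}"
    if na: "nb (a 0) = {b 0, p, a 1}" and nb0: "nb (b 0) = {a 0, q, b 1}" and pq: "p \<in> U" "q \<in> U"
      and last: "{a r', a r} \<in> {{a 0, p}, {b 0, q}}" "{b r', b r} \<in> {{a 0, p}, {b 0, q}}"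
      "a r \<in> U" "b r \<in> U" for p q
  proof -
    let ?F = "CH \<union> {{a 0, p}, {b 0, q}}"
    define ok where "ok u w \<longleftrightarrow> w \<in> U \<and> {u, w} \<in> ?F" for u w
    have all: "ok u w" if uw: "u \<in> U" "w \<in> nb u" for u w
    proof -
      obtain i where i: "i < r" "u = a i \<or> u = b i" using uw(1) by (auto simp: U_def)
      have succ: "ok (a i) (a (Suc i)) \<and> ok (b i) (b (Suc i))"
      proof (cases "Suc i < r")
        case True
        then show ?thesis using U_mem chain_a chain_b by (simp add: ok_def)
      next
        case False
        then have i': "Suc i = r" "i = r'" using i(1) r' by linarith+
        have sub: "{{a 0, p}, {b 0, q}} \<subseteq> ?F" by simp
        have "ok (a r') (a r) \<and> ok (b r') (b r)"
          unfolding ok_def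
          by (intro conjI last(3,4) subsetD[OF sub last(1)] subsetD[OF sub last(2)])
        then show ?thesis using i' by simp
      qed
      have here: "ok (a i) (b i)" "ok (b i) (a i)"
        using U_mem chain_r i(1) by (auto simp: ok_def insert_commute)
      show ?thesis
      proof (cases i)
        case 0
        have "ok (a 0) p" "ok (b 0) q" using pq by (auto simp: ok_def)
        moreover have "u = a 0 \<and> w \<in> {b 0, p, a 1} \<or> u = b 0 \<and> w \<in> {a 0, q, b 1}"
          using i(2) uw(2) na nb0 0 by auto
        ultimately show ?thesis using here succ 0 by auto
      next
        case (Suc k)
        then have "ok (a i) (a k)" "ok (b i) (b k)"
          using U_mem[of k] chain_a[of k] chain_b[of k] i(1) by (auto simp: ok_def insert_commute)
        moreover have "u = a i \<and> w \<in> {b i, a k, a (Suc i)} \<or> u = b i \<and> w \<in> {a i, b k, b (Suc i)}"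
          using i(2) uw(2) nba[of k] nbb[of k] Suc by auto
        ultimately show ?thesis using here succ by auto
      qed
    qed
    have ra: "a i \<in> reach E v \<and> b i \<in> reach E v" for i
    proof (induction i)
      case 0
      have "v \<in> reach E v" by simp
      then show ?case using reach_step[of v E v "b 0"] E_r[of 0] a0 by auto
    next
      case (Suc i)
      then show ?case using reach_step E_a[of i] E_b[of i] by metis
    qed
    have "reach E v \<subseteq> U"
    proof (rule reach_least)
      show "v \<in> U" using U_mem(1)[OF r0] a0 by simp
      show "w \<in> U" if "u \<in> U" "{u, w} \<in> E" for u w using all[OF that(1)] that(2) by (simp add: nb_def ok_def)
    qed
    then have RU: "reach E v = U" using ra by (auto simp: U_def)
    have "induced_edges E U \<subseteq> ?F"
    proof
      fix e assume e: "e \<in> induced_edges E U"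
      then have "card e = 2" using graph by (auto simp: induced_edges_def simple_graph_def)
      then obtain u w where uw: "e = {u, w}" by (auto simp: card_2_iff)
      then have "u \<in> U" "w \<in> nb u" using e by (auto simp: induced_edges_def nb_def)
      then have "ok u w" by (rule all)
      then show "e \<in> ?F" using uw by (simp add: ok_def)
    qed
    moreover have "CH \<subseteq> induced_edges E U" using chain_E by (auto simp: induced_edges_def)
    moreover have "{a 0, p} \<in> E" "{b 0, q} \<in> E" using na nb0 by (auto simp: nb_def)
    then have "{{a 0, p}, {b 0, q}} \<subseteq> induced_edges E U"
      using pq U_mem[OF r0] by (simp add: induced_edges_def)
    ultimately show ?thesis using RU by blast
  qed
  have r'_less: "r' < r" using r' by simp
  have R0: "R 0 \<noteq> R r'" using R_inj[of 0 r'] r' r0 by auto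
  have nb_ends: "nb (a 0) = {b 0, p, a 1}" "nb (b 0) = {a 0, q, b 1}"
    if pq: "p \<in> nb (a 0)" "q \<in> nb (b 0)" "p \<in> R r'" "q \<in> R r'" for p q
    using pq a10 rung_nb[OF rung] rung_nb[OF rung_sym[OF rung]]
      neq[OF in_R(2) pq(3) R0] neq[OF in_R(2) in_R(1) R01] neq[OF pq(3) in_R(1) R1[symmetric]]
      neq[OF in_R(1) pq(4) R0] neq[OF in_R(1) in_R(2) R01] neq[OF pq(4) in_R(2) R1[symmetric]]
    by (intro nb_eqI aV bV; simp)+
  have last_nb: "a r' \<in> nb (a r)" "b r' \<in> nb (b r)" using nba[of r'] nbb[of r'] r' by auto
  have "a r = a 0 \<and> b r = b 0 \<or> a r = b 0 \<and> b r = a 0"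
    using Rr by (auto simp: R_def doubleton_eq_iff)
  then show ?thesis
  proof
    assume close: "a r = a 0 \<and> b r = b 0"
    then have nbs: "nb (a 0) = {b 0, a r', a 1}" "nb (b 0) = {a 0, b r', b 1}"
      using nb_ends[OF _ _ in_R] last_nb by simp_all
    have "reach E v = U \<and> induced_edges E (reach E v) = CH \<union> {{a 0, a r'}, {b 0, b r'}}"
      by (rule closing[OF nbs]) (use close U_mem[OF r0] U_mem[OF r'_less] in \<open>simp_all add: insert_commute\<close>)
    then have RU: "reach E v = U" and IE: "induced_edges E (reach E v) = CH \<union> {{a 0, a r'}, {b 0, b r'}}"
      by (rule conjunct1, rule conjunct2)
    have "{{?a 1, ?a r}, {?b 1, ?b r}} = {{a 0, a r'}, {b 0, b r'}}" using r' by (simp)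
    then have IE': "induced_edges E (reach E v) = chain_edges r ?a ?b \<union> {{?a 1, ?a r}, {?b 1, ?b r}}"
      by (simp only: IE CH_def)
    have RU': "reach E v = chain_vertices r ?a ?b" using RU by (simp only: vert U_def)
    have "is_band r (reach E v) (induced_edges E (reach E v))"
      unfolding is_band_def
      by (rule conjI[OF sg], rule exI[of _ ?a], rule exI[of _ ?b]) (intro conjI lab RU' IE')
    then show ?thesis by blast
  next
    assume close: "a r = b 0 \<and> b r = a 0"
    then have nbs: "nb (a 0) = {b 0, b r', a 1}" "nb (b 0) = {a 0, a r', b 1}"
      using nb_ends[OF _ _ in_R(2,1)] last_nb by simp_all
    have "reach E v = U \<and> induced_edges E (reach E v) = CH \<union> {{a 0, b r'}, {b 0, a r'}}"
      by (rule closing[OF nbs]) (use close U_mem[OF r0] U_mem[OF r'_less] in \<open>simp_all add: insert_commute\<close>)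
    then have RU: "reach E v = U" and IE: "induced_edges E (reach E v) = CH \<union> {{a 0, b r'}, {b 0, a r'}}"
      by (rule conjunct1, rule conjunct2)
    have "{{?a 1, ?b r}, {?a r, ?b 1}} = {{a 0, b r'}, {b 0, a r'}}" using r' by (simp add: insert_commute)
    then have IE': "induced_edges E (reach E v) = chain_edges r ?a ?b \<union> {{?a 1, ?b r}, {?a r, ?b 1}}"
      by (simp only: IE CH_def)
    have RU': "reach E v = chain_vertices r ?a ?b" using RU by (simp only: vert U_def)
    have "is_moebius_band r (reach E v) (induced_edges E (reach E v))"
      unfolding is_moebius_band_def
      by (rule conjI[OF sg], rule exI[of _ ?a], rule exI[of _ ?b]) (intro conjI lab RU' IE')
    then show ?thesis by blast
  qed
qed

lemma component_is_band:
  assumes "v \<in> V"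
  shows "\<exists>r. is_band r (reach E v) (induced_edges E (reach E v)) \<or>
    is_moebius_band r (reach E v) (induced_edges E (reach E v))"
  using k4_component[OF assms] good_component[of v] assms by (auto simp: good_def)

end

section \<open>Even bands and odd Moebius bands are bipartite\<close>

lemma chain_labellingD:
  assumes "chain_labelling r a b" "i \<in> {1..r}" "j \<in> {1..r}"
  shows "a i = a j \<longleftrightarrow> i = j" "b i = b j \<longleftrightarrow> i = j" "a i \<noteq> b j"
proof -
  have inj: "inj_on a {1..r}" "inj_on b {1..r}" and "a ` {1..r} \<inter> b ` {1..r} = {}"
    using assms(1) by (simp_all add: chain_labelling_def)
  then show "a i = a j \<longleftrightarrow> i = j" "b i = b j \<longleftrightarrow> i = j" "a i \<noteq> b j"
    using inj_on_eq_iff[OF inj(1) assms(2,3)] inj_on_eq_iff[OF inj(2) assms(2,3)] assms(2,3) by blast+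
qed

lemma chain_signing:
  assumes lab: "chain_labelling r a b"
  obtains \<epsilon> :: "'v \<Rightarrow> rat" where "\<And>i. i \<in> {1..r} \<Longrightarrow> \<epsilon> (a i) = (- 1) ^ i"
    "\<And>i. i \<in> {1..r} \<Longrightarrow> \<epsilon> (b i) = - ((- 1) ^ i)" "\<And>u. u \<notin> chain_vertices r a b \<Longrightarrow> \<epsilon> u = 0"
proof -
  have inj: "inj_on a {1..r}" "inj_on b {1..r}" using lab by (auto simp: chain_labelling_def)
  define \<epsilon> :: "'v \<Rightarrow> rat" where "\<epsilon> u = (if u \<in> a ` {1..r} then (- 1) ^ the_inv_into {1..r} a u
    else if u \<in> b ` {1..r} then - ((- 1) ^ the_inv_into {1..r} b u) else 0)" for u
  show thesis
  proof
    show "\<epsilon> (a i) = (- 1) ^ i" if "i \<in> {1..r}" for i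
      using that the_inv_into_f_f[OF inj(1) that] by (simp add: \<epsilon>_def del: One_nat_def)
    show "\<epsilon> (b i) = - ((- 1) ^ i)" if "i \<in> {1..r}" for i
    proof -
      have "b i \<notin> a ` {1..r}" using that lab unfolding chain_labelling_def by blast
      then show ?thesis
        using that the_inv_into_f_f[OF inj(2) that] by (simp add: \<epsilon>_def del: One_nat_def)
    qed
    show "\<epsilon> u = 0" if "u \<notin> chain_vertices r a b" for u
      using that by (simp add: \<epsilon>_def chain_vertices_def)
  qed
qed

text \<open>The signs alternate along both rails and are opposite at the two ends of each rung; the parity of
  \<open>r\<close> makes this compatible with the two closing edges.\<close>

lemma bipartite_signing:
  assumes G: "simple_graph V E" and v: "v \<in> V"
    and bip: "is_band r (reach E v) (induced_edges E (reach E v)) \<and> even r \<or>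
      is_moebius_band r (reach E v) (induced_edges E (reach E v)) \<and> odd r"
  obtains \<epsilon> :: "'v \<Rightarrow> rat" and v0 where "\<And>e. e \<in> E \<Longrightarrow> (\<Sum>v\<in>e. \<epsilon> v) = 0" "v0 \<in> V" "\<epsilon> v0 \<noteq> 0"
proof -
  let ?C = "reach E v" and ?F = "induced_edges E (reach E v)"
  obtain a b c d where lab: "chain_labelling r a b" and C: "?C = chain_vertices r a b"
    and F: "?F = chain_edges r a b \<union> {c, d}"
    and cd: "even r \<and> c = {a 1, a r} \<and> d = {b 1, b r} \<or> odd r \<and> c = {a 1, b r} \<and> d = {a r, b 1}"
    using bip unfolding is_band_def is_moebius_band_def by blast
  obtain \<epsilon> :: "'v \<Rightarrow> rat" where ea: "\<And>i. i \<in> {1..r} \<Longrightarrow> \<epsilon> (a i) = (- 1) ^ i"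
    and eb: "\<And>i. i \<in> {1..r} \<Longrightarrow> \<epsilon> (b i) = - ((- 1) ^ i)"
    and e0: "\<And>u. u \<notin> chain_vertices r a b \<Longrightarrow> \<epsilon> u = 0"
    using chain_signing[OF lab] by metis
  have r1: "r \<ge> 1" using lab by (simp add: chain_labelling_def)
  have end1: "\<epsilon> (a 1) = - 1" "\<epsilon> (b 1) = 1" using ea[of 1] eb[of 1] r1 by auto
  have endr: "\<epsilon> (a r) = (- 1) ^ r" "\<epsilon> (b r) = - ((- 1) ^ r)" using ea[of r] eb[of r] r1 by auto
  have pair: "\<exists>x y. e = {x, y} \<and> \<epsilon> x + \<epsilon> y = 0" if e: "e \<in> ?F" for e
  proof -
    have "e \<in> chain_edges r a b \<or> e = c \<or> e = d" using e unfolding F by blast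
    then consider i where "e = {a i, a (i + 1)}" "1 \<le> i" "i < r"
      | i where "e = {b i, b (i + 1)}" "1 \<le> i" "i < r" | i where "e = {a i, b i}" "1 \<le> i" "i \<le> r"
      | "e = c" | "e = d"
    proof (elim disjE)
      assume "e \<in> chain_edges r a b"
      then show thesis unfolding chain_edges_def using that(1-3) by (elim UnE CollectE exE conjE)
    qed (use that(4,5) in blast)+
    then show ?thesis
    proof cases
      case (1 i)
      then have "\<epsilon> (a i) + \<epsilon> (a (i + 1)) = 0" using ea[of i] ea[of "i + 1"] by simp
      then show ?thesis using 1 by blast
    next
      case (2 i)
      then have "\<epsilon> (b i) + \<epsilon> (b (i + 1)) = 0" using eb[of i] eb[of "i + 1"] by simp
      then show ?thesis using 2 by blast
    next
      case (3 i)
      then have "\<epsilon> (a i) + \<epsilon> (b i) = 0" using ea[of i] eb[of i] by simp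
      then show ?thesis using 3 by blast
    next
      case 4
      have "\<epsilon> (a 1) + \<epsilon> (a r) = 0" if "even r" using end1 endr that by simp
      moreover have "\<epsilon> (a 1) + \<epsilon> (b r) = 0" if "odd r" using end1 endr that by simp
      ultimately show ?thesis using 4 cd by blast
    next
      case 5
      have "\<epsilon> (b 1) + \<epsilon> (b r) = 0" if "even r" using end1 endr that by simp
      moreover have "\<epsilon> (a r) + \<epsilon> (b 1) = 0" if "odd r" using end1 endr that by simp
      ultimately show ?thesis using 5 cd by blast
    qed
  qed
  show thesis
  proof
    fix e assume e: "e \<in> E"
    show "(\<Sum>v\<in>e. \<epsilon> v) = 0"
    proof (cases "e \<inter> ?C = {}")
      case True
      then show ?thesis using e0 C by (intro sum.neutral) auto
    next
      case False
      then have "e \<in> ?F" using edge_meets_reach[OF G e] e by (auto simp: induced_edges_def)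
      then obtain x y where xy: "e = {x, y}" "\<epsilon> x + \<epsilon> y = 0" using pair by blast
      moreover have "card e = 2" using G e by (auto simp: simple_graph_def)
      ultimately show ?thesis by (cases "x = y") auto
    qed
  next
    have "a 1 \<in> ?C" unfolding C chain_vertices_def using r1 by auto
    then show "a 1 \<in> V" using reach_subset[OF G v] by auto
    show "\<epsilon> (a 1) \<noteq> 0" using end1 by simp
  qed
qed

section \<open>Squares generating the toric ideal\<close>

text \<open>An ideal contains the toric ideal as soon as it contains all differences of monomials of
  equal degree: such differences cancel the terms of a polynomial one by one.\<close>

lemma toric_ideal_subset:
  assumes G: "simple_graph V E"
    and J: "ideal J (poly_ring E :: ('v set, 'k::field) mpoly ring)"
    and diff: "\<And>m m'. m \<in> mons E \<Longrightarrow> m' \<in> mons E \<Longrightarrow> vdeg m = vdeg m' \<Longrightarrow> single m 1 - single m' 1 \<in> J"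
  shows "(toric_ideal V E :: ('v set, 'k) mpoly set) \<subseteq> J"
proof
  let ?P = "toric_ideal V E :: ('v set, 'k) mpoly set"
  have P: "ideal ?P (poly_ring E)" using toric_ideal_prime[OF G] by (rule primeideal.axioms)
  fix p assume "p \<in> ?P"
  then show "p \<in> J"
  proof (induction "card (keys p)" arbitrary: p rule: less_induct)
    case less
    show ?case
    proof (cases "p = 0")
      case True
      then show ?thesis using poly_ring_idealD(2)[OF J] by simp
    next
      case False
      then obtain m where m: "m \<in> keys p" by (metis in_keys_iff lookup_zero poly_mapping_eqI)
      have pE: "keys p \<subseteq> mons E" using poly_ring_idealD(1)[OF P] less.prems by (auto simp: carrier_poly_ring)
      have fib: "lin (\<lambda>x. of_bool (vdeg x = vdeg m)) p = 0"
        using less.prems by (simp add: toric_ideal_eq_fib_ideal[OF G] fib_ideal_def)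
      have "\<exists>m'\<in>keys p. m' \<noteq> m \<and> vdeg m' = vdeg m"
      proof (rule ccontr)
        assume no: "\<not> ?thesis"
        have "lin (\<lambda>x. of_bool (vdeg x = vdeg m)) p = (\<Sum>x\<in>keys p. if x = m then lookup p m else 0)"
          unfolding lin_def by (intro sum.cong refl) (use no in auto)
        then show False using fib m by (simp add: in_keys_iff)
      qed
      then obtain m' where m': "m' \<in> keys p" "m' \<noteq> m" "vdeg m' = vdeg m" by blast
      let ?c = "lookup p m"
      let ?b = "single 0 ?c * (single m 1 - single m' 1) :: ('v set, 'k) mpoly"
      have c: "single 0 ?c \<in> carrier (poly_ring E)" by (rule carrier_single) simp
      have mE: "m \<in> mons E" "m' \<in> mons E" using m m' pE by auto
      have bJ: "?b \<in> J" by (rule poly_ring_idealD(5)[OF J diff c]) (use mE m' in auto)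
      have "single m 1 - single m' 1 \<in> ?P"
        using m'(3) binomial_in_fib_ideal_iff[OF mE, of vdeg] by (simp add: toric_ideal_eq_fib_ideal[OF G])
      then have bP: "?b \<in> ?P" by (rule poly_ring_idealD(5)[OF P _ c])
      have b: "?b = single m ?c - single m' ?c" by (simp add: right_diff_distrib mult_single)
      have "keys (p - ?b) \<subseteq> keys p - {m}"
      proof
        fix x assume "x \<in> keys (p - ?b)"
        then have "lookup p x - (lookup (single m ?c) x - lookup (single m' ?c) x) \<noteq> 0"
          unfolding b by (simp add: in_keys_iff lookup_minus)
        then show "x \<in> keys p - {m}"
          using m m' by (auto simp: lookup_single when_def in_keys_iff split: if_splits)
      qed
      then have "card (keys (p - ?b)) \<le> card (keys p - {m})" by (intro card_mono) auto
      also have "\<dots> < card (keys p)" using m by (intro card_Diff1_less) auto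
      finally have "p - ?b \<in> J" using less.hyps poly_ring_idealD(4)[OF P less.prems bP] by blast
      then have "(p - ?b) + ?b \<in> J" using poly_ring_idealD(3)[OF J _ bJ] by blast
      then show ?thesis by simp
    qed
  qed
qed

definition square_binomial :: "'x \<Rightarrow> 'x \<Rightarrow> 'x \<Rightarrow> 'x \<Rightarrow> ('x, 'k::field) mpoly" where
  "square_binomial e f g h = single (single e 1 + single f 1) 1 - single (single g 1 + single h 1) 1"

text \<open>Replacing the two rails of a square by its two rungs terminates, and a monomial without a
  pair of opposite rails is determined by its degree: on each square the difference of the two
  rail exponents is determined by the degree, and one of the two exponents is zero.\<close>

lemma squares_generate:
  fixes E :: "'v set set" and \<alpha> \<beta> \<gamma> \<delta> :: "'i \<Rightarrow> 'v set"
  assumes G: "simple_graph V E"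
    and edges: "\<And>i. i \<in> I \<Longrightarrow> {\<alpha> i, \<beta> i, \<gamma> i, \<delta> i} \<subseteq> E"
    and square: "\<And>i. i \<in> I \<Longrightarrow> \<alpha> i \<inter> \<beta> i = {} \<and> \<gamma> i \<inter> \<delta> i = {} \<and> \<alpha> i \<union> \<beta> i = \<gamma> i \<union> \<delta> i"
    and rails: "\<And>i. i \<in> I \<Longrightarrow> \<alpha> i \<notin> T \<and> \<beta> i \<notin> T \<and> \<gamma> i \<in> T \<and> \<delta> i \<in> T"
    and cover: "\<And>e. e \<in> E \<Longrightarrow> e \<notin> T \<Longrightarrow> \<exists>i\<in>I. e = \<alpha> i \<or> e = \<beta> i"
    and matching: "\<And>e. e \<in> E \<Longrightarrow> e \<in> T \<Longrightarrow> \<exists>v\<in>e. \<forall>e'\<in>E. v \<in> e' \<longrightarrow> e' \<in> T \<longrightarrow> e' = e"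
    and balanced: "\<And>z i. kern E z \<Longrightarrow> i \<in> I \<Longrightarrow> z (\<alpha> i) = z (\<beta> i)"
  defines "S \<equiv> (\<lambda>i. square_binomial (\<alpha> i) (\<beta> i) (\<gamma> i) (\<delta> i)) ` I :: ('v set, 'k::field) mpoly set"
  shows "S \<subseteq> carrier (poly_ring E)" "Idl\<^bsub>poly_ring E\<^esub> S = toric_ideal V E"
proof -
  let ?R = "poly_ring E :: ('v set, 'k) mpoly ring"
  let ?P = "toric_ideal V E :: ('v set, 'k) mpoly set"
  interpret ring ?R by (rule poly_ring_ring)
  have finE: "finite E" using simple_graph_finite_edges[OF G] .
  have P: "ideal ?P ?R" using toric_ideal_prime[OF G] by (rule primeideal.axioms)
  have m4: "single (\<alpha> i) 1 + single (\<beta> i) 1 \<in> mons E" "single (\<gamma> i) 1 + single (\<delta> i) 1 \<in> mons E"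
    if "i \<in> I" for i using edges[OF that] by (auto simp: single_in_mons)
  have v4: "vdeg (single (\<alpha> i) 1 + single (\<beta> i) 1) = vdeg (single (\<gamma> i) 1 + single (\<delta> i) 1)"
    if "i \<in> I" for i
    using square[OF that] vdeg_matching[of "\<alpha> i" "\<beta> i" "\<alpha> i \<union> \<beta> i"]
      vdeg_matching[of "\<gamma> i" "\<delta> i" "\<gamma> i \<union> \<delta> i"] by (simp add: fun_eq_iff)
  have SP: "S \<subseteq> ?P"
  proof
    fix s assume "s \<in> S"
    then obtain i where i: "i \<in> I" "s = square_binomial (\<alpha> i) (\<beta> i) (\<gamma> i) (\<delta> i)" by (auto simp: S_def)
    then show "s \<in> ?P"
      unfolding toric_ideal_eq_fib_ideal[OF G] i(2) square_binomial_def
      using binomial_in_fib_ideal_iff[OF m4[OF i(1)], of vdeg] v4[OF i(1)] by blast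
  qed
  then show SR: "S \<subseteq> carrier ?R" using poly_ring_idealD(1)[OF P] by blast
  let ?J = "Idl\<^bsub>?R\<^esub> S"
  have J: "ideal ?J ?R" using genideal_ideal[OF SR] .
  have SJ: "S \<subseteq> ?J" using genideal_self[OF SR] .
  define reduced where "reduced m \<longleftrightarrow> (\<forall>i\<in>I. lookup m (\<alpha> i) = 0 \<or> lookup m (\<beta> i) = 0)" for m :: "'v set \<Rightarrow>\<^sub>0 nat"
  have reduce: "\<exists>n\<in>mons E. reduced n \<and> vdeg n = vdeg m \<and> single m 1 - single n 1 \<in> ?J" if "m \<in> mons E" for m
    using that
  proof (induction "\<Sum>e\<in>E - T. lookup m e" arbitrary: m rule: less_induct)
    case less
    show ?case
    proof (cases "reduced m")
      case True
      then show ?thesis using less.prems poly_ring_idealD(2)[OF J] by (intro bexI[of _ m]) auto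
    next
      case False
      then obtain i where i: "i \<in> I" "\<alpha> i \<in> keys m" "\<beta> i \<in> keys m" by (auto simp: reduced_def in_keys_iff)
      have "\<alpha> i \<noteq> {}" using G edges[OF i(1)] by (auto simp: simple_graph_def)
      then have neq: "\<beta> i \<noteq> \<alpha> i" using square[OF i(1)] by auto
      obtain m1 where m1: "m = single (\<alpha> i) 1 + m1" using split_off_variable[OF i(2)] by auto
      then have "\<beta> i \<in> keys m1" using i(3) neq by (auto simp: keys_add_nat)
      then obtain k where "m1 = single (\<beta> i) 1 + k" using split_off_variable[of "\<beta> i" m1] by auto
      then have k: "m = (single (\<alpha> i) 1 + single (\<beta> i) 1) + k" using m1 by (simp add: add.assoc)
      define n where "n = (single (\<gamma> i) 1 + single (\<delta> i) 1) + k"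
      have kE: "k \<in> mons E" using less.prems k by simp
      have nE: "n \<in> mons E" unfolding n_def using m4(2)[OF i(1)] kE by simp
      have vn: "vdeg n = vdeg m" using v4[OF i(1)] by (simp add: n_def k fun_eq_iff vdeg_add)
      have eq: "single m 1 - single n 1 = single k 1 * square_binomial (\<alpha> i) (\<beta> i) (\<gamma> i) (\<delta> i)"
        unfolding square_binomial_def n_def k by (simp add: right_diff_distrib mult_single add.commute)
      have "square_binomial (\<alpha> i) (\<beta> i) (\<gamma> i) (\<delta> i) \<in> ?J" using SJ i(1) by (auto simp: S_def)
      then have mn: "single m 1 - single n 1 \<in> ?J"
        unfolding eq by (rule poly_ring_idealD(5)[OF J _ carrier_single[OF kE]])
      have "(\<Sum>e\<in>E - T. lookup n e) < (\<Sum>e\<in>E - T. lookup m e)"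
      proof (rule sum_strict_mono_ex1)
        have ln: "lookup n e = lookup k e" if "e \<notin> T" for e
        proof -
          have "\<gamma> i \<noteq> e" "\<delta> i \<noteq> e" using rails[OF i(1)] that by blast+
          then show ?thesis by (simp add: n_def lookup_add lookup_single_not_eq)
        qed
        show "\<forall>e\<in>E - T. lookup n e \<le> lookup m e"
          using ln by (simp add: k lookup_add)
        have "lookup n (\<alpha> i) < lookup m (\<alpha> i)"
          using rails[OF i(1)] ln[of "\<alpha> i"] by (simp add: k lookup_add)
        moreover have "\<alpha> i \<in> E - T" using rails[OF i(1)] edges[OF i(1)] by blast
        ultimately show "\<exists>e\<in>E - T. lookup n e < lookup m e" by blast
      qed (use finE in simp)
      from less.hyps[OF this nE] obtain n' where n': "n' \<in> mons E" "reduced n'" "vdeg n' = vdeg n"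
        "single n 1 - single n' 1 \<in> ?J" by blast
      have "(single m 1 - single n 1) + (single n 1 - single n' 1) \<in> ?J"
        by (rule poly_ring_idealD(3)[OF J mn n'(4)])
      then show ?thesis using n' vn by (intro bexI[of _ n']) auto
    qed
  qed
  have unique: "m = n" if mn: "m \<in> mons E" "n \<in> mons E" "reduced m" "reduced n" "vdeg m = vdeg n" for m n
  proof -
    let ?z = "\<lambda>e. of_nat (lookup m e) - of_nat (lookup n e) :: rat"
    have ker: "kern E ?z" using kern_monomials[OF finE mn(1,2,5)] .
    have rail: "lookup m (\<alpha> i) = lookup n (\<alpha> i) \<and> lookup m (\<beta> i) = lookup n (\<beta> i)" if i: "i \<in> I" for i
    proof -
      have "?z (\<alpha> i) = ?z (\<beta> i)" using balanced[OF ker i] .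
      then have "of_nat (lookup m (\<alpha> i) + lookup n (\<beta> i)) = (of_nat (lookup m (\<beta> i) + lookup n (\<alpha> i)) :: rat)"
        by simp
      then have "lookup m (\<alpha> i) + lookup n (\<beta> i) = lookup m (\<beta> i) + lookup n (\<alpha> i)"
        by (simp only: of_nat_eq_iff)
      then show ?thesis using mn(3,4) i unfolding reduced_def by fastforce
    qed
    have zrail: "?z e = 0" if "e \<in> E" "e \<notin> T" for e using cover[OF that] rail by auto
    show ?thesis
    proof (rule poly_mapping_eqI)
      fix e
      have "?z e = 0"
      proof (cases "e \<in> E \<and> e \<in> T")
        case True
        then obtain v where v: "v \<in> e" "\<forall>e'\<in>E. v \<in> e' \<longrightarrow> e' \<in> T \<longrightarrow> e' = e" using matching by blast
        have "(\<Sum>e'\<in>{e' \<in> E. v \<in> e'}. ?z e') = (\<Sum>e'\<in>{e' \<in> E. v \<in> e'}. if e' = e then ?z e else 0)"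
          by (intro sum.cong refl) (use v zrail in auto)
        also have "\<dots> = ?z e" using True v(1) finE by simp
        finally show ?thesis using ker by (simp add: kern_def)
      next
        case False
        then show ?thesis using zrail ker unfolding kern_def by blast
      qed
      then show "lookup m e = lookup n e" by simp
    qed
  qed
  have "?P \<subseteq> ?J"
  proof (rule toric_ideal_subset[OF G J])
    fix m m' assume m: "m \<in> mons E" "m' \<in> mons E" "vdeg m = vdeg m'"
    obtain n where n: "n \<in> mons E" "reduced n" "vdeg n = vdeg m" "single m 1 - single n 1 \<in> ?J"
      using reduce[OF m(1)] by blast
    obtain n' where n': "n' \<in> mons E" "reduced n'" "vdeg n' = vdeg m'" "single m' 1 - single n' 1 \<in> ?J"
      using reduce[OF m(2)] by blast
    have "n = n'" using unique n n' m(3) by simp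
    then have "(single m 1 - single n 1) - (single m' 1 - single n 1) \<in> ?J"
      using poly_ring_idealD(4)[OF J n(4)] n'(4) by blast
    then show "single m 1 - single m' 1 \<in> ?J" by simp
  qed
  moreover have "?J \<subseteq> ?P" by (rule genideal_minimal[OF P SP])
  ultimately show "?J = ?P" by blast
qed

section \<open>Odd bands and even Moebius bands\<close>

text \<open>The labels are continued by one step beyond the last rung, which uniformly describes the
  edges that close the chain; \<open>t\<close> tells whether closing swaps the two rails.\<close>

definition cyclic_ladder :: "bool \<Rightarrow> nat \<Rightarrow> (nat \<Rightarrow> 'v) \<Rightarrow> (nat \<Rightarrow> 'v) \<Rightarrow> 'v set \<Rightarrow> 'v set set \<Rightarrow> bool" where
  "cyclic_ladder t r a b C F \<longleftrightarrow> chain_labelling r a b \<and> r \<ge> 2 \<and> C = chain_vertices r a b \<and>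
    (t \<longleftrightarrow> even r) \<and> a (Suc r) = (if t then b 1 else a 1) \<and> b (Suc r) = (if t then a 1 else b 1) \<and>
    F = (\<lambda>i. {a i, a (Suc i)}) ` {1..r} \<union> (\<lambda>i. {b i, b (Suc i)}) ` {1..r} \<union> (\<lambda>i. {a i, b i}) ` {1..r}"

lemma chain_edges_closed:
  assumes "r \<ge> 1"
  shows "chain_edges r a b \<union> {{a r, x}, {b r, y}} =
    (\<lambda>i. {(a(Suc r := x)) i, (a(Suc r := x)) (Suc i)}) ` {1..r} \<union>
    (\<lambda>i. {(b(Suc r := y)) i, (b(Suc r := y)) (Suc i)}) ` {1..r} \<union>
    (\<lambda>i. {(a(Suc r := x)) i, (b(Suc r := y)) i}) ` {1..r}"
proof -
  have close: "(\<lambda>i. {(h(Suc r := x)) i, (h(Suc r := x)) (Suc i)}) ` {1..r} =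
      insert {h r, x} {{h i, h (i + 1)} |i. 1 \<le> i \<and> i < r}" for h :: "nat \<Rightarrow> 'a" and x
  proof -
    have "{1..r} = insert r {1..<r}" using assms by auto
    then have "(\<lambda>i. {(h(Suc r := x)) i, (h(Suc r := x)) (Suc i)}) ` {1..r} =
        insert {h r, x} ((\<lambda>i. {h i, h (i + 1)}) ` {1..<r})" by (auto simp: image_def)
    then show ?thesis by (auto simp: image_def)
  qed
  have rungs: "(\<lambda>i. {(a(Suc r := x)) i, (b(Suc r := y)) i}) ` {1..r} = {{a j, b j} |j. 1 \<le> j \<and> j \<le> r}"
    by (auto simp: image_def)
  show ?thesis unfolding close rungs chain_edges_def by blast
qed

lemma odd_band_cyclic_ladder:
  assumes "odd_band C F"
  shows "\<exists>t r a b. cyclic_ladder t r a b C F"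
proof -
  obtain r a b where r: "odd r" and G: "simple_graph C F" and lab: "chain_labelling r a b"
    and C: "C = chain_vertices r a b" and F: "F = chain_edges r a b \<union> {{a 1, a r}, {b 1, b r}}"
    using assms unfolding odd_band_def is_band_def by blast
  have r1: "r \<ge> 1" using lab by (simp add: chain_labelling_def)
  have "r \<noteq> 1"
  proof
    assume "r = 1"
    then have "{a 1} \<in> F" using F by simp
    then show False using G by (auto simp: simple_graph_def)
  qed
  then have r2: "r \<ge> 2" using r1 by simp
  let ?a = "a(Suc r := a 1)" and ?b = "b(Suc r := b 1)"
  have eq: "?a i = a i" "?b i = b i" if "i \<in> {1..r}" for i using that by auto
  have img: "?a ` {1..r} = a ` {1..r}" "?b ` {1..r} = b ` {1..r}"
    by (rule image_cong[OF refl eq(1)], assumption) (rule image_cong[OF refl eq(2)])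
  have inj: "inj_on ?a {1..r} = inj_on a {1..r}" "inj_on ?b {1..r} = inj_on b {1..r}"
    by (rule inj_on_cong[OF eq(1)], assumption) (rule inj_on_cong[OF eq(2)])
  have "chain_labelling r ?a ?b"
    using lab unfolding chain_labelling_def img inj .
  moreover have "C = chain_vertices r ?a ?b" using C img by (simp only: chain_vertices_def)
  moreover have "F = chain_edges r a b \<union> {{a r, a 1}, {b r, b 1}}" using F by (simp add: insert_commute)
  moreover have "?a (Suc r) = a 1" "?b (Suc r) = b 1" "?a 1 = a 1" "?b 1 = b 1" using r1 by auto
  ultimately have "cyclic_ladder False r ?a ?b C F"
    unfolding cyclic_ladder_def using r r2 chain_edges_closed[OF r1, of a b "a 1" "b 1"] by simp
  then show ?thesis by blast
qed

lemma even_moebius_band_cyclic_ladder: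
  assumes "even_moebius_band C F"
  shows "\<exists>t r a b. cyclic_ladder t r a b C F"
proof -
  obtain r a b where r: "even r" and lab: "chain_labelling r a b"
    and C: "C = chain_vertices r a b" and F: "F = chain_edges r a b \<union> {{a 1, b r}, {a r, b 1}}"
    using assms unfolding even_moebius_band_def is_moebius_band_def by blast
  have r1: "r \<ge> 1" using lab by (simp add: chain_labelling_def)
  have r2: "r \<ge> 2" using r1 r by (cases "r = 1") auto
  let ?a = "a(Suc r := b 1)" and ?b = "b(Suc r := a 1)"
  have eq: "?a i = a i" "?b i = b i" if "i \<in> {1..r}" for i using that by auto
  have img: "?a ` {1..r} = a ` {1..r}" "?b ` {1..r} = b ` {1..r}"
    by (rule image_cong[OF refl eq(1)], assumption) (rule image_cong[OF refl eq(2)])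
  have inj: "inj_on ?a {1..r} = inj_on a {1..r}" "inj_on ?b {1..r} = inj_on b {1..r}"
    by (rule inj_on_cong[OF eq(1)], assumption) (rule inj_on_cong[OF eq(2)])
  have "chain_labelling r ?a ?b"
    using lab unfolding chain_labelling_def img inj .
  moreover have "C = chain_vertices r ?a ?b" using C img by (simp only: chain_vertices_def)
  moreover have "F = chain_edges r a b \<union> {{a r, b 1}, {b r, a 1}}" using F by (simp add: insert_commute)
  moreover have "?a (Suc r) = b 1" "?b (Suc r) = a 1" "?a 1 = a 1" "?b 1 = b 1" using r1 by auto
  ultimately have "cyclic_ladder True r ?a ?b C F"
    unfolding cyclic_ladder_def using r r2 chain_edges_closed[OF r1, of a b "b 1" "a 1"] by simp
  then show ?thesis by blast
qed

lemma cyclic_ladder_distinct: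
  assumes L: "cyclic_ladder t r a b C F" and i: "i \<in> {1..r}"
  shows "distinct [a i, a (Suc i), b i, b (Suc i)]"
proof -
  have lab: "chain_labelling r a b" and r: "r \<ge> 2" and
    next1: "a (Suc r) = (if t then b 1 else a 1)" "b (Suc r) = (if t then a 1 else b 1)"
    using L by (auto simp: cyclic_ladder_def)
  note D = chain_labellingD[OF lab]
  show ?thesis
  proof (cases "i = r")
    case True
    then show ?thesis using D(1)[of r 1] D(2)[of r 1] D(3)[of r r] D(3)[of r 1] D(3)[of 1 r] D(3)[of 1 1] r
      by (cases t) (auto simp: next1)
  next
    case False
    then have "Suc i \<in> {1..r}" using i by auto
    then show ?thesis using D(1,2,3)[of i "Suc i"] D(3)[of i i] D(3)[of "Suc i" i] D(3)[of "Suc i" "Suc i"] i by auto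
  qed
qed

lemma sum_at_cubic_vertex:
  assumes "degree E v = 3" "{e \<in> E. v \<in> e} \<subseteq> {x, y, w}"
  shows "(\<Sum>e\<in>{e \<in> E. v \<in> e}. z e) = z x + z y + (z w :: rat)"
proof -
  have c: "card {e \<in> E. v \<in> e} = 3" using assms(1) by (simp add: degree_def)
  have "card {x, y, w} \<le> 3" by (auto simp: card_insert_if)
  then have eq: "{e \<in> E. v \<in> e} = {x, y, w}" using assms(2) c by (intro card_seteq) auto
  then have "card {x, y, w} = 3" using c by simp
  then have "x \<noteq> y" "x \<noteq> w" "y \<noteq> w" by (auto simp: card_insert_if split: if_splits)
  then show ?thesis unfolding eq by simp
qed

lemma cyclic_ladder_swap:
  assumes "cyclic_ladder t r a b C F"
  shows "cyclic_ladder t r b a C F"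
proof -
  have "(\<lambda>i. {b i, a i}) ` {1..r} = (\<lambda>i. {a i, b i}) ` {1..r}" by (simp add: insert_commute)
  then show ?thesis
    using assms unfolding cyclic_ladder_def chain_labelling_def chain_vertices_def
    by (simp add: Un_commute Int_commute)
qed

text \<open>The three edges at \<open>a i\<close> are its rung and the rails before and behind it. At \<open>a 1\<close> the rail
  before it is the closing edge, which belongs to the other rail if closing swaps the rails.\<close>

lemma cyclic_ladder_vertex_sums:
  assumes L: "cyclic_ladder t r a b C F" and deg: "\<forall>v\<in>C. degree E v = 3"
    and F: "\<forall>e\<in>E. e \<inter> C \<noteq> {} \<longrightarrow> e \<in> F" and ker: "kern E z"
  shows "\<And>j. j \<in> {1..<r} \<Longrightarrow>
      z {a (Suc j), a (Suc (Suc j))} + z {a j, a (Suc j)} + z {a (Suc j), b (Suc j)} = 0"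
    and "z {a 1, a (Suc 1)} + z (if t then {b r, b (Suc r)} else {a r, a (Suc r)}) + z {a 1, b 1} = 0"
proof -
  have lab: "chain_labelling r a b" and r: "r \<ge> 2" and C: "C = chain_vertices r a b" and
    next1: "a (Suc r) = (if t then b 1 else a 1)" "b (Suc r) = (if t then a 1 else b 1)" and
    F': "F = (\<lambda>i. {a i, a (Suc i)}) ` {1..r} \<union> (\<lambda>i. {b i, b (Suc i)}) ` {1..r} \<union> (\<lambda>i. {a i, b i}) ` {1..r}"
    using L by (simp_all add: cyclic_ladder_def)
  note D = chain_labellingD[OF lab]
  define A B H where "A j = {a j, a (Suc j)}" and "B j = {b j, b (Suc j)}" and "H j = {a j, b j}" for j
  have one: "(1 :: nat) \<in> {1..r}" "r \<in> {1..r}" using r by auto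
  have at: "\<exists>k\<in>{1..r}. e = A k \<or> e = B k \<or> e = H k" if "e \<in> E" "a j \<in> e" "j \<in> {1..r}" for e j
  proof -
    have "a j \<in> C" using that(3) by (simp add: C chain_vertices_def)
    then have "e \<in> F" using that F by blast
    then show ?thesis unfolding F' A_def B_def H_def by (elim UnE imageE) auto
  qed
  have inH: "k = j" if "a j \<in> H k" "j \<in> {1..r}" "k \<in> {1..r}" for j k
    using that D(1,3)[OF that(2,3)] by (auto simp: H_def)
  have inA: "k = j \<or> Suc k = j" if "a j \<in> A k" "j \<in> {1..r}" "k \<in> {1..r}" "Suc k \<in> {1..r}" for j k
    using that D(1)[OF that(2,3)] D(1)[OF that(2,4)] by (auto simp: A_def)
  have inB: "a j \<notin> B k" if "j \<in> {1..r}" "k \<in> {1..r}" "Suc k \<in> {1..r}" for j k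
    using D(3)[OF that(1,2)] D(3)[OF that(1,3)] by (auto simp: B_def)
  have inAr: "j = r \<or> j = 1 \<and> \<not> t" if "a j \<in> A r" "j \<in> {1..r}" for j
    using that D(1)[OF that(2) one(2)] D(1,3)[OF that(2) one(1)] by (auto simp: A_def next1 split: if_splits)
  have inBr: "j = 1 \<and> t" if "a j \<in> B r" "j \<in> {1..r}" for j
    using that D(3)[OF that(2) one(2)] D(1,3)[OF that(2) one(1)] by (auto simp: B_def next1 split: if_splits)
  have sum: "z x + z y + z w = 0" if "j \<in> {1..r}" "{e \<in> E. a j \<in> e} \<subseteq> {x, y, w}" for j x y w
  proof -
    have "a j \<in> C" using that(1) by (simp add: C chain_vertices_def)
    then have "degree E (a j) = 3" using deg by blast
    then show ?thesis using sum_at_cubic_vertex[OF _ that(2), of z] ker by (simp add: kern_def)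
  qed
  show "z {a (Suc j), a (Suc (Suc j))} + z {a j, a (Suc j)} + z {a (Suc j), b (Suc j)} = 0"
    if j: "j \<in> {1..<r}" for j
  proof -
    have j': "Suc j \<in> {1..r}" "Suc j \<noteq> 1" using j by auto
    have "{e \<in> E. a (Suc j) \<in> e} \<subseteq> {A (Suc j), A j, H (Suc j)}"
    proof
      fix e assume e: "e \<in> {e \<in> E. a (Suc j) \<in> e}"
      then obtain k where k: "k \<in> {1..r}" "e = A k \<or> e = B k \<or> e = H k" using at j'(1) by blast
      show "e \<in> {A (Suc j), A j, H (Suc j)}"
      proof (cases "k = r")
        case True
        then show ?thesis using e k(2) inAr[OF _ j'(1)] inBr[OF _ j'(1)] inH[OF _ j'(1) k(1)] j'(2) by auto
      next
        case False
        then have "Suc k \<in> {1..r}" using k(1) by auto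
        then show ?thesis using e k(2) inA[OF _ j'(1) k(1)] inB[OF j'(1) k(1)] inH[OF _ j'(1) k(1)] by auto
      qed
    qed
    then show ?thesis using sum[OF j'(1)] unfolding A_def H_def by blast
  qed
  let ?P = "if t then B r else A r"
  have "{e \<in> E. a 1 \<in> e} \<subseteq> {A 1, ?P, H 1}"
  proof
    fix e assume e: "e \<in> {e \<in> E. a 1 \<in> e}"
    then obtain k where k: "k \<in> {1..r}" "e = A k \<or> e = B k \<or> e = H k" using at one(1) by blast
    show "e \<in> {A 1, ?P, H 1}"
    proof (cases "k = r")
      case True
      then show ?thesis using e k(2) inAr[OF _ one(1)] inBr[OF _ one(1)] inH[OF _ one(1) k(1)] r by auto
    next
      case False
      then have "Suc k \<in> {1..r}" "Suc k \<noteq> 1" using k(1) by auto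
      then show ?thesis using e k(2) inA[OF _ one(1) k(1)] inB[OF one(1) k(1)] inH[OF _ one(1) k(1)] by auto
    qed
  qed
  then have "z (A 1) + z ?P + z (H 1) = 0" by (rule sum[OF one(1)])
  then show "z {a 1, a (Suc 1)} + z (if t then {b r, b (Suc r)} else {a r, a (Suc r)}) + z {a 1, b 1} = 0"
    unfolding A_def B_def H_def .
qed

text \<open>The equations at the two ends of a rung force the differences of the two rails to alternate
  along the ladder, and the parity makes this inconsistent with the closing step unless they all
  vanish.\<close>

lemma cyclic_ladder_balanced:
  assumes L: "cyclic_ladder t r a b C F" and deg: "\<forall>v\<in>C. degree E v = 3"
    and F: "\<forall>e\<in>E. e \<inter> C \<noteq> {} \<longrightarrow> e \<in> F"
    and ker: "kern E z" and i: "i \<in> {1..r}"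
  shows "z {a i, a (Suc i)} = z {b i, b (Suc i)}"
proof -
  have r: "r \<ge> 2" and t: "t \<longleftrightarrow> even r" using L by (simp_all add: cyclic_ladder_def)
  note sa = cyclic_ladder_vertex_sums[OF L deg F ker]
  note sb = cyclic_ladder_vertex_sums[OF cyclic_ladder_swap[OF L] deg F ker]
  define d where "d j = z {a j, a (Suc j)} - z {b j, b (Suc j)}" for j
  have rung: "{b j, a j} = {a j, b j}" for j by auto
  have step: "d (Suc j) = - d j" if "j \<in> {1..<r}" for j
    using sa(1)[OF that] sb(1)[OF that] unfolding d_def rung by linarith
  have close: "d 1 = (if t then 1 else - 1) * d r"
    using sa(2) sb(2) unfolding d_def rung by (cases t) auto
  have alt: "d (Suc j) = (- 1) ^ j * d 1" if "j < r" for j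
    using that by (induction j) (use step in auto)
  obtain s where s: "r = Suc s" using r by (cases r) auto
  have "d 1 = 0" using close alt[of s] t unfolding s by (cases t) auto
  then have "d i = 0" using alt[of "i - 1"] i by auto
  then show ?thesis by (simp add: d_def)
qed

lemma card_chain_vertices:
  assumes "chain_labelling r a b"
  shows "card (chain_vertices r a b) = 2 * r"
  using assms unfolding chain_vertices_def chain_labelling_def
  by (simp add: card_Un_disjoint card_image)

text \<open>Reachability is symmetric, so components are disjoint or equal.\<close>

lemma reach_eq:
  assumes "u \<in> reach E v"
  shows "reach E u = reach E v"
proof -
  have "sym (adjacency E)" by (auto simp: sym_def adjacency_def insert_commute)
  then have "(u, v) \<in> (adjacency E)\<^sup>*" using assms sym_rtrancl unfolding reach_def by (metis mem_Collect_eq symD)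
  then show ?thesis using assms unfolding reach_def by (auto intro: rtrancl_trans)
qed

text \<open>Each component has half as many squares as vertices.\<close>

lemma ladders_few_generators:
  assumes G: "simple_graph V E" and cubic: "\<And>v. v \<in> V \<Longrightarrow> degree E v = 3"
    and ladders: "\<And>v. v \<in> V \<Longrightarrow> \<exists>t r a b. cyclic_ladder t r a b (reach E v) (induced_edges E (reach E v))"
  shows "\<exists>S. finite S \<and> S \<subseteq> carrier (poly_ring E) \<and>
    Idl\<^bsub>poly_ring E\<^esub> S = (toric_ideal V E :: ('v set, 'k::field) mpoly set) \<and> 2 * card S \<le> card V"
proof -
  define CS where "CS = reach E ` V"
  have "\<forall>C\<in>CS. \<exists>t r a b. cyclic_ladder t r a b C (induced_edges E C)" using ladders by (auto simp: CS_def)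
  then obtain t r a b where L: "\<And>C. C \<in> CS \<Longrightarrow> cyclic_ladder (t C) (r C) (a C) (b C) C (induced_edges E C)"
    by metis
  have finV: "finite V" using G by (simp add: simple_graph_def)
  have same: "C = D" if "C \<in> CS" "D \<in> CS" "x \<in> C" "x \<in> D" for C D x
    using that reach_eq unfolding CS_def by (metis imageE)
  have CV: "C \<subseteq> V" if "C \<in> CS" for C using that reach_subset[OF G] by (auto simp: CS_def)
  have meets: "e \<in> induced_edges E C" if "e \<in> E" "e \<inter> C \<noteq> {}" "C \<in> CS" for e C
    using that edge_meets_reach[OF G that(1)] by (auto simp: CS_def induced_edges_def)
  have lab: "chain_labelling (r C) (a C) (b C)" and rC: "r C \<ge> 2"
    and vert: "C = chain_vertices (r C) (a C) (b C)"
    and next1: "a C (Suc (r C)) = (if t C then b C 1 else a C 1)" "b C (Suc (r C)) = (if t C then a C 1 else b C 1)"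
    and F: "induced_edges E C = (\<lambda>i. {a C i, a C (Suc i)}) ` {1..r C} \<union>
      (\<lambda>i. {b C i, b C (Suc i)}) ` {1..r C} \<union> (\<lambda>i. {a C i, b C i}) ` {1..r C}"
    if "C \<in> CS" for C using L[OF that] by (auto simp: cyclic_ladder_def)
  have inC: "a C i \<in> C" "b C i \<in> C" if "C \<in> CS" "i \<in> {1..r C}" for C i
    using vert[OF that(1)] that(2) unfolding chain_vertices_def by blast+
  have last: "{a C (Suc i), b C (Suc i)} \<in> (\<lambda>i. {a C i, b C i}) ` {1..r C}" if "C \<in> CS" "i \<in> {1..r C}" for C i
  proof (cases "i = r C")
    case True
    have "{a C (Suc i), b C (Suc i)} = {a C 1, b C 1}" using next1[OF that(1)] True by auto
    then show ?thesis using rC[OF that(1)] by auto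
  next
    case False
    then have "Suc i \<in> {1..r C}" using that(2) by auto
    then show ?thesis by blast
  qed
  define I where "I = Sigma CS (\<lambda>C. {1..r C})"
  define \<alpha> \<beta> \<gamma> \<delta> where "\<alpha> p = {a (fst p) (snd p), a (fst p) (Suc (snd p))}"
    and "\<beta> p = {b (fst p) (snd p), b (fst p) (Suc (snd p))}"
    and "\<gamma> p = {a (fst p) (snd p), b (fst p) (snd p)}"
    and "\<delta> p = {a (fst p) (Suc (snd p)), b (fst p) (Suc (snd p))}" for p
  define T where "T = \<gamma> ` I"
  have T_unique: "e = {a C i, b C i}" if e: "e \<in> T" "C \<in> CS" "i \<in> {1..r C}" "a C i \<in> e" for e C i
  proof -
    obtain D j where D: "D \<in> CS" "j \<in> {1..r D}" "e = {a D j, b D j}"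
      using e(1) by (auto simp: T_def I_def \<gamma>_def)
    have "a C i \<in> D" using e(4) D inC[OF D(1,2)] by auto
    then have CD: "C = D" using same[OF e(2) D(1) inC(1)[OF e(2,3)]] by blast
    have "a C i \<noteq> b C j" using chain_labellingD(3)[OF lab[OF e(2)] e(3)] D(2) CD by blast
    then have "a C i = a C j" using e(4) D(3) CD by auto
    then have "i = j" using chain_labellingD(1)[OF lab[OF e(2)] e(3)] D(2) CD by blast
    then show ?thesis using D(3) CD by simp
  qed
  have no_rail: "\<alpha> p \<notin> T" "\<beta> p \<notin> T" if p: "p \<in> I" for p
  proof -
    obtain C i where Ci: "p = (C, i)" "C \<in> CS" "i \<in> {1..r C}" using p by (auto simp: I_def)
    note dist = cyclic_ladder_distinct[OF L[OF Ci(2)] Ci(3)]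
    show "\<alpha> p \<notin> T"
    proof
      assume "\<alpha> p \<in> T"
      then have "\<alpha> p = {a C i, b C i}" using T_unique[OF _ Ci(2,3)] by (simp add: \<alpha>_def Ci(1))
      then show False using dist by (auto simp: \<alpha>_def Ci(1) doubleton_eq_iff)
    qed
    show "\<beta> p \<notin> T"
    proof
      assume "\<beta> p \<in> T"
      then obtain D j where D: "D \<in> CS" "j \<in> {1..r D}" "\<beta> p = {a D j, b D j}"
        by (auto simp: T_def I_def \<gamma>_def)
      have bi: "b C i \<in> {a D j, b D j}" unfolding D(3)[symmetric] by (simp add: \<beta>_def Ci(1))
      then have "b C i \<in> D" using inC[OF D(1,2)] by auto
      then have CD: "C = D" using same[OF Ci(2) D(1) inC(2)[OF Ci(2,3)]] by blast
      have jC: "j \<in> {1..r C}" using D(2) CD by simp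
      have "b C i \<noteq> a C j" using chain_labellingD(3)[OF lab[OF Ci(2)] jC Ci(3)] by metis
      then have "b C i = b C j" using bi CD by auto
      then have "j = i" using chain_labellingD(2)[OF lab[OF Ci(2)] Ci(3) jC] by blast
      then have "\<beta> p = {a C i, b C i}" using D(3) CD by simp
      then show False using dist by (auto simp: \<beta>_def Ci(1) doubleton_eq_iff)
    qed
  qed
  have rung_T: "{a C i, b C i} \<in> T" if "C \<in> CS" "i \<in> {1..r C}" for C i
    using that by (auto simp: T_def I_def \<gamma>_def intro!: image_eqI[of _ _ "(C, i)"])
  have at: "\<exists>C i. p = (C, i) \<and> C \<in> CS \<and> i \<in> {1..r C}" if "p \<in> I" for p
    using that by (auto simp: I_def)
  have edges: "{\<alpha> p, \<beta> p, \<gamma> p, \<delta> p} \<subseteq> E" if p: "p \<in> I" for p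
  proof -
    obtain C i where Ci: "p = (C, i)" "C \<in> CS" "i \<in> {1..r C}" using at[OF p] by blast
    have FE: "induced_edges E C \<subseteq> E" by (auto simp: induced_edges_def)
    have "{\<alpha> p, \<beta> p, \<gamma> p, \<delta> p} \<subseteq> induced_edges E C"
      using Ci(3) last[OF Ci(2,3)] unfolding F[OF Ci(2)] \<alpha>_def \<beta>_def \<gamma>_def \<delta>_def Ci(1) fst_conv snd_conv
      by blast
    then show ?thesis using FE by blast
  qed
  have square: "\<alpha> p \<inter> \<beta> p = {} \<and> \<gamma> p \<inter> \<delta> p = {} \<and> \<alpha> p \<union> \<beta> p = \<gamma> p \<union> \<delta> p" if p: "p \<in> I" for p
  proof -
    obtain C i where Ci: "p = (C, i)" "C \<in> CS" "i \<in> {1..r C}" using at[OF p] by blast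
    show ?thesis using cyclic_ladder_distinct[OF L[OF Ci(2)] Ci(3)]
      by (auto simp: \<alpha>_def \<beta>_def \<gamma>_def \<delta>_def Ci(1))
  qed
  have rails: "\<alpha> p \<notin> T \<and> \<beta> p \<notin> T \<and> \<gamma> p \<in> T \<and> \<delta> p \<in> T" if p: "p \<in> I" for p
  proof -
    obtain C i where Ci: "p = (C, i)" "C \<in> CS" "i \<in> {1..r C}" using at[OF p] by blast
    have "\<delta> p \<in> T" using last[OF Ci(2,3)] rung_T[OF Ci(2)] by (auto simp: \<delta>_def Ci(1))
    then show ?thesis using no_rail[OF p] p by (simp add: T_def)
  qed
  have balanced: "z (\<alpha> p) = z (\<beta> p)" if z: "kern E z" and p: "p \<in> I" for z p
  proof -
    obtain C i where Ci: "p = (C, i)" "C \<in> CS" "i \<in> {1..r C}" using at[OF p] by blast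
    have "\<forall>v\<in>C. degree E v = 3" using cubic CV[OF Ci(2)] by blast
    moreover have "\<forall>e\<in>E. e \<inter> C \<noteq> {} \<longrightarrow> e \<in> induced_edges E C" using meets Ci(2) by blast
    ultimately show ?thesis
      using cyclic_ladder_balanced[OF L[OF Ci(2)] _ _ z Ci(3)] by (simp add: \<alpha>_def \<beta>_def Ci(1))
  qed
  have cover: "\<exists>p\<in>I. e = \<alpha> p \<or> e = \<beta> p" if e: "e \<in> E" "e \<notin> T" for e
  proof -
    have "card e = 2" "e \<subseteq> V" using G e(1) by (auto simp: simple_graph_def)
    moreover from this have "e \<noteq> {}" by auto
    ultimately obtain v where v: "v \<in> e" "v \<in> V" by blast
    have C: "reach E v \<in> CS" using v by (simp add: CS_def)
    have "v \<in> e \<inter> reach E v" using v(1) by simp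
    then have "e \<inter> reach E v \<noteq> {}" by force
    then have "e \<in> induced_edges E (reach E v)" by (rule meets[OF e(1) _ C])
    then obtain i where i: "i \<in> {1..r (reach E v)}"
      "e = \<alpha> (reach E v, i) \<or> e = \<beta> (reach E v, i) \<or> e = {a (reach E v) i, b (reach E v) i}"
      unfolding F[OF C] \<alpha>_def \<beta>_def fst_conv snd_conv by blast
    then have "e = \<alpha> (reach E v, i) \<or> e = \<beta> (reach E v, i)" using e(2) rung_T[OF C i(1)] by blast
    then show ?thesis using i(1) C by (intro bexI[of _ "(reach E v, i)"]) (simp_all add: I_def)
  qed
  have matching: "\<exists>v\<in>e. \<forall>e'\<in>E. v \<in> e' \<longrightarrow> e' \<in> T \<longrightarrow> e' = e" if e: "e \<in> E" "e \<in> T" for e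
  proof -
    obtain C i where Ci: "C \<in> CS" "i \<in> {1..r C}" "e = {a C i, b C i}"
      using e(2) by (auto simp: T_def I_def \<gamma>_def)
    show ?thesis using T_unique[OF _ Ci(1,2)] Ci(3) by (intro bexI[of _ "a C i"]) auto
  qed
  note gen = squares_generate[OF G edges square rails cover matching balanced, where 'k = 'k]
  have finCS: "finite CS" using finV by (simp add: CS_def)
  then have finI: "finite I" by (simp add: I_def)
  have "2 * card I = (\<Sum>C\<in>CS. card C)"
    using finCS card_chain_vertices[OF lab] vert by (simp add: I_def sum_distrib_left)
  also have "\<dots> = card (\<Union> CS)"
  proof (rule card_Union_disjoint[symmetric])
    show "pairwise disjnt CS" using same unfolding pairwise_def disjnt_def by blast
    show "finite C" if "C \<in> CS" for C using CV[OF that] finV finite_subset by blast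
  qed
  also have "\<dots> \<le> card V" using CV finV by (intro card_mono) auto
  finally have "2 * card I \<le> card V" .
  then have "2 * card ((\<lambda>p. square_binomial (\<alpha> p) (\<beta> p) (\<gamma> p) (\<delta> p)) ` I :: ('v set, 'k) mpoly set) \<le> card V"
    using card_image_le[OF finI, of "\<lambda>p. square_binomial (\<alpha> p) (\<beta> p) (\<gamma> p) (\<delta> p) :: ('v set, 'k) mpoly"] by linarith
  moreover have "finite ((\<lambda>p. square_binomial (\<alpha> p) (\<beta> p) (\<gamma> p) (\<delta> p)) ` I :: ('v set, 'k) mpoly set)"
    using finI by simp
  ultimately show ?thesis using gen by blast
qed

section \<open>Cubic complete intersections\<close>

lemma complete_intersection_imp_bands:
  fixes V :: "'v set"
  assumes G: "simple_graph V E" and reg: "regular 3 V E"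
    and ci: "complete_intersection TYPE('k::field) V E" and v: "v \<in> V"
  shows "odd_band (reach E v) (induced_edges E (reach E v)) \<or>
    even_moebius_band (reach E v) (induced_edges E (reach E v))"
proof -
  let ?R = "poly_ring E :: ('v set, 'k) mpoly ring"
  let ?P = "toric_ideal V E :: ('v set, 'k) mpoly set"
  obtain B where B: "edge_basis E B" using edge_basis_exists[OF simple_graph_finite_edges[OF G]] by blast
  let ?q = "card (E - B)"
  have min: "min_generators ?R ?P = enat ?q"
    using ci toric_height[OF G B, where 'k='k] by (simp add: complete_intersection_def Let_def)
  have "\<exists>S. finite S \<and> S \<subseteq> carrier ?R \<and> Idl\<^bsub>?R\<^esub> S = ?P \<and> card S \<le> ?q"
  proof (rule ccontr)
    assume "\<not> ?thesis"
    then have "enat (Suc ?q) \<le> min_generators ?R ?P"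
      unfolding min_generators_def by (intro INF_greatest) (auto simp: not_le Suc_le_eq)
    then show False using min by simp
  qed
  then obtain S where S: "finite S" "S \<subseteq> carrier ?R" "Idl\<^bsub>?R\<^esub> S = ?P" "card S \<le> ?q" by blast
  have slots: "finite (slots E)" "card (slots E) \<le> ?q"
    using card_slots_le_generators[OF G S(1,2,3)] S(4) by auto
  note counts = ci_slot_counts[OF G reg B slots]
  interpret cubic_two_squares V E
  proof
    show "simple_graph V E" by (rule G)
    show "degree E v = 3" if "v \<in> V" for v using reg that by (simp add: regular_def)
    show "W1 = W2 \<or> W1 = W3 \<or> W2 = W3" if "v \<in> V" "W1 \<in> squares_at E v" "W2 \<in> squares_at E v"
      "W3 \<in> squares_at E v" for v W1 W2 W3
      by (rule ci_at_most_two_squares[OF G counts(3)[OF that(1)] that(2,3,4)])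
    show "\<exists>W1\<in>squares_at E v. \<exists>W2\<in>squares_at E v. W1 \<noteq> W2" if "v \<in> V" "\<not> k4_at E v" for v
      using ci_two_squares[OF G counts(3)[OF that(1)] counts(2)] that(2) by blast
  qed
  have not_bip: "\<not> (is_band r (reach E v) (induced_edges E (reach E v)) \<and> even r \<or>
      is_moebius_band r (reach E v) (induced_edges E (reach E v)) \<and> odd r)" for r
  proof
    assume "is_band r (reach E v) (induced_edges E (reach E v)) \<and> even r \<or>
      is_moebius_band r (reach E v) (induced_edges E (reach E v)) \<and> odd r"
    then obtain \<epsilon> :: "'v \<Rightarrow> rat" and v0 where "\<And>e. e \<in> E \<Longrightarrow> (\<Sum>v\<in>e. \<epsilon> v) = 0" "v0 \<in> V" "\<epsilon> v0 \<noteq> 0"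
      using bipartite_signing[OF G v] by metis
    moreover have "edge_indep E B" using B by (simp add: edge_basis_def)
    ultimately have "card B < card V" using edge_indep_card_less[OF G] by blast
    then show False using counts(1) corank_ge(2)[OF G reg B] by linarith
  qed
  then show ?thesis
    using component_is_band[OF v] unfolding odd_band_def even_moebius_band_def by blast
qed

lemma bands_imp_complete_intersection:
  fixes V :: "'v set"
  assumes G: "simple_graph V E" and reg: "regular 3 V E"
    and bands: "\<And>v. v \<in> V \<Longrightarrow> odd_band (reach E v) (induced_edges E (reach E v)) \<or>
      even_moebius_band (reach E v) (induced_edges E (reach E v))"
  shows "complete_intersection TYPE('k::field) V E"
proof -
  let ?R = "poly_ring E :: ('v set, 'k) mpoly ring"
  let ?P = "toric_ideal V E :: ('v set, 'k) mpoly set"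
  obtain B where B: "edge_basis E B" using edge_basis_exists[OF simple_graph_finite_edges[OF G]] by blast
  let ?q = "card (E - B)"
  have "\<exists>t r a b. cyclic_ladder t r a b (reach E v) (induced_edges E (reach E v))" if "v \<in> V" for v
    using bands[OF that] odd_band_cyclic_ladder even_moebius_band_cyclic_ladder by blast
  then obtain S where S: "finite S" "S \<subseteq> carrier ?R" "Idl\<^bsub>?R\<^esub> S = ?P" "2 * card S \<le> card V"
    using ladders_few_generators[OF G, where 'k='k] reg unfolding regular_def by blast
  have "card S \<le> ?q" using S(4) corank_ge(1)[OF G reg B] by linarith
  then have "min_generators ?R ?P \<le> enat ?q"
    unfolding min_generators_def using S by (intro INF_lower2[of S]) auto
  moreover have "enat ?q \<le> min_generators ?R ?P"
    unfolding min_generators_def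
  proof (rule INF_greatest)
    fix S assume "S \<in> {S. finite S \<and> S \<subseteq> carrier ?R \<and> Idl\<^bsub>?R\<^esub> S = ?P}"
    then have "finite (slots E)" "card (slots E) \<le> card S"
      using card_slots_le_generators[OF G, of S] by auto
    then show "enat ?q \<le> enat (card S)" using card_slots_ge[OF G B] by simp
  qed
  ultimately show ?thesis
    using toric_height[OF G B, where 'k='k] by (simp add: complete_intersection_def Let_def)
qed

theorem theorem4p4:
  fixes V :: "'v set" and E :: "'v set set"
  assumes "simple_graph V E"
    and "regular 3 V E"
  shows "complete_intersection TYPE('k::field) V E \<longleftrightarrow>
    (\<forall>(C, F) \<in> components V E. odd_band C F \<or> even_moebius_band C F)"
  using complete_intersection_imp_bands[OF assms] bands_imp_complete_intersection[OF assms]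
  unfolding components_eq by fast

end
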